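(* Let $H$ be a fixed graph which is either unicyclic or a tree with at least two edges. Then $f^-_H(n)=o\big(f^+_H(n)\big)$ as $n\to\infty$.
   Context: All graphs are finite and simple. A graph is unicyclic if it is connected and contains exactly one cycle. In the $(1:b)$ (strict) Avoider--Enforcer $H$-game on $K_n$ ($n,b$ positive integers, $H$ with at least two edges), Avoider and Enforcer alternately claim previously unclaimed edges of $K_n$, Avoider moving first. Avoider claims exactly one edge per turn and Enforcer claims exactly $b$ edges per turn; if strictly fewer than $b$ edges are unclaimed before a move of Enforcer, he claims all of them. The game ends when all edges are claimed. Avoider loses (Enforcer wins) if the graph of Avoider's edges then contains a copy of $H$; otherwise Avoider wins. The lower threshold $f^-_H(n)$ is the largest integer such that for every $b\le f^-_H(n)$ Enforcer has a winning strategy in the $(1:b)$ $H$-game on $K_n$. The upper threshold $f^+_H(n)$ is the largest integer $b$ such that Enforcer has a winning strategy in the $(1:b)$ $H$-game on $K_n$. (The separation conjecture for a connected graph $H$ with at least two edges is the assertion $f^-_H(n)=o(f^+_H(n))$.) *)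

theory Defs
  imports "HOL-Library.Landau_Symbols" "HOL-Library.Ramsey"
begin

section \<open>Finite simple graphs\<close>

text \<open>A graph is a pair of a finite vertex set and a set of two-element subsets of it;
  \<^term>\<open>nsets V 2\<close> is the set of all two-element subsets of \<^term>\<open>V\<close>.\<close>

definition simple_graph :: "'a set \<Rightarrow> 'a set set \<Rightarrow> bool" where
  "simple_graph V E \<longleftrightarrow> finite V \<and> E \<subseteq> nsets V 2"

definition connected_graph :: "'a set \<Rightarrow> 'a set set \<Rightarrow> bool" where
  "connected_graph V E \<longleftrightarrow>
     simple_graph V E \<and> V \<noteq> {} \<and> (\<forall>u\<in>V. \<forall>v\<in>V. (u, v) \<in> {(x, y). {x, y} \<in> E}\<^sup>*)"

definition cyclic_edges :: "'a list \<Rightarrow> 'a set set" where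
  "cyclic_edges vs = {{vs ! i, vs ! (Suc i mod length vs)} | i. i < length vs}"

text \<open>A cycle is a subgraph, not a closed walk with a base point and an orientation. As it has no
  isolated vertices it is represented by its edge set, so that the different cyclic vertex
  sequences traversing it count as one cycle.\<close>

definition is_cycle :: "'a set set \<Rightarrow> 'a set set \<Rightarrow> bool" where
  "is_cycle E C \<longleftrightarrow>
     C \<subseteq> E \<and> (\<exists>vs. distinct vs \<and> length vs \<ge> 3 \<and> C = cyclic_edges vs)"

definition unicyclic :: "'a set \<Rightarrow> 'a set set \<Rightarrow> bool" where
  "unicyclic V E \<longleftrightarrow> connected_graph V E \<and> (\<exists>!C. is_cycle E C)"

definition tree_graph :: "'a set \<Rightarrow> 'a set set \<Rightarrow> bool" where
  "tree_graph V E \<longleftrightarrow> connected_graph V E \<and> \<not> (\<exists>C. is_cycle E C)"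

text \<open>Copies are not required to be induced.\<close>

definition contains_copy :: "'b set \<Rightarrow> 'b set set \<Rightarrow> 'a set \<Rightarrow> 'a set set \<Rightarrow> bool" where
  "contains_copy W F V E \<longleftrightarrow>
     (\<exists>f. inj_on f V \<and> f ` V \<subseteq> W \<and> (\<forall>e\<in>E. f ` e \<in> F))"

section \<open>The strict Avoider--Enforcer game\<close>

abbreviation complete_edges :: "nat \<Rightarrow> nat set set" where
  "complete_edges n \<equiv> nsets {..<n} 2"

text \<open>A history lists the rounds played so far; a round consists of the edge claimed by Avoider
  followed by the set of edges claimed by Enforcer in reply.\<close>

type_synonym history = "(nat set \<times> nat set set) list"

definition avoider_edges :: "history \<Rightarrow> nat set set" where
  "avoider_edges h = fst ` set h"

definition enforcer_edges :: "history \<Rightarrow> nat set set" where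
  "enforcer_edges h = \<Union> (snd ` set h)"

definition unclaimed :: "nat \<Rightarrow> history \<Rightarrow> nat set set" where
  "unclaimed n h = complete_edges n - (avoider_edges h \<union> enforcer_edges h)"

text \<open>The minimum covers the rule that Enforcer claims all remaining edges if there are fewer
  than \<^term>\<open>b\<close>; it is zero if Avoider has just claimed the last edge.\<close>

definition legal_reply :: "nat \<Rightarrow> nat \<Rightarrow> history \<Rightarrow> nat set \<Rightarrow> nat set set \<Rightarrow> bool" where
  "legal_reply n b h a B \<longleftrightarrow>
     B \<subseteq> unclaimed n h - {a} \<and> card B = min b (card (unclaimed n h - {a}))"

inductive legal_history :: "nat \<Rightarrow> nat \<Rightarrow> history \<Rightarrow> bool" for n b where
  start: "legal_history n b []"
| round: "legal_history n b (h @ [(a, B)])"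
    if "legal_history n b h" "a \<in> unclaimed n h" "legal_reply n b h a B"

type_synonym enforcer_strategy = "history \<Rightarrow> nat set \<Rightarrow> nat set set"

definition legal_strategy :: "nat \<Rightarrow> nat \<Rightarrow> enforcer_strategy \<Rightarrow> bool" where
  "legal_strategy n b \<sigma> \<longleftrightarrow>
     (\<forall>h a. legal_history n b h \<and> a \<in> unclaimed n h \<longrightarrow> legal_reply n b h a (\<sigma> h a))"

definition follows :: "enforcer_strategy \<Rightarrow> history \<Rightarrow> bool" where
  "follows \<sigma> h \<longleftrightarrow> (\<forall>i < length h. snd (h ! i) = \<sigma> (take i h) (fst (h ! i)))"

definition enforcer_wins :: "'a set \<Rightarrow> 'a set set \<Rightarrow> nat \<Rightarrow> nat \<Rightarrow> bool" where
  "enforcer_wins V E n b \<longleftrightarrow>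
     (\<exists>\<sigma>. legal_strategy n b \<sigma> \<and>
       (\<forall>h. legal_history n b h \<and> unclaimed n h = {} \<and> follows \<sigma> h \<longrightarrow>
          contains_copy {..<n} (avoider_edges h) V E))"

text \<open>The bias ranges over positive integers. If Enforcer wins for no positive bias, the upper
  threshold is \<^term>\<open>0::nat\<close>; the lower threshold is \<^term>\<open>0::nat\<close> whenever Enforcer does not
  win with bias \<^term>\<open>1::nat\<close>. The maxima exist as soon as the graph has at least two edges,
  since Enforcer loses if his first move exhausts the board.\<close>

definition lower_threshold :: "'a set \<Rightarrow> 'a set set \<Rightarrow> nat \<Rightarrow> nat" where
  "lower_threshold V E n = (GREATEST k. \<forall>b. 1 \<le> b \<and> b \<le> k \<longrightarrow> enforcer_wins V E n b)"

definition upper_threshold :: "'a set \<Rightarrow> 'a set set \<Rightarrow> nat \<Rightarrow> nat" where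
  "upper_threshold V E n = (GREATEST b. b = 0 \<or> enforcer_wins V E n b)"

end

theory Submission
  imports Defs "HOL-Library.Disjoint_Sets"
begin

text \<open>Let \<open>k\<close> be the number of edges of \<open>H\<close> and \<open>N = n choose 2\<close>. Who wins depends on
  \<open>N mod (b + 1)\<close>, the number of edges left before Avoider's last move.

  If this remainder is at least \<open>(b + 1) / 2\<close>, Avoider wins for \<open>b\<close> of order \<open>n powr (1 + d)\<close> with
  \<open>1 / L < d \<le> 1 / (L - 1)\<close>: she always joins two components of minimal total size. As long as
  sizes below \<open>s\<close> are possible, the free edges are plentiful; once they are not, only about
  \<open>n (n / b) ^ (s - 1)\<close> moves remain. So components keep at most \<open>L\<close> vertices and she even
  avoids all cycles. Take \<open>L = k\<close> for a tree and \<open>L\<close> larger for a unicyclic graph.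

  If the remainder is positive and small, Enforcer wins for \<open>b\<close> of order \<open>n powr (1 + d)\<close> with
  \<open>d\<close> below \<open>1 / (k - 1)\<close> for a tree, and below \<open>1 / (2 k + 2)\<close> for a unicyclic graph. Vertices
  get roles in \<open>H\<close>. Enforcer keeps all edges between partial copies of \<open>H\<close> that could be merged,
  claims useless edges at once, and otherwise sacrifices edges between copies of two fixed adjacent
  parts. Every move of Avoider then enlarges a partial copy (or wastes a useless edge), so
  some larger pattern becomes frequent and replaces the current parts. Finally every free edge
  completes a copy of \<open>H\<close>. If two parts are joined by two edges of \<open>H\<close>, which happens only in
  the unicyclic case, these are sacrificed in pairs, and \<open>b\<close> is chosen even.\<close>

section \<open>Positional form of the game\<close>

text \<open>The obstacle is that Enforcer must claim exactly \<open>b\<close> edges in every full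
  round and so risks destroying the copies he wants to promote. Confining the damage to edges
  between two blocks of copies works only if these edges outlast the phase. Blocks of parts of
  weights \<open>w\<close> and \<open>w'\<close> have order \<open>\<mu> * \<eta> ^ w\<close> and
  \<open>\<mu> * \<eta> ^ w'\<close>, while choosing two parts of least total weight ensures that
  only about \<open>\<mu> * \<eta> ^ (w + w' + 1)\<close> moves of progress occur before some larger
  pattern is frequent. Each costs at most \<open>5 * b\<close> edges; equating both quantities
  forces \<open>\<eta>\<close> to be of order \<open>\<mu> / b\<close>, that is
  \<open>n / b\<close>. At the end an edge joining two parts gives a threat for each pair of copies,
  an edge closing the cycle only one for each copy. Hence the unicyclic case needs a much smaller
  remainder. With \<open>L = k\<close> for a tree and \<open>L = 2 * k + 3\<close> for a unicyclic
  graph, the exponents of both players cover the open interval from \<open>1 / L\<close> to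
  \<open>1 / (L - 1)\<close>; any two exponents from it separate the thresholds.\<close>

inductive enforcer_pos :: "nat \<Rightarrow> (nat set set \<Rightarrow> bool) \<Rightarrow> nat set set \<Rightarrow> nat set set \<Rightarrow> bool"
  for b P where
  finished: "P A \<Longrightarrow> enforcer_pos b P A {}"
| move: "U \<noteq> {} \<Longrightarrow>
    (\<And>a. a \<in> U \<Longrightarrow> \<exists>B. B \<subseteq> U - {a} \<and> card B = min b (card (U - {a})) \<and>
       enforcer_pos b P (insert a A) (U - {a} - B)) \<Longrightarrow> enforcer_pos b P A U"

lemma finite_complete_edges [simp]: "finite (complete_edges n)"
  by (simp add: finite_imp_finite_nsets)

lemma avoider_edges_Nil [simp]: "avoider_edges [] = {}"
  and avoider_edges_snoc [simp]: "avoider_edges (h @ [(a, B)]) = insert a (avoider_edges h)"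
  by (auto simp: avoider_edges_def)

lemma unclaimed_Nil [simp]: "unclaimed n [] = complete_edges n"
  and unclaimed_snoc [simp]: "unclaimed n (h @ [(a, B)]) = unclaimed n h - {a} - B"
  by (auto simp: unclaimed_def enforcer_edges_def avoider_edges_def)

lemma finite_unclaimed [simp]: "finite (unclaimed n h)"
  by (simp add: unclaimed_def)

lemma follows_snoc: "follows \<sigma> (h @ [(a, B)]) \<longleftrightarrow> follows \<sigma> h \<and> B = \<sigma> h a"
  unfolding follows_def by (auto simp: nth_append less_Suc_eq)

lemma legal_reply_exists: "\<exists>B. legal_reply n b h a B"
proof -
  have "finite (unclaimed n h - {a})" by simp
  then obtain B where "B \<subseteq> unclaimed n h - {a}" "card B = min b (card (unclaimed n h - {a}))"
    by (metis min.cobounded2 obtain_subset_with_card_n)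
  then show ?thesis by (auto simp: legal_reply_def)
qed

text \<open>Choose at every history a legal reply that keeps a positional win if there is one.
  Legality is demanded separately because \<open>legal_strategy\<close> also covers histories on
  which the strategy was not followed. Later arguments then only have to exhibit one reply to each
  move.\<close>

lemma enforcer_wins_if_enforcer_pos:
  assumes "enforcer_pos b (\<lambda>A. contains_copy {..<n} A V E) {} (complete_edges n)"
  shows "enforcer_wins V E n b"
proof -
  let ?P = "\<lambda>A. contains_copy {..<n} A V E"
  define pos where "pos h = enforcer_pos b ?P (avoider_edges h) (unclaimed n h)" for h
  define good where "good h a B \<longleftrightarrow> legal_reply n b h a B \<and> (pos h \<longrightarrow> pos (h @ [(a, B)]))" for h a B
  define \<sigma> where "\<sigma> h a = (SOME B. good h a B)" for h a
  have good: "good h a (\<sigma> h a)" if a: "a \<in> unclaimed n h" for h a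
  proof -
    have "\<exists>B. good h a B"
    proof (cases "pos h")
      case True
      then have "enforcer_pos b ?P (avoider_edges h) (unclaimed n h)"
        by (simp add: pos_def)
      then show ?thesis
      proof cases
        case finished
        then show ?thesis using a by simp
      next
        case move
        then show ?thesis using a by (auto simp: good_def pos_def legal_reply_def)
      qed
    next
      case False
      then show ?thesis using legal_reply_exists by (auto simp: good_def)
    qed
    then show ?thesis unfolding \<sigma>_def by (rule someI_ex)
  qed
  have "legal_strategy n b \<sigma>"
    using good by (auto simp: legal_strategy_def good_def)
  moreover have "pos h" if "legal_history n b h" "follows \<sigma> h" for h
    using that
  proof (induction rule: legal_history.induct)
    case start
    then show ?case using assms by (simp add: pos_def)
  next
    case (round h a B)
    then have "B = \<sigma> h a" "pos h" by (simp_all add: follows_snoc)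
    then show ?case using good[OF round.hyps(2)] by (simp add: good_def)
  qed
  then have "?P (avoider_edges h)"
    if "legal_history n b h" "follows \<sigma> h" "unclaimed n h = {}" for h
    using that unfolding pos_def by (metis enforcer_pos.simps)
  ultimately show ?thesis unfolding enforcer_wins_def by blast
qed

text \<open>Against a fixed winning strategy, Avoider's choices maintaining \<open>I\<close> produce
  a complete history that follows it and yet, by \<open>final\<close>, contains no copy. The step
  must tolerate every legal reply, since nothing is known about the strategy.\<close>

lemma not_enforcer_wins_if_invariant:
  assumes start: "I {} (complete_edges n)"
    and step: "\<And>A U. I A U \<Longrightarrow> U \<noteq> {} \<Longrightarrow> U \<subseteq> complete_edges n \<Longrightarrow>
       \<exists>a\<in>U. \<forall>B. B \<subseteq> U - {a} \<and> card B = min b (card (U - {a})) \<longrightarrow> I (insert a A) (U - {a} - B)"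
    and final: "\<And>A. I A {} \<Longrightarrow> \<not> contains_copy {..<n} A V E"
  shows "\<not> enforcer_wins V E n b"
proof
  assume "enforcer_wins V E n b"
  then obtain \<sigma> where \<sigma>: "legal_strategy n b \<sigma>"
    and win: "\<And>h. legal_history n b h \<Longrightarrow> unclaimed n h = {} \<Longrightarrow> follows \<sigma> h \<Longrightarrow>
          contains_copy {..<n} (avoider_edges h) V E"
    unfolding enforcer_wins_def by blast
  have "False" if "legal_history n b h" "follows \<sigma> h" "I (avoider_edges h) (unclaimed n h)" for h
    using that
  proof (induction "card (unclaimed n h)" arbitrary: h rule: less_induct)
    case less
    show ?case
    proof (cases "unclaimed n h = {}")
      case True
      then show ?thesis using less.prems win final by fastforce
    next
      case False
      have "unclaimed n h \<subseteq> complete_edges n" by (auto simp: unclaimed_def)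
      then obtain a where a: "a \<in> unclaimed n h"
        and aB: "\<And>B. B \<subseteq> unclaimed n h - {a} \<Longrightarrow> card B = min b (card (unclaimed n h - {a})) \<Longrightarrow>
            I (insert a (avoider_edges h)) (unclaimed n h - {a} - B)"
        using step[OF less.prems(3) False] by blast
      let ?h = "h @ [(a, \<sigma> h a)]"
      have reply: "legal_reply n b h a (\<sigma> h a)"
        using \<sigma> a less.prems(1) by (auto simp: legal_strategy_def)
      show ?thesis
      proof (rule less.hyps[of ?h])
        show "card (unclaimed n ?h) < card (unclaimed n h)"
          using a by (auto intro!: psubset_card_mono)
        show "legal_history n b ?h"
          using less.prems(1) a reply by (rule legal_history.round)
        show "follows \<sigma> ?h" using less.prems(2) by (simp add: follows_snoc)
        show "I (avoider_edges ?h) (unclaimed n ?h)"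
          using aB reply by (simp add: legal_reply_def)
      qed
    qed
  qed
  from this[of "[]"] start show False
    by (simp add: legal_history.start follows_def)
qed

text \<open>Truncated subtraction also covers the last round, where Enforcer takes all that is left.
  Full rounds keep the residue of the number of free edges modulo \<open>b + 1\<close>.\<close>

lemma card_after_round:
  assumes "finite U" "a \<in> U" "B \<subseteq> U - {a}" "card B = min b (card (U - {a}))"
  shows "card (U - {a} - B) = card U - (b + 1)"
proof -
  have "card (U - {a} - B) = card (U - {a}) - card B"
    using assms by (meson card_Diff_subset finite_Diff finite_subset)
  then show ?thesis using assms by simp
qed

section \<open>Avoider keeps all components small\<close>

text \<open>Acyclicity as an inequality: a forest has \<open>card S\<close> minus the number of
  components of its subgraph on \<open>S\<close> edges inside \<open>S\<close>, and at least as many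
  components there as parts meet \<open>S\<close>. This survives a merge by one edge, since an edge
  inside \<open>S\<close> is gained only when two parts meeting \<open>S\<close> become one.\<close>

definition forest_partition :: "nat \<Rightarrow> nat set set \<Rightarrow> nat set set \<Rightarrow> bool" where
  "forest_partition n A PP \<longleftrightarrow> partition_on {..<n} PP \<and> (\<forall>e\<in>A. \<exists>X\<in>PP. e \<subseteq> X) \<and>
     (\<forall>S\<subseteq>{..<n}. card {e\<in>A. e \<subseteq> S} + card {X\<in>PP. X \<inter> S \<noteq> {}} \<le> card S)"

definition crossing :: "nat set set \<Rightarrow> nat set set \<Rightarrow> nat \<Rightarrow> bool" where
  "crossing U PP s \<longleftrightarrow>
     (\<exists>X\<in>PP. \<exists>Y\<in>PP. X \<noteq> Y \<and> card X + card Y = s \<and> (\<exists>u\<in>X. \<exists>v\<in>Y. {u, v} \<in> U))"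

definition large_parts :: "nat set set \<Rightarrow> nat \<Rightarrow> nat" where
  "large_parts PP s = card {X\<in>PP. s \<le> card X}"

text \<open>The recursion adds up the rounds left, in units of \<open>n * (n / b) ^ (s - 1)\<close>:
  1 for rounding up, \<open>s\<close> for edges inside parts, and the sum for edges between parts of
  size at least \<open>i\<close> and at least \<open>s - i\<close>. There each of the two vertex
  sets costs a factor \<open>s\<close>, as all parts are smaller than \<open>s\<close>.\<close>

fun avoider_const :: "nat \<Rightarrow> real" where
  "avoider_const s = (if s \<le> 1 then 1 else
     1 + real s + (real s)\<^sup>2 * (\<Sum>i\<in>{1..<s}. avoider_const i * avoider_const (s - i)))"

declare avoider_const.simps [simp del]

lemma avoider_const_ge_1: "1 \<le> avoider_const s"
proof (induction s rule: less_induct)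
  case (less s)
  have "0 \<le> (\<Sum>i\<in>{1..<s}. avoider_const i * avoider_const (s - i))"
    by (rule sum_nonneg) (use less.IH in \<open>force intro!: mult_nonneg_nonneg intro: order_trans[of 0 1]\<close>)
  then show ?case by (subst avoider_const.simps) auto
qed

lemma finite_partition_of: "partition_on {..<n::nat} PP \<Longrightarrow> finite PP"
  by (meson finite_elements finite_lessThan)

lemma partition_part_finite: "partition_on {..<n::nat} PP \<Longrightarrow> X \<in> PP \<Longrightarrow> finite X"
  by (metis finite_lessThan finite_subset partition_onD1 Union_upper)

lemma partition_disjoint: "partition_on A PP \<Longrightarrow> X \<in> PP \<Longrightarrow> Y \<in> PP \<Longrightarrow> X \<noteq> Y \<Longrightarrow> X \<inter> Y = {}"
  by (metis partition_onD2 disjointD)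

lemma partition_merge:
  assumes "partition_on A PP" "X \<in> PP" "Y \<in> PP" "X \<noteq> Y"
  shows "partition_on A (insert (X \<union> Y) (PP - {X, Y}))"
proof (rule partition_onI)
  show "{} \<notin> insert (X \<union> Y) (PP - {X, Y})"
    using assms partition_onD3 by fastforce
  show "\<Union> (insert (X \<union> Y) (PP - {X, Y})) = A"
    using assms partition_onD1[OF assms(1)] by blast
  show "disjnt p q"
    if "p \<in> insert (X \<union> Y) (PP - {X, Y})" "q \<in> insert (X \<union> Y) (PP - {X, Y})" "p \<noteq> q" for p q
    using that partition_disjoint[OF assms(1)] assms(2,3) unfolding disjnt_def by (auto 4 3)
qed

lemma forest_partition_merge:
  assumes F: "forest_partition n A PP" and X: "X \<in> PP" and Y: "Y \<in> PP" and XY: "X \<noteq> Y"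
    and u: "u \<in> X" and v: "v \<in> Y" and A: "A \<subseteq> complete_edges n"
  shows "forest_partition n (insert {u, v} A) (insert (X \<union> Y) (PP - {X, Y}))"
proof -
  have P: "partition_on {..<n} PP" using F by (simp add: forest_partition_def)
  let ?PP = "insert (X \<union> Y) (PP - {X, Y})"
  have fin: "finite PP" using P finite_partition_of by blast
  have disj: "X \<inter> Y = {}" using partition_disjoint[OF P X Y XY] .
  have "partition_on {..<n} ?PP" by (rule partition_merge[OF P X Y XY])
  moreover have "\<exists>Z\<in>?PP. e \<subseteq> Z" if "e \<in> insert {u, v} A" for e
  proof (cases "e = {u, v}")
    case True
    then show ?thesis using u v by auto
  next
    case False
    then have "e \<in> A" using that by blast
    then obtain Z where "Z \<in> PP" "e \<subseteq> Z"
      using F unfolding forest_partition_def by blast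
    then show ?thesis by (cases "Z = X \<or> Z = Y") auto
  qed
  moreover have "card {e\<in>insert {u, v} A. e \<subseteq> S} + card {Z\<in>?PP. Z \<inter> S \<noteq> {}} \<le> card S"
    if S: "S \<subseteq> {..<n}" for S
  proof -
    have finA: "finite {e\<in>A. e \<subseteq> S}" 
      using finite_subset[OF A finite_complete_edges] by simp
    have old: "card {e\<in>A. e \<subseteq> S} + card {Z\<in>PP. Z \<inter> S \<noteq> {}} \<le> card S"
      using F S by (simp add: forest_partition_def)
    let ?R = "{Z\<in>PP - {X, Y}. Z \<inter> S \<noteq> {}}"
    have finR: "finite ?R" using fin by auto
    have new_le: "card {Z\<in>?PP. Z \<inter> S \<noteq> {}} \<le> card ?R + (if (X \<union> Y) \<inter> S \<noteq> {} then 1 else 0)"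
    proof -
      have "{Z\<in>?PP. Z \<inter> S \<noteq> {}} \<subseteq> (if (X \<union> Y) \<inter> S \<noteq> {} then insert (X \<union> Y) ?R else ?R)" by auto
      then have "card {Z\<in>?PP. Z \<inter> S \<noteq> {}} \<le> card (if (X \<union> Y) \<inter> S \<noteq> {} then insert (X \<union> Y) ?R else ?R)"
        by (rule card_mono[rotated]) (use finR in auto)
      also have "\<dots> \<le> card ?R + (if (X \<union> Y) \<inter> S \<noteq> {} then 1 else 0)"
        using finR by (simp add: card_insert_if)
      finally show ?thesis .
    qed
    have old_eq: "card {Z\<in>PP. Z \<inter> S \<noteq> {}} =
        card ?R + (if X \<inter> S \<noteq> {} then 1 else 0) + (if Y \<inter> S \<noteq> {} then 1 else 0)"
    proof -
      have "{Z\<in>PP. Z \<inter> S \<noteq> {}} =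
          ?R \<union> ((if X \<inter> S \<noteq> {} then {X} else {}) \<union> (if Y \<inter> S \<noteq> {} then {Y} else {}))"
        using X Y by auto
      also have "card \<dots> = card ?R + card ((if X \<inter> S \<noteq> {} then {X} else {}) \<union> (if Y \<inter> S \<noteq> {} then {Y} else {}))"
        by (rule card_Un_disjoint) (use finR in auto)
      finally show ?thesis using XY by auto
    qed
    show ?thesis
    proof (cases "{u, v} \<subseteq> S")
      case True
      have "{e\<in>insert {u, v} A. e \<subseteq> S} \<subseteq> insert {u, v} {e\<in>A. e \<subseteq> S}" by auto
      then have "card {e\<in>insert {u, v} A. e \<subseteq> S} \<le> card (insert {u, v} {e\<in>A. e \<subseteq> S})"
        by (rule card_mono[rotated]) (use finA in auto)
      also have "\<dots> \<le> card {e\<in>A. e \<subseteq> S} + 1"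
        by (simp add: card_insert_if finA)
      finally have "card {e\<in>insert {u, v} A. e \<subseteq> S} \<le> card {e\<in>A. e \<subseteq> S} + 1" .
      moreover have "X \<inter> S \<noteq> {}" "Y \<inter> S \<noteq> {}" using True u v by auto
      ultimately show ?thesis using old old_eq new_le by (auto split: if_splits)
    next
      case False
      then have "{e\<in>insert {u, v} A. e \<subseteq> S} = {e\<in>A. e \<subseteq> S}" by auto
      then show ?thesis using old old_eq new_le by (auto split: if_splits simp: Int_Un_distrib2)
    qed
  qed
  ultimately show ?thesis unfolding forest_partition_def by blast
qed

text \<open>If every crossing edge joins parts of total size at least \<open>s\<close>, its end in a part of
  size \<open>i\<close> meets a vertex in a part of size at least \<open>s - i\<close>.\<close>

lemma card_unclaimed_le:
  assumes P: "partition_on {..<n} PP" and U: "U \<subseteq> complete_edges n"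
    and small: "\<And>X. X \<in> PP \<Longrightarrow> card X < s"
    and min: "\<And>t. crossing U PP t \<Longrightarrow> s \<le> t"
    and M: "\<And>j. 1 \<le> j \<Longrightarrow> j < s \<Longrightarrow> real (large_parts PP j) \<le> M j"
  shows "real (card U) \<le> real n * real s + (real s)\<^sup>2 * (\<Sum>i\<in>{1..<s}. M i * M (s - i))"
proof -
  define part where "part u = (THE X. X \<in> PP \<and> u \<in> X)" for u
  have part: "part u \<in> PP \<and> u \<in> part u" if "u < n" for u
  proof -
    have "\<exists>!X. X \<in> PP \<and> u \<in> X"
      using P that partition_disjoint[OF P] partition_onD1[OF P] by blast
    then show ?thesis unfolding part_def by (rule theI')
  qed
  have finp: "finite (part u)" if "u < n" for u using part[OF that] P partition_part_finite by blast
  define W where "W j = \<Union> {X\<in>PP. j \<le> card X}" for j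
  have finPP: "finite PP" using P finite_partition_of by blast
  have finW: "finite (W j)" for j
    unfolding W_def using finPP partition_part_finite[OF P] by auto
  have cardW: "real (card (W j)) \<le> real s * M j" if "1 \<le> j" "j < s" for j
  proof -
    have "card (W j) \<le> sum card {X\<in>PP. j \<le> card X}"
      unfolding W_def by (rule card_Union_le_sum_card)
    also have "\<dots> \<le> card {X\<in>PP. j \<le> card X} * s"
      using sum_bounded_above[of "{X\<in>PP. j \<le> card X}" card s] small by force
    finally have "real (card (W j)) \<le> real (large_parts PP j) * real s"
      unfolding large_parts_def by (metis of_nat_le_iff of_nat_mult)
    also have "\<dots> \<le> M j * real s" using M[OF that] by (rule mult_right_mono) simp
    finally show ?thesis by (simp add: mult.commute)
  qed
  let ?e = "\<lambda>(u, v). {u, v :: nat}"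
  let ?In = "?e ` Sigma {..<n} part"
  let ?C = "\<lambda>i. ?e ` (W i \<times> W (s - i))"
  have sub: "U \<subseteq> ?In \<union> (\<Union>i\<in>{1..<s}. ?C i)"
  proof
    fix e assume e: "e \<in> U"
    then have "e \<in> complete_edges n" using U by blast
    then obtain u v where uv: "e = {u, v}" "u < n" "v < n" "u \<noteq> v"
      by (auto simp: nsets_def card_2_iff)
    show "e \<in> ?In \<union> (\<Union>i\<in>{1..<s}. ?C i)"
    proof (cases "part u = part v")
      case True
      then have "(u, v) \<in> Sigma {..<n} part" using uv part by auto
      then show ?thesis using uv by force
    next
      case False
      have "crossing U PP (card (part u) + card (part v))"
        unfolding crossing_def using part[OF uv(2)] part[OF uv(3)] uv(1) e False by blast
      then have ge: "s \<le> card (part u) + card (part v)" by (rule min)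
      let ?i = "card (part u)"
      have i: "1 \<le> ?i" "?i < s"
        using part[OF uv(2)] small finp[OF uv(2)] by (auto simp: Suc_le_eq card_gt_0_iff)
      have "u \<in> W ?i" using part[OF uv(2)] unfolding W_def by blast
      moreover have "v \<in> W (s - ?i)" using part[OF uv(3)] ge unfolding W_def by auto
      ultimately have "e \<in> ?C ?i" using uv by force
      then show ?thesis using i by auto
    qed
  qed
  have fin_In: "finite ?In" using finp by auto
  have fin_C: "finite (?C i)" for i using finW by auto
  have card_In: "card ?In \<le> n * s"
  proof -
    have "card ?In \<le> card (Sigma {..<n} part)" by (rule card_image_le) (use finp in auto)
    also have "\<dots> = (\<Sum>u<n. card (part u))" by (rule card_SigmaI) (use finp in auto)
    also have "\<dots> \<le> (\<Sum>u<n. s)"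
      using part small by (intro sum_mono) (simp add: less_imp_le)
    finally show ?thesis by simp
  qed
  have card_C: "real (card (?C i)) \<le> (real s)\<^sup>2 * (M i * M (s - i))" if "i \<in> {1..<s}" for i
  proof -
    have "card (?C i) \<le> card (W i \<times> W (s - i))" by (rule card_image_le) (use finW in auto)
    then have "real (card (?C i)) \<le> real (card (W i)) * real (card (W (s - i)))"
      by (metis card_cartesian_product of_nat_le_iff of_nat_mult)
    also have "\<dots> \<le> (real s * M i) * (real s * M (s - i))"
      using that by (intro mult_mono cardW order_trans[OF of_nat_0_le_iff cardW[of i]]) auto
    finally show ?thesis by (simp add: power2_eq_square mult_ac)
  qed
  have "card U \<le> card (?In \<union> (\<Union>i\<in>{1..<s}. ?C i))"
    by (rule card_mono[OF _ sub]) (use fin_In fin_C in auto)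
  also have "\<dots> \<le> card ?In + card (\<Union>i\<in>{1..<s}. ?C i)" by (rule card_Un_le)
  also have "\<dots> \<le> n * s + (\<Sum>i\<in>{1..<s}. card (?C i))"
    by (intro add_mono card_In card_UN_le) auto
  finally have "real (card U) \<le> real (n * s + (\<Sum>i\<in>{1..<s}. card (?C i)))"
    by (rule of_nat_mono)
  also have "\<dots> = real n * real s + (\<Sum>i\<in>{1..<s}. real (card (?C i)))" by simp
  also have "\<dots> \<le> real n * real s + (\<Sum>i\<in>{1..<s}. (real s)\<^sup>2 * (M i * M (s - i)))"
    by (intro add_left_mono sum_mono card_C)
  finally show ?thesis unfolding sum_distrib_left .
qed

text \<open>If about \<open>n * (n / b) ^ (j - 1)\<close> parts have at least \<open>j\<close>
  vertices for all \<open>j < s\<close>, then about \<open>n ^ 2 * (n / b) ^ (s - 2)\<close> edges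
  are free once no smaller merge is possible; dividing by \<open>b\<close> gives this number of
  rounds. For \<open>s = 1\<close> it is the trivial bound \<open>n\<close> on the number of
  parts.\<close>

definition avoider_bound :: "nat \<Rightarrow> nat \<Rightarrow> nat \<Rightarrow> real" where
  "avoider_bound n b s = avoider_const s * real n * (real n / real b) ^ (s - 1)"

text \<open>All summands become multiples of the same power, because the exponents
  \<open>i - 1\<close> and \<open>s - i - 1\<close> add up to \<open>s - 2\<close>. The constant is
  what the recursion of \<open>avoider_const\<close> leaves after its first two terms.\<close>

lemma card_unclaimed_le':
  assumes P: "partition_on {..<n} PP" and U: "U \<subseteq> complete_edges n" and s: "2 \<le> s"
    and small: "\<And>X. X \<in> PP \<Longrightarrow> card X < s"
    and min: "\<And>t. crossing U PP t \<Longrightarrow> s \<le> t"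
    and M: "\<And>j. 2 \<le> j \<Longrightarrow> j < s \<Longrightarrow> real (large_parts PP j) \<le> avoider_bound n b j"
  shows "real (card U) \<le> real n * real s +
     (avoider_const s - 1 - real s) * ((real n)\<^sup>2 * (real n / real b) ^ (s - 2))"
proof -
  let ?th = "real n / real b"
  \<comment> \<open>The hypothesis \<open>M\<close> starts at size 2; at size 1 the bound is that
    there are at most \<open>n\<close> disjoint nonempty parts.\<close>
  have card_PP: "card PP \<le> n"
  proof -
    have "card PP = (\<Sum>X\<in>PP. 1)" by simp
    also have "\<dots> \<le> (\<Sum>X\<in>PP. card X)"
    proof (rule sum_mono)
      fix X assume X: "X \<in> PP"
      then have "X \<noteq> {}" using P partition_onD3 by metis
      then show "1 \<le> card X" using partition_part_finite[OF P X] by (simp add: Suc_le_eq card_gt_0_iff)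
    qed
    also have "\<dots> = card (\<Union>PP)"
      by (rule card_Union_disjoint[symmetric])
        (use partition_disjoint[OF P] partition_part_finite[OF P] in \<open>auto simp: pairwise_def disjnt_def\<close>)
    finally show ?thesis by (simp flip: partition_onD1[OF P])
  qed
  have "real (card U) \<le> real n * real s +
      (real s)\<^sup>2 * (\<Sum>i\<in>{1..<s}. avoider_bound n b i * avoider_bound n b (s - i))"
  proof (rule card_unclaimed_le[OF P U small min])
    fix j assume j: "1 \<le> j" "j < s"
    show "real (large_parts PP j) \<le> avoider_bound n b j"
    proof (cases "j = 1")
      case True
      have "large_parts PP 1 \<le> card PP"
        unfolding large_parts_def using finite_partition_of[OF P] by (intro card_mono) auto
      then show ?thesis using card_PP True
        by (simp add: avoider_bound_def avoider_const.simps[of "Suc 0"])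
    next
      case False
      then show ?thesis using j M by simp
    qed
  qed
  also have "(\<Sum>i\<in>{1..<s}. avoider_bound n b i * avoider_bound n b (s - i)) =
      (\<Sum>i\<in>{1..<s}. avoider_const i * avoider_const (s - i)) * ((real n)\<^sup>2 * ?th ^ (s - 2))"
    unfolding sum_distrib_right
  proof (rule sum.cong[OF refl])
    fix i assume i: "i \<in> {1..<s}"
    then have "i - 1 + (s - i - 1) = s - 2" by auto
    then have "?th ^ (s - 2) = ?th ^ (i - 1) * ?th ^ (s - i - 1)" by (metis power_add)
    then show "avoider_bound n b i * avoider_bound n b (s - i) =
        avoider_const i * avoider_const (s - i) * ((real n)\<^sup>2 * ?th ^ (s - 2))"
      unfolding avoider_bound_def by (simp add: power2_eq_square mult_ac)
  qed
  also have "(real s)\<^sup>2 * ((\<Sum>i\<in>{1..<s}. avoider_const i * avoider_const (s - i)) * ((real n)\<^sup>2 * ?th ^ (s - 2)))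
     = (avoider_const s - 1 - real s) * ((real n)\<^sup>2 * ?th ^ (s - 2))"
    using s by (subst avoider_const.simps[of s]) (simp add: mult_ac)
  finally show ?thesis .
qed

section \<open>How a round changes the parts and the number of rounds left\<close>

lemma large_parts_merge:
  assumes P: "partition_on {..<n} PP" and X: "X \<in> PP" and Y: "Y \<in> PP" and XY: "X \<noteq> Y"
  shows "large_parts (insert (X \<union> Y) (PP - {X, Y})) s
     \<le> large_parts PP s + (if s \<le> card X + card Y then 1 else 0)"
proof -
  have fin: "finite PP" using P finite_partition_of by blast
  have card: "card (X \<union> Y) = card X + card Y"
    using partition_disjoint[OF P X Y XY] partition_part_finite[OF P] X Y by (simp add: card_Un_disjoint)
  let ?L = "{Z\<in>PP. s \<le> card Z}"
  have "{Z\<in>insert (X \<union> Y) (PP - {X, Y}). s \<le> card Z} \<subseteq>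
      (if s \<le> card X + card Y then insert (X \<union> Y) ?L else ?L)" using card by auto
  then have "large_parts (insert (X \<union> Y) (PP - {X, Y})) s \<le>
      card (if s \<le> card X + card Y then insert (X \<union> Y) ?L else ?L)"
    unfolding large_parts_def by (rule card_mono[rotated]) (use fin in auto)
  also have "\<dots> \<le> card ?L + (if s \<le> card X + card Y then 1 else 0)"
    using fin by (simp add: card_insert_if)
  finally show ?thesis by (simp add: large_parts_def)
qed

text \<open>The ceiling of \<open>m / (b + 1)\<close>: the number of moves Avoider still has to
  make, the last round possibly being incomplete.\<close>

definition rounds_left :: "nat \<Rightarrow> nat \<Rightarrow> nat" where
  "rounds_left b m = (m + b) div (b + 1)"

lemma rounds_left_step: "0 < m \<Longrightarrow> rounds_left b (m - (b + 1)) + 1 = rounds_left b m"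
proof (cases "b + 1 \<le> m")
  case True
  then have "m + b = (m - (b + 1) + b) + (b + 1)" by simp
  then show ?thesis
    unfolding rounds_left_def using div_add_self2[of "b + 1" "m - (b + 1) + b"] by simp
next
  case False
  assume "0 < m"
  with False have "(m + b) div (b + 1) = 1" by (intro div_nat_eqI) auto
  then show ?thesis using False by (simp add: rounds_left_def)
qed

lemma rounds_left_le:
  assumes "0 < b"
  shows "real (rounds_left b m) \<le> 1 + real m / real b"
proof -
  have "real (rounds_left b m) \<le> real (m + b) / real (b + 1)"
    unfolding rounds_left_def by (rule of_nat_div_le_of_nat)
  also have "\<dots> \<le> real (m + b) / real b"
    using assms by (intro divide_left_mono) auto
  also have "\<dots> = 1 + real m / real b" using assms by (simp add: add_divide_distrib)
  finally show ?thesis .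
qed

text \<open>The potential of the argument: once components with \<open>s\<close> vertices appear, their number plus
  the number of rounds left does not increase any more.\<close>

definition avoider_inv :: "nat \<Rightarrow> nat \<Rightarrow> nat \<Rightarrow> nat set set \<Rightarrow> nat set set \<Rightarrow> bool" where
  "avoider_inv n b L A U \<longleftrightarrow> A \<subseteq> complete_edges n \<and> U \<subseteq> complete_edges n \<and>
     (U = {} \<or> b + 1 \<le> 2 * (card U mod (b + 1))) \<and>
     (\<exists>PP. forest_partition n A PP \<and> (\<forall>X\<in>PP. card X \<le> L) \<and>
       (\<forall>s\<in>{2..L}. large_parts PP s = 0 \<or>
          real (large_parts PP s) + real (rounds_left b (card U)) \<le> avoider_bound n b s))"

text \<open>Avoider joins two parts of least total size \<open>t\<close>. A merge of size at most
  \<open>L\<close> exists, for otherwise \<open>big\<close> leaves at most \<open>b / 2\<close> free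
  edges, fewer than the remainder. Counts at sizes above \<open>t\<close> do not grow. At sizes up
  to \<open>t\<close> a new part is paid for by the round just played or, if it is the first of its
  size, by the counting bound.\<close>

lemma avoider_inv_step:
  assumes inv: "avoider_inv n b L A U" and U0: "U \<noteq> {}"
    and L: "1 \<le> L" and nb: "n \<le> b" and n: "1 \<le> n"
    and ge1: "1 \<le> real n * (real n / real b) ^ (L - 1)"
    and big: "2 * avoider_const (L + 1) * (real n + (real n)\<^sup>2 * (real n / real b) ^ (L - 1)) \<le> real b"
  shows "\<exists>a\<in>U. \<forall>B. B \<subseteq> U - {a} \<and> card B = min b (card (U - {a})) \<longrightarrow>
     avoider_inv n b L (insert a A) (U - {a} - B)"
proof -
  let ?th = "real n / real b"
  let ?\<rho> = "\<lambda>U :: nat set set. rounds_left b (card U)"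
  have A: "A \<subseteq> complete_edges n" and U: "U \<subseteq> complete_edges n"
    and rem: "b + 1 \<le> 2 * (card U mod (b + 1))"
    using inv U0 unfolding avoider_inv_def by blast+
  from inv obtain PP where F: "forest_partition n A PP" and small: "\<And>X. X \<in> PP \<Longrightarrow> card X \<le> L"
    and "\<forall>s\<in>{2..L}. large_parts PP s = 0 \<or>
          real (large_parts PP s) + real (?\<rho> U) \<le> avoider_bound n b s"
    unfolding avoider_inv_def by blast
  then have bound: "\<And>s. 2 \<le> s \<Longrightarrow> s \<le> L \<Longrightarrow> large_parts PP s = 0 \<or>
        real (large_parts PP s) + real (?\<rho> U) \<le> avoider_bound n b s"
    by simp
  have P: "partition_on {..<n} PP" using F by (simp add: forest_partition_def)
  have finU: "finite U" using finite_subset[OF U] by simp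
  have b: "0 < real b" using n nb by simp
  have th: "0 \<le> ?th" "?th \<le> 1" using nb b by auto
  have large: "real (large_parts PP s) \<le> avoider_bound n b s" if "2 \<le> s" "s \<le> L" for s
  proof -
    have "0 \<le> avoider_bound n b s"
      using avoider_const_ge_1[of s] th by (simp add: avoider_bound_def)
    then show ?thesis using bound[OF that] by auto
  qed
  have const: "1 + real s \<le> avoider_const s" if "2 \<le> s" for s
  proof -
    have "0 \<le> (\<Sum>i\<in>{1..<s}. avoider_const i * avoider_const (s - i))"
      by (intro sum_nonneg mult_nonneg_nonneg order_trans[OF zero_le_one avoider_const_ge_1])
    then show ?thesis using that by (subst avoider_const.simps) simp
  qed
  have ex: "\<exists>t\<le>L. crossing U PP t"
  proof (rule ccontr)
    assume "\<not> ?thesis"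
    then have min: "\<And>t. crossing U PP t \<Longrightarrow> L + 1 \<le> t" by (metis not_less_eq_eq Suc_eq_plus1)
    have "real (card U) \<le> real n * real (L + 1) +
       (avoider_const (L + 1) - 1 - real (L + 1)) * ((real n)\<^sup>2 * ?th ^ (L + 1 - 2))"
      by (rule card_unclaimed_le'[OF P U _ _ min]) (use small large L in \<open>auto simp: less_Suc_eq_le\<close>)
    also have "\<dots> \<le> avoider_const (L + 1) * real n + avoider_const (L + 1) * ((real n)\<^sup>2 * ?th ^ (L - 1))"
    proof (rule add_mono)
      show "real n * real (L + 1) \<le> avoider_const (L + 1) * real n"
        using const[of "L + 1"] L by (subst mult.commute) (intro mult_right_mono, auto)
      show "(avoider_const (L + 1) - 1 - real (L + 1)) * ((real n)\<^sup>2 * ?th ^ (L + 1 - 2))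
          \<le> avoider_const (L + 1) * ((real n)\<^sup>2 * ?th ^ (L - 1))"
        using th L order_trans[OF zero_le_one avoider_const_ge_1, of "L + 1"]
        by (intro mult_mono) (auto simp: Suc_diff_le numeral_2_eq_2)
    qed
    finally have "2 * real (card U) \<le> real b" using big by (simp add: algebra_simps)
    then have "2 * card U \<le> b" by linarith
    moreover have "card U mod (b + 1) \<le> card U" by simp
    ultimately show False using rem by linarith
  qed
  define t where "t = (LEAST t. crossing U PP t)"
  have t: "crossing U PP t" and tL: "t \<le> L" and tmin: "\<And>s. crossing U PP s \<Longrightarrow> t \<le> s"
    unfolding t_def using ex by (auto intro: LeastI Least_le order_trans)
  obtain X Y u v where X: "X \<in> PP" and Y: "Y \<in> PP" and XY: "X \<noteq> Y" and tXY: "card X + card Y = t"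
    and u: "u \<in> X" and v: "v \<in> Y" and uv: "{u, v} \<in> U"
    using t unfolding crossing_def by blast
  let ?a = "{u, v}"
  let ?PP = "insert (X \<union> Y) (PP - {X, Y})"
  show ?thesis
  proof (rule bexI[OF _ uv], intro allI impI)
    fix B assume B: "B \<subseteq> U - {?a} \<and> card B = min b (card (U - {?a}))"
    let ?U = "U - {?a} - B"
    have card: "card ?U = card U - (b + 1)"
      using card_after_round[OF finU uv] B by blast
    have rounds: "?\<rho> ?U + 1 = ?\<rho> U"
      unfolding card using U0 finU by (intro rounds_left_step) (simp add: card_gt_0_iff)
    \<comment> \<open>A full round keeps the residue; a round that is not full empties the
      board.\<close>
    have rem': "?U = {} \<or> b + 1 \<le> 2 * (card ?U mod (b + 1))"
    proof (cases "b + 1 \<le> card U")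
      case True
      then show ?thesis using rem unfolding card le_mod_geq[OF True, symmetric] by blast
    next
      case False
      then have "card ?U = 0" using card by simp
      moreover have "finite ?U" using finU by simp
      ultimately show ?thesis by simp
    qed
    have "large_parts ?PP s = 0 \<or> real (large_parts ?PP s) + real (?\<rho> ?U) \<le> avoider_bound n b s"
      if s: "2 \<le> s" "s \<le> L" for s
    proof (cases "s \<le> t")
      case False
      then have "large_parts ?PP s \<le> large_parts PP s"
        using large_parts_merge[OF P X Y XY, of s] tXY by simp
      then show ?thesis using bound[OF s] rounds by linarith
    next
      case True
      have le: "large_parts ?PP s \<le> large_parts PP s + 1"
        using large_parts_merge[OF P X Y XY, of s] by (simp split: if_splits)
      show ?thesis
      proof (cases "large_parts PP s = 0")
        case False
        then show ?thesis using bound[OF s] rounds le by linarith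
      next
        case zero: True
        have lt: "card Z < s" if "Z \<in> PP" for Z
        proof (rule ccontr)
          assume "\<not> card Z < s"
          then have "Z \<in> {X\<in>PP. s \<le> card X}" using that by simp
          then show False using zero finite_partition_of[OF P] by (auto simp: large_parts_def)
        qed
        \<comment> \<open>All parts are still smaller than \<open>s\<close> and, as
          \<open>s \<le> t\<close>, every free edge between two parts has total size at least
          \<open>s\<close>; so the counting bound limits the rounds left.\<close>
        have "real (card U) \<le> real n * real s +
            (avoider_const s - 1 - real s) * ((real n)\<^sup>2 * ?th ^ (s - 2))"
          by (rule card_unclaimed_le'[OF P U s(1) lt]) (use True tmin large s in \<open>auto intro: order_trans\<close>)
        then have "real (card U) / real b \<le> (real n * real s +
            (avoider_const s - 1 - real s) * ((real n)\<^sup>2 * ?th ^ (s - 2))) / real b"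
          using b by (intro divide_right_mono) auto
        also have "\<dots> = real s * ?th + (avoider_const s - 1 - real s) * (real n * (?th * ?th ^ (s - 2)))"
          by (simp add: add_divide_distrib power2_eq_square mult_ac)
        also have "?th * ?th ^ (s - 2) = ?th ^ (s - 1)"
        proof -
          have "s - 1 = Suc (s - 2)" using s by simp
          then show ?thesis by simp
        qed
        finally have 1: "real (card U) / real b \<le>
            real s * ?th + (avoider_const s - 1 - real s) * (real n * ?th ^ (s - 1))" .
        \<comment> \<open>This lets the main term absorb both the 1 from rounding and the edges
          inside parts.\<close>
        have 2: "1 \<le> real n * ?th ^ (s - 1)"
        proof -
          have "?th ^ (L - 1) \<le> ?th ^ (s - 1)" using s th by (intro power_decreasing) auto
          then have "real n * ?th ^ (L - 1) \<le> real n * ?th ^ (s - 1)" by (intro mult_left_mono) auto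
          then show ?thesis using ge1 by linarith
        qed
        have "real s * ?th \<le> real s * (real n * ?th ^ (s - 1))"
          using 2 th by (intro mult_left_mono) auto
        with 1 2 have 3: "1 + real (card U) / real b \<le> avoider_const s * (real n * ?th ^ (s - 1))"
          by (simp add: algebra_simps)
        have "real (?\<rho> U) \<le> 1 + real (card U) / real b" using b by (intro rounds_left_le) simp
        then have "real (?\<rho> U) \<le> avoider_bound n b s"
          using 3 by (simp add: avoider_bound_def mult_ac)
        then show ?thesis using le zero rounds by linarith
      qed
    qed
    moreover have "\<forall>Z\<in>?PP. card Z \<le> L"
      using small tXY tL card_Un_le[of X Y] by (auto intro: order_trans)
    moreover have "forest_partition n (insert ?a A) ?PP"
      by (rule forest_partition_merge[OF F X Y XY u v A])
    moreover have "insert ?a A \<subseteq> complete_edges n" using A U uv by blast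
    moreover have "?U \<subseteq> complete_edges n" using U by blast
    ultimately show "avoider_inv n b L (insert ?a A) ?U"
      unfolding avoider_inv_def using rem' by (intro conjI exI[of _ ?PP] ballI) (simp_all, blast)
  qed
qed

lemma forest_partition_singletons: "forest_partition n {} ((\<lambda>x. {x}) ` {..<n})"
proof -
  have "card {X \<in> (\<lambda>x. {x}) ` {..<n}. X \<inter> S \<noteq> {}} \<le> card S" if "S \<subseteq> {..<n}" for S
  proof -
    have "{X \<in> (\<lambda>x. {x}) ` {..<n}. X \<inter> S \<noteq> {}} \<subseteq> (\<lambda>x. {x}) ` S" by auto
    moreover have S: "finite S" using finite_subset[OF that] by simp
    ultimately have "card {X \<in> (\<lambda>x. {x}) ` {..<n}. X \<inter> S \<noteq> {}} \<le> card ((\<lambda>x. {x}) ` S)"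
      by (intro card_mono) auto
    then show ?thesis using card_image_le[OF S, of "\<lambda>x. {x}"] by linarith
  qed
  moreover have "partition_on {..<n} ((\<lambda>x. {x}) ` {..<n})"
    by (rule partition_onI) (auto simp: disjnt_def)
  ultimately show ?thesis unfolding forest_partition_def by auto
qed

text \<open>The hypothesis \<open>free\<close> isolates the dependence on the target graph: a tree
  is excluded by the size of the parts, a unicyclic graph by acyclicity.\<close>

lemma avoider_avoids:
  assumes L: "1 \<le> L" and nb: "n \<le> b" and n: "1 \<le> n"
    and ge1: "1 \<le> real n * (real n / real b) ^ (L - 1)"
    and big: "2 * avoider_const (L + 1) * (real n + (real n)\<^sup>2 * (real n / real b) ^ (L - 1)) \<le> real b"
    and rem: "b + 1 \<le> 2 * ((n choose 2) mod (b + 1))"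
    and free: "\<And>A PP. A \<subseteq> complete_edges n \<Longrightarrow> forest_partition n A PP \<Longrightarrow>
       (\<And>X. X \<in> PP \<Longrightarrow> card X \<le> L) \<Longrightarrow> \<not> contains_copy {..<n} A V E"
  shows "\<not> enforcer_wins V E n b"
proof (rule not_enforcer_wins_if_invariant[where I = "avoider_inv n b L"])
  have "large_parts ((\<lambda>x. {x}) ` {..<n}) s = 0" if "2 \<le> s" for s
  proof -
    have "{X \<in> (\<lambda>x. {x}) ` {..<n}. s \<le> card X} = {}" using that by auto
    then show ?thesis unfolding large_parts_def by (metis card.empty)
  qed
  moreover have "card (complete_edges n) = n choose 2"
    by (simp add: card_nsets)
  ultimately show "avoider_inv n b L {} (complete_edges n)"
    unfolding avoider_inv_def using rem L forest_partition_singletons[of n]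
    by (intro conjI exI[of _ "(\<lambda>x. {x}) ` {..<n}"]) auto
  show "\<And>A U. avoider_inv n b L A U \<Longrightarrow> U \<noteq> {} \<Longrightarrow> U \<subseteq> complete_edges n \<Longrightarrow>
       \<exists>a\<in>U. \<forall>B. B \<subseteq> U - {a} \<and> card B = min b (card (U - {a})) \<longrightarrow>
         avoider_inv n b L (insert a A) (U - {a} - B)"
    by (rule avoider_inv_step[OF _ _ L nb n ge1 big])
  show "\<And>A. avoider_inv n b L A {} \<Longrightarrow> \<not> contains_copy {..<n} A V E"
    unfolding avoider_inv_def using free by blast
qed

section \<open>Graphs with at most one cycle\<close>

abbreviation reach :: "'a set set \<Rightarrow> ('a \<times> 'a) set" where
  "reach S \<equiv> {(x, y). {x, y} \<in> S}\<^sup>*"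

definition at_most_one_cycle :: "'a set set \<Rightarrow> bool" where
  "at_most_one_cycle E \<longleftrightarrow> (\<forall>C C'. is_cycle E C \<and> is_cycle E C' \<longrightarrow> C = C')"

definition has_cycle :: "'a set set \<Rightarrow> bool" where
  "has_cycle E \<longleftrightarrow> (\<exists>C. is_cycle E C)"

lemma is_cycle_mono: "is_cycle S C \<Longrightarrow> S \<subseteq> S' \<Longrightarrow> is_cycle S' C"
  by (auto simp: is_cycle_def)

lemma has_cycle_mono: "has_cycle S \<Longrightarrow> S \<subseteq> S' \<Longrightarrow> has_cycle S'"
  unfolding has_cycle_def using is_cycle_mono[of S _ S'] by blast

lemma is_cycle_nonempty:
  assumes "is_cycle S C"
  shows "C \<noteq> {}"
proof -
  obtain vs where "3 \<le> length vs" "C = cyclic_edges vs" using assms by (auto simp: is_cycle_def)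
  then have "{vs ! 0, vs ! (Suc 0 mod length vs)} \<in> C" unfolding cyclic_edges_def by fastforce
  then show ?thesis by blast
qed

lemma reach_mono: "S \<subseteq> S' \<Longrightarrow> reach S \<subseteq> reach S'"
  by (rule rtrancl_mono) auto

lemma reach_sym: "(u, v) \<in> reach S \<Longrightarrow> (v, u) \<in> reach S"
  by (rule symD[OF sym_rtrancl]) (auto simp: sym_def insert_commute)

lemma reach_trans: "(u, v) \<in> reach S \<Longrightarrow> (v, w) \<in> reach S \<Longrightarrow> (u, w) \<in> reach S"
  by (rule rtrancl_trans)

lemma reach_edge: "{u, v} \<in> S \<Longrightarrow> (u, v) \<in> reach S"
  by (rule r_into_rtrancl) simp

lemma reach_distinct_path:
  assumes "(u, v) \<in> reach S"
  shows "\<exists>xs. xs \<noteq> [] \<and> hd xs = u \<and> last xs = v \<and> distinct xs \<and> successively (\<lambda>x y. {x, y} \<in> S) xs"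
  using assms
proof (induction rule: converse_rtrancl_induct)
  case base
  show ?case by (rule exI[of _ "[v]"]) simp
next
  case (step x y)
  then obtain xs where xs: "xs \<noteq> []" "hd xs = y" "last xs = v" "distinct xs"
      "successively (\<lambda>x y. {x, y} \<in> S) xs" by blast
  show ?case
  proof (cases "x \<in> set xs")
    case True
    then obtain ys zs where "xs = ys @ x # zs" by (meson split_list)
    then show ?thesis using xs by (intro exI[of _ "x # zs"]) (auto simp: successively_append_iff)
  next
    case False
    then show ?thesis using xs step.hyps(1)
      by (intro exI[of _ "x # xs"]) (auto simp: successively_Cons)
  qed
qed

text \<open>Close a path with distinct vertices by the new edge. The path has at least three
  vertices, since otherwise its only edge would be \<open>{u, v}\<close>, which is not in
  \<open>S\<close>.\<close>

lemma cycle_through_edge: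
  assumes uv: "(u, v) \<in> reach S" and ne: "u \<noteq> v" and new: "{u, v} \<notin> S"
  shows "\<exists>C. is_cycle (insert {u, v} S) C \<and> {u, v} \<in> C"
proof -
  obtain xs where xs: "xs \<noteq> []" "hd xs = u" "last xs = v" "distinct xs"
      "successively (\<lambda>x y. {x, y} \<in> S) xs"
    using reach_distinct_path[OF uv] by blast
  have step: "{xs ! i, xs ! Suc i} \<in> S" if "Suc i < length xs" for i
    using xs(5) that unfolding successively_conv_nth by blast
  have u: "xs ! 0 = u" using hd_conv_nth[OF xs(1)] xs(2) by simp
  have v: "xs ! (length xs - 1) = v" using last_conv_nth[OF xs(1)] xs(3) by simp
  have "length xs \<noteq> 0" using xs(1) by simp
  moreover have "length xs \<noteq> 1" using u v ne by auto
  moreover have "length xs \<noteq> 2"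
  proof
    assume len: "length xs = 2"
    then have "{xs ! 0, xs ! 1} \<in> S" using step[of 0] by simp
    then show False using u v new len by simp
  qed
  ultimately have len: "3 \<le> length xs" by linarith
  have close: "{xs ! (length xs - 1), xs ! (Suc (length xs - 1) mod length xs)} = {u, v}"
  proof -
    have "Suc (length xs - 1) = length xs" using len by simp
    then have "Suc (length xs - 1) mod length xs = 0" by (simp only: mod_self)
    then show ?thesis unfolding u v by (simp only: u insert_commute)
  qed
  have "cyclic_edges xs \<subseteq> insert {u, v} S"
  proof
    fix e assume "e \<in> cyclic_edges xs"
    then obtain i where i: "i < length xs" "e = {xs ! i, xs ! (Suc i mod length xs)}"
      unfolding cyclic_edges_def by blast
    show "e \<in> insert {u, v} S"
    proof (cases "Suc i < length xs")
      case True
      then show ?thesis using i(2) step[OF True] by simp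
    next
      case False
      then have "i = length xs - 1" using i(1) by linarith
      then show ?thesis using i(2) close by simp
    qed
  qed
  moreover have "{u, v} \<in> cyclic_edges xs"
  proof -
    have "length xs - 1 < length xs" using len by linarith
    then show ?thesis unfolding cyclic_edges_def using close by blast
  qed
  ultimately show ?thesis unfolding is_cycle_def using xs(4) len by blast
qed

text \<open>Each edge closes a cycle that contains it and otherwise uses edges of \<open>S\<close>.
  Uniqueness identifies both cycles, so the first edge is in \<open>insert {u', v'} S\<close> but
  not in \<open>S\<close>.\<close>

lemma at_most_one_chord:
  assumes one: "at_most_one_cycle E" and S: "S \<subseteq> E"
    and "{u, v} \<in> E - S" "u \<noteq> v" "(u, v) \<in> reach S"
    and "{u', v'} \<in> E - S" "u' \<noteq> v'" "(u', v') \<in> reach S"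
  shows "{u, v} = {u', v'}"
proof -
  obtain C where C: "is_cycle (insert {u, v} S) C" "{u, v} \<in> C"
    using cycle_through_edge[OF assms(5,4)] assms(3) by blast
  obtain C' where C': "is_cycle (insert {u', v'} S) C'" "{u', v'} \<in> C'"
    using cycle_through_edge[OF assms(8,7)] assms(6) by blast
  have "is_cycle E C" "is_cycle E C'"
    using is_cycle_mono[OF C(1), of E] is_cycle_mono[OF C'(1), of E] assms(2,3,6) by blast+
  then have "C = C'" using one by (auto simp: at_most_one_cycle_def)
  then have "{u, v} \<in> insert {u', v'} S" using C C' by (auto simp: is_cycle_def)
  then show ?thesis using assms(3) by blast
qed

text \<open>The connected component of \<open>v\<close> for the edge set \<open>S\<close>; a vertex
  on no edge of \<open>S\<close> forms a singleton. As \<open>S\<close> grows from phase to phase,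
  these are the pieces of the target graph of which copies are maintained.\<close>

definition part :: "'a set set \<Rightarrow> 'a \<Rightarrow> 'a set" where
  "part S v = {u. (v, u) \<in> reach S}"

definition induced :: "'a set set \<Rightarrow> 'a set \<Rightarrow> 'a set set" where
  "induced S D = {e\<in>S. e \<subseteq> D}"

lemma self_in_part [simp]: "v \<in> part S v"
  by (simp add: part_def)

lemma part_eq:
  assumes "u \<in> part S v"
  shows "part S u = part S v"
proof -
  have vu: "(v, u) \<in> reach S" using assms by (simp add: part_def)
  have "(u, x) \<in> reach S \<longleftrightarrow> (v, x) \<in> reach S" for x
    using reach_trans[OF vu, of x] reach_trans[OF reach_sym[OF vu], of x] by blast
  then show ?thesis unfolding part_def by blast
qed

lemma same_part_reach: "p \<in> part S u \<Longrightarrow> q \<in> part S u \<Longrightarrow> (p, q) \<in> reach S"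
  using part_eq[of p S u] unfolding part_def by blast

lemma part_disjoint: "part S u \<noteq> part S v \<Longrightarrow> part S u \<inter> part S v = {}"
  using part_eq[of _ S u] part_eq[of _ S v] by blast

lemma part_empty [simp]: "part {} v = {v}"
  by (simp add: part_def)

lemma reach_in_part:
  assumes "(u, v) \<in> reach S"
  shows "(u, v) \<in> reach (induced S (part S u))"
  using assms
proof (induction rule: rtrancl_induct)
  case (step y z)
  then have "y \<in> part S u" "z \<in> part S u"
    unfolding part_def using rtrancl_into_rtrancl[of u y _ z] by blast+
  then have "{y, z} \<in> induced S (part S u)" using step.hyps(2) by (simp add: induced_def)
  then have "(y, z) \<in> reach (induced S (part S u))" by (rule reach_edge)
  with step.IH show ?case by (rule reach_trans)
qed simp

lemma part_subset:
  assumes S: "S \<subseteq> nsets V 2" and v: "v \<in> V"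
  shows "part S v \<subseteq> V"
proof
  fix u assume "u \<in> part S v"
  then have "(v, u) \<in> reach S" by (simp add: part_def)
  then show "u \<in> V"
    using S v by (induction rule: rtrancl_induct) (auto simp: nsets_def)
qed

text \<open>The Enforcer argument produces about \<open>n (n / b) ^ weight k S\<close> copies of a connected
  subgraph with edge set \<open>S\<close>. An edge closing a cycle costs \<open>k\<close> extra: this is harmless, as
  unicyclic graphs have room to spare.\<close>

definition weight :: "nat \<Rightarrow> 'a set set \<Rightarrow> nat" where
  "weight k S = card S + (if has_cycle S then k else 0)"

lemma weight_strict_mono:
  assumes "finite S'" "S \<subset> S'"
  shows "weight k S + 1 \<le> weight k S'"
  using assms has_cycle_mono[of S S'] psubset_card_mono[OF assms] by (auto simp: weight_def)

text \<open>Disjoint edge sets cannot both contain the only cycle, so the extra \<open>k\<close>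
  occurs at most once on the left and is inherited by \<open>S'\<close>. The edge \<open>e\<close>
  accounts for the summand 1, which later becomes one more factor \<open>\<eta>\<close>.\<close>

lemma weight_superadditive:
  assumes one: "at_most_one_cycle S'" and fin: "finite S'"
    and sub: "insert e (S1 \<union> S2) \<subseteq> S'" and disj: "S1 \<inter> S2 = {}" "e \<notin> S1 \<union> S2"
  shows "weight k S1 + weight k S2 + 1 \<le> weight k S'"
proof -
  have "\<not> (has_cycle S1 \<and> has_cycle S2)"
  proof
    assume "has_cycle S1 \<and> has_cycle S2"
    then obtain C1 C2 where C: "is_cycle S1 C1" "is_cycle S2 C2" by (auto simp: has_cycle_def)
    then have "is_cycle S' C1" "is_cycle S' C2"
      using sub is_cycle_mono[of S1 C1 S'] is_cycle_mono[of S2 C2 S'] by blast+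
    then have "C1 = C2" using one by (auto simp: at_most_one_cycle_def)
    then have "C1 \<subseteq> S1 \<inter> S2" using C by (auto simp: is_cycle_def)
    then show False using disj C(1) is_cycle_nonempty by blast
  qed
  moreover have "card S1 + card S2 + 1 \<le> card S'"
  proof -
    have "finite (S1 \<union> S2)" using sub finite_subset[OF _ fin, of "S1 \<union> S2"] by blast
    then have fins: "finite S1" "finite S2" by simp_all
    have "card (insert e (S1 \<union> S2)) = card S1 + card S2 + 1"
      using fins disj by (simp add: card_Un_disjoint)
    then show ?thesis using card_mono[OF fin sub] by simp
  qed
  moreover have "has_cycle S'" if "has_cycle S1 \<or> has_cycle S2"
    using that sub has_cycle_mono[of S1 S'] has_cycle_mono[of S2 S'] by blast
  ultimately show ?thesis by (auto simp: weight_def)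
qed

text \<open>Two missing edges with both ends in one part would be two different chords. Thus every
  phase except the last finds two adjacent parts.\<close>

lemma exists_linking_edge:
  assumes E: "E \<subseteq> nsets V 2" "finite E" and one: "at_most_one_cycle E" and S: "S \<subseteq> E"
    and card: "card S + 2 \<le> card E"
  shows "\<exists>p q. {p, q} \<in> E - S \<and> p \<in> V \<and> q \<in> V \<and> part S p \<noteq> part S q"
proof (rule ccontr)
  assume no: "\<not> ?thesis"
  have chord: "\<exists>p q. e = {p, q} \<and> p \<noteq> q \<and> (p, q) \<in> reach S" if e: "e \<in> E - S" for e
  proof -
    obtain p q where pq: "e = {p, q}" "p \<noteq> q" "p \<in> V" "q \<in> V"
      using e E by (auto simp: nsets_def card_2_iff)
    then have "part S p = part S q" using no e by blast
    then have "q \<in> part S p" by simp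
    then show ?thesis using pq by (auto simp: part_def)
  qed
  have "card (E - S) \<ge> 2" using card S E by (simp add: card_Diff_subset finite_subset)
  then obtain T where T: "T \<subseteq> E - S" "card T = 2"
    using obtain_subset_with_card_n by metis
  then obtain e f where "T = {e, f}" "e \<noteq> f" by (auto simp: card_2_iff)
  then have ef: "e \<in> E - S" "f \<in> E - S" "e \<noteq> f" using T(1) by auto
  obtain p q p' q' where "e = {p, q}" "p \<noteq> q" "(p, q) \<in> reach S"
      "f = {p', q'}" "p' \<noteq> q'" "(p', q') \<in> reach S"
    using chord[OF ef(1)] chord[OF ef(2)] by auto
  then show False using at_most_one_chord[OF one S, of p q p' q'] ef by simp
qed

text \<open>This bounds the number of edges between two parts by two, and by one in the acyclic case.\<close>

lemma at_most_two_linking_edges: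
  assumes one: "at_most_one_cycle E" and S: "S \<subseteq> E" and V: "E \<subseteq> nsets V 2"
    and ne: "part S u \<noteq> part S v"
    and e: "{p1, q1} \<in> E" "p1 \<in> part S u" "q1 \<in> part S v"
    and f: "{p2, q2} \<in> E" "p2 \<in> part S u" "q2 \<in> part S v" "{p2, q2} \<noteq> {p1, q1}"
    and g: "{p3, q3} \<in> E" "p3 \<in> part S u" "q3 \<in> part S v" "{p3, q3} \<noteq> {p1, q1}"
  shows "has_cycle E" "{p2, q2} = {p3, q3}"
proof -
  let ?S = "insert {p1, q1} S"
  have link: "{p, q} \<notin> S \<and> p \<noteq> q \<and> (p, q) \<in> reach ?S"
    if "p \<in> part S u" "q \<in> part S v" for p q
  proof -
    have "part S p \<noteq> part S q" using that ne part_eq by metis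
    then have "(p, q) \<notin> reach S" using part_eq[of q S p] by (auto simp: part_def)
    then have "{p, q} \<notin> S" "p \<noteq> q" using reach_edge[of p q S] by blast+
    moreover have "(p, p1) \<in> reach ?S"
      using same_part_reach[OF that(1) e(2)] reach_mono[of S ?S] by blast
    moreover have "(q1, q) \<in> reach ?S"
      using same_part_reach[OF e(3) that(2)] reach_mono[of S ?S] by blast
    moreover have "(p1, q1) \<in> reach ?S" by (rule reach_edge) simp
    ultimately show ?thesis using reach_trans[of p p1 ?S q1] reach_trans[of p q1 ?S q] by blast
  qed
  note link2 = link[OF f(2,3)] and link3 = link[OF g(2,3)]
  have S': "?S \<subseteq> E" using e S by blast
  show "{p2, q2} = {p3, q3}"
    by (rule at_most_one_chord[OF one S']) (use link2 link3 f g in blast)+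
  have "\<exists>C. is_cycle (insert {p2, q2} ?S) C \<and> {p2, q2} \<in> C"
    by (rule cycle_through_edge) (use link2 f in blast)+
  then obtain C where C: "is_cycle (insert {p2, q2} ?S) C" by blast
  have "insert {p2, q2} ?S \<subseteq> E" using f(1) S' by blast
  then have "is_cycle E C" by (rule is_cycle_mono[OF C])
  then show "has_cycle E" unfolding has_cycle_def by blast
qed

text \<open>An edge inside a part closes the cycle together with edges of that part, so the pattern
  weighs more than \<open>card E\<close>, and by uniqueness \<open>S\<close> was acyclic. Hence a
  chord never undercuts the cheapest linking edge.\<close>

lemma chord_weight:
  assumes one: "at_most_one_cycle E" and fin: "finite E" and S: "S \<subseteq> E"
    and e: "{u, v} \<in> E - S" "u \<noteq> v" "(u, v) \<in> reach S"
    and S': "insert {u, v} (induced S (part S u)) \<subseteq> S'" "S' \<subseteq> E"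
  shows "card E + 1 \<le> weight (card E) S'" and "\<not> has_cycle S"
proof -
  have "(u, v) \<in> reach (induced S (part S u))" using reach_in_part[OF e(3)] .
  moreover have "{u, v} \<notin> induced S (part S u)" using e(1) by (auto simp: induced_def)
  ultimately obtain C where "is_cycle (insert {u, v} (induced S (part S u))) C" and e_C: "{u, v} \<in> C"
    using cycle_through_edge[OF _ e(2)] by blast
  then have C: "is_cycle S' C" using S'(1) is_cycle_mono by blast
  have finS': "finite S'" using finite_subset[OF S'(2) fin] .
  have "S' \<noteq> {}" using S'(1) by blast
  then have "1 \<le> card S'" using finS' by (simp add: Suc_le_eq card_gt_0_iff)
  moreover have "has_cycle S'" using C unfolding has_cycle_def by blast
  ultimately show "card E + 1 \<le> weight (card E) S'" by (simp add: weight_def)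
  show "\<not> has_cycle S"
  proof
    assume "has_cycle S"
    then obtain C' where C': "is_cycle S C'" by (auto simp: has_cycle_def)
    have "C = C'" using one is_cycle_mono[OF C' S] is_cycle_mono[OF C S'(2)]
      by (auto simp: at_most_one_cycle_def)
    then have "{u, v} \<in> S" using e_C C' unfolding is_cycle_def by blast
    then show False using e(1) by blast
  qed
qed

section \<open>Copies with prescribed roles\<close>

text \<open>Fixing in advance which vertex of the target each board vertex may play allows partial
  copies to be merged without conflict whenever their role sets are disjoint.\<close>

locale roles =
  fixes V :: "'a set" and E :: "'a set set" and n :: nat and role :: "nat \<Rightarrow> 'a"
  assumes connected: "connected_graph V E"
    and one_cycle: "at_most_one_cycle E"
    and role_in: "\<And>i. i < n \<Longrightarrow> role i \<in> V"
begin

lemma E_subset: "E \<subseteq> nsets V 2" and finite_V: "finite V" and V_nonempty: "V \<noteq> {}"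
  using connected by (auto simp: connected_graph_def simple_graph_def)

lemma finite_E: "finite E"
  using finite_subset[OF E_subset] finite_V by (simp add: finite_imp_finite_nsets)

lemma E_ne: "{p, q} \<in> E \<Longrightarrow> p \<noteq> q"
  using E_subset by (auto simp: nsets_def)

definition realized :: "nat set \<Rightarrow> nat set set" where
  "realized X = {e \<in> nsets X 2. role ` e \<in> E}"

definition cross :: "nat set \<Rightarrow> nat set \<Rightarrow> nat set set" where
  "cross X Y = {{x, y} | x y. x \<in> X \<and> y \<in> Y \<and> {role x, role y} \<in> E}"

text \<open>The subgraph of the target that Avoider has built inside \<open>X\<close>, transported
  by the roles so that copies on different board vertices can be compared.\<close>

definition pattern :: "nat set set \<Rightarrow> nat set \<Rightarrow> 'a set set" where
  "pattern A X = (`) role ` (realized X \<inter> A)"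

definition connected_by :: "'a set set \<Rightarrow> 'a set \<Rightarrow> bool" where
  "connected_by S D \<longleftrightarrow> (\<forall>p\<in>D. \<forall>q\<in>D. (p, q) \<in> reach S)"

text \<open>The inclusion \<open>realized X \<subseteq> A \<union> U\<close> says that Enforcer owns
  no edge that the copy may still need inside \<open>X\<close>. Connectedness refers to Avoider's
  edges only.\<close>

definition copies :: "nat set set \<Rightarrow> nat set set \<Rightarrow> nat set set \<Rightarrow> bool" where
  "copies A U CC \<longleftrightarrow> disjoint CC \<and>
     (\<forall>X\<in>CC. X \<subseteq> {..<n} \<and> X \<noteq> {} \<and> inj_on role X \<and> realized X \<subseteq> A \<union> U \<and> connected_by (pattern A X) (role ` X))"

lemma cross_sym: "cross X Y = cross Y X"
proof -
  have "cross X Y \<subseteq> cross Y X" for X Y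
  proof
    fix e assume "e \<in> cross X Y"
    then obtain x y where xy: "e = {x, y}" "x \<in> X" "y \<in> Y" "{role x, role y} \<in> E"
      unfolding cross_def by blast
    then have "e = {y, x}" "{role y, role x} \<in> E" by (simp_all add: insert_commute)
    with xy(2,3) show "e \<in> cross Y X" unfolding cross_def by blast
  qed
  then show ?thesis by blast
qed

lemma cross_Un: "cross (X \<union> Y) Z = cross X Z \<union> cross Y Z" "cross Z (X \<union> Y) = cross Z X \<union> cross Z Y"
  unfolding cross_def by blast+

lemma crossE:
  assumes "e \<in> cross X Y"
  obtains x y where "e = {x, y}" "x \<in> X" "y \<in> Y" "{role x, role y} \<in> E"
  using assms unfolding cross_def by blast

lemma realizedD: "e \<in> realized X \<Longrightarrow> e \<subseteq> X \<and> e \<noteq> {} \<and> role ` e \<in> E"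
  unfolding realized_def by (auto simp: nsets_def)

lemma realized_Un:
  assumes "X \<inter> Y = {}"
  shows "realized (X \<union> Y) = realized X \<union> realized Y \<union> cross X Y"
proof
  show "realized (X \<union> Y) \<subseteq> realized X \<union> realized Y \<union> cross X Y"
  proof
    fix e assume e: "e \<in> realized (X \<union> Y)"
    then obtain x y where xy: "e = {x, y}" "x \<noteq> y"
      unfolding realized_def by (auto simp: nsets_def card_2_iff)
    have E: "{role x, role y} \<in> E" and sub: "x \<in> X \<union> Y" "y \<in> X \<union> Y"
      using realizedD[OF e] xy by auto
    have "e \<in> realized X" if "x \<in> X" "y \<in> X"
      using that xy E by (simp add: realized_def)
    moreover have "e \<in> realized Y" if "x \<in> Y" "y \<in> Y"
      using that xy E by (simp add: realized_def)
    moreover have "e \<in> cross X Y" if "x \<in> X" "y \<in> Y"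
      using that xy E unfolding cross_def by blast
    moreover have "e \<in> cross X Y" if "x \<in> Y" "y \<in> X"
    proof -
      have "e = {y, x}" "{role y, role x} \<in> E" using xy E by (simp_all add: insert_commute)
      then show ?thesis using that unfolding cross_def by blast
    qed
    ultimately show "e \<in> realized X \<union> realized Y \<union> cross X Y" using sub by blast
  qed
  have "cross X Y \<subseteq> realized (X \<union> Y)"
  proof
    fix e assume "e \<in> cross X Y"
    then obtain x y where xy: "e = {x, y}" "x \<in> X" "y \<in> Y" "{role x, role y} \<in> E" by (rule crossE)
    then have "x \<noteq> y" using assms by blast
    then show "e \<in> realized (X \<union> Y)" using xy by (simp add: realized_def)
  qed
  moreover have "realized X \<subseteq> realized (X \<union> Y)" "realized Y \<subseteq> realized (X \<union> Y)"
    unfolding realized_def using nsets_mono[of X "X \<union> Y" 2] nsets_mono[of Y "X \<union> Y" 2] by blast+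
  ultimately show "realized X \<union> realized Y \<union> cross X Y \<subseteq> realized (X \<union> Y)" by blast
qed

lemma copies_disjoint: "copies A U CC \<Longrightarrow> X \<in> CC \<Longrightarrow> Y \<in> CC \<Longrightarrow> x \<in> X \<Longrightarrow> x \<in> Y \<Longrightarrow> X = Y"
  unfolding copies_def disjoint_def by blast

lemma copies_finite:
  assumes "copies A U CC"
  shows "finite CC"
proof -
  have "CC \<subseteq> Pow {..<n}" using assms unfolding copies_def by blast
  then show ?thesis by (rule finite_subset) simp
qed

lemma copiesD:
  assumes "copies A U CC" "X \<in> CC"
  shows "X \<subseteq> {..<n}" "X \<noteq> {}" "inj_on role X" "realized X \<subseteq> A \<union> U" "finite X" "role ` X \<subseteq> V"
    "card X \<le> card V"
proof -
  show X: "X \<subseteq> {..<n}" and "X \<noteq> {}" and inj: "inj_on role X" and "realized X \<subseteq> A \<union> U"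
    using assms unfolding copies_def by blast+
  show "finite X" using finite_subset[OF X] by simp
  show sub: "role ` X \<subseteq> V" using role_in X by auto
  show "card X \<le> card V" using card_inj_on_le[OF inj sub finite_V] .
qed

lemma copiesD_connected: "copies A U CC \<Longrightarrow> X \<in> CC \<Longrightarrow> connected_by (pattern A X) (role ` X)"
  unfolding copies_def by blast

lemma cross_not_realized:
  assumes "copies A U CC" "X \<in> CC" "Y \<in> CC" "X \<noteq> Y" "W \<in> CC" "e \<in> cross X Y"
  shows "e \<notin> realized W"
proof
  assume "e \<in> realized W"
  then have "e \<subseteq> W" using realizedD by blast
  moreover obtain x y where "e = {x, y}" "x \<in> X" "y \<in> Y" using assms(6) by (rule crossE)
  ultimately have "X = W" "Y = W"
    using copies_disjoint[OF assms(1,2,5), of x] copies_disjoint[OF assms(1,3,5), of y] by blast+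
  then show False using assms(4) by simp
qed

lemma cross_unique:
  assumes "copies A U CC" "X \<in> CC" "Y \<in> CC" "X' \<in> CC" "Y' \<in> CC" "X' \<noteq> Y'"
    and e: "e \<in> cross X Y" "e \<in> cross X' Y'"
  shows "X = X' \<and> Y = Y' \<or> X = Y' \<and> Y = X'"
proof -
  obtain x y where xy: "e = {x, y}" "x \<in> X" "y \<in> Y" using e(1) by (rule crossE)
  obtain x' y' where xy': "e = {x', y'}" "x' \<in> X'" "y' \<in> Y'" using e(2) by (rule crossE)
  have "x' \<noteq> y'" using xy' assms(6) copies_disjoint[OF assms(1,4,5), of x'] by blast
  then have "x = x' \<and> y = y' \<or> x = y' \<and> y = x'"
    using xy(1) xy'(1) by (auto simp: doubleton_eq_iff)
  then show ?thesis
    using copies_disjoint[OF assms(1,2,4), of x] copies_disjoint[OF assms(1,3,5), of y]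
      copies_disjoint[OF assms(1,2,5), of x] copies_disjoint[OF assms(1,3,4), of y] xy xy' by blast
qed

lemma realized_image_inj:
  assumes "inj_on role X"
  shows "inj_on ((`) role) (realized X)"
proof -
  have "realized X \<subseteq> Pow X" using realizedD by blast
  then show ?thesis using inj_on_subset[OF inj_on_image_Pow[OF assms]] by blast
qed

lemma pattern_subset: "pattern A X \<subseteq> induced E (role ` X)"
proof
  fix e assume "e \<in> pattern A X"
  then obtain f where "e = role ` f" "f \<in> realized X" unfolding pattern_def by blast
  then show "e \<in> induced E (role ` X)" using realizedD[of f X] unfolding induced_def by blast
qed

lemma card_realized_le:
  assumes "inj_on role X"
  shows "card (realized X \<inter> A) \<le> card E"
proof -
  have "inj_on ((`) role) (realized X \<inter> A)"
    by (rule inj_on_subset[OF realized_image_inj[OF assms]]) blast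
  moreover have "(`) role ` (realized X \<inter> A) \<subseteq> E"
    unfolding realized_def by blast
  ultimately show ?thesis by (rule card_inj_on_le[OF _ _ finite_E])
qed

text \<open>\<open>B\<close> is the set of vertices in the blocks that Enforcer sacrifices.\<close>

definition open_pair :: "nat set set \<Rightarrow> nat set \<Rightarrow> nat set \<Rightarrow> bool" where
  "open_pair U X Y \<longleftrightarrow> X \<noteq> Y \<and> role ` X \<inter> role ` Y = {} \<and> cross X Y \<subseteq> U"

text \<open>Within a phase \<open>S\<close> is fixed: the roles of each copy are a union of parts,
  and Avoider owns its edges for all of \<open>S\<close> there. Role-disjoint copies are guaranteed
  to be mergeable if one of them avoids \<open>B\<close>; where both meet \<open>B\<close>, Enforcer
  may have claimed edges.\<close>

definition phase_inv :: "'a set set \<Rightarrow> nat set \<Rightarrow> nat set set \<Rightarrow> nat set set \<Rightarrow> nat set set \<Rightarrow> bool" where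
  "phase_inv S B A U CC \<longleftrightarrow> U \<subseteq> complete_edges n \<and> A \<inter> U = {} \<and> copies A U CC \<and>
     (\<forall>X\<in>CC. \<forall>Y\<in>CC. X \<noteq> Y \<and> role ` X \<inter> role ` Y = {} \<and> X \<inter> B = {} \<longrightarrow> cross X Y \<subseteq> U) \<and>
     (\<forall>X\<in>CC. (\<forall>p\<in>role ` X. part S p \<subseteq> role ` X) \<and> induced S (role ` X) \<subseteq> pattern A X)"

text \<open>Under \<open>phase_inv\<close> one inclusion always holds, so this says that Avoider
  owns an edge of the copy beyond those of \<open>S\<close>.\<close>

definition advanced :: "'a set set \<Rightarrow> nat set set \<Rightarrow> nat set \<Rightarrow> bool" where
  "advanced S A X \<longleftrightarrow> pattern A X \<noteq> induced S (role ` X)"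

text \<open>Free edges that lie in no copy and join no two copies that can still be merged. Claiming
  one affects no copy and no open pair, so they are Enforcer's preferred replies.\<close>

definition junk :: "nat set set \<Rightarrow> nat set set \<Rightarrow> nat set set" where
  "junk U CC = {e\<in>U. (\<forall>X\<in>CC. e \<notin> realized X) \<and>
     (\<forall>X\<in>CC. \<forall>Y\<in>CC. open_pair U X Y \<longrightarrow> e \<notin> cross X Y)}"

text \<open>Edges are counted rather than copies, so that every move outside the junk increases this
  number: merging two advanced copies lowers the number of copies but adds an edge.\<close>

definition progress :: "'a set set \<Rightarrow> nat set set \<Rightarrow> nat set set \<Rightarrow> nat" where
  "progress S A CC = (\<Sum>X | X \<in> CC \<and> advanced S A X. card (realized X \<inter> A))"

text \<open>Advanced copies count even if they meet \<open>B\<close>. A copy absorbed by a merge is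
  then replaced by the merged one, and Avoider's moves never lower this number.\<close>

definition available :: "'a set set \<Rightarrow> nat set \<Rightarrow> nat set set \<Rightarrow> nat set set \<Rightarrow> 'a \<Rightarrow> nat" where
  "available S B A CC p = card {X\<in>CC. p \<in> role ` X \<and> (advanced S A X \<or> X \<inter> B = {})}"

lemma pattern_cong: "realized X \<inter> A = realized X \<inter> A' \<Longrightarrow> pattern A X = pattern A' X"
  by (simp add: pattern_def)

lemma phase_invD:
  assumes "phase_inv S B A U CC"
  shows "U \<subseteq> complete_edges n" "A \<inter> U = {}" "copies A U CC"
    "\<And>X Y. X \<in> CC \<Longrightarrow> Y \<in> CC \<Longrightarrow> X \<noteq> Y \<Longrightarrow> role ` X \<inter> role ` Y = {} \<Longrightarrow> X \<inter> B = {} \<Longrightarrow> cross X Y \<subseteq> U"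
    "\<And>X p. X \<in> CC \<Longrightarrow> p \<in> role ` X \<Longrightarrow> part S p \<subseteq> role ` X"
    "\<And>X. X \<in> CC \<Longrightarrow> induced S (role ` X) \<subseteq> pattern A X"
proof -
  note inv = assms[unfolded phase_inv_def]
  show "U \<subseteq> complete_edges n" "A \<inter> U = {}" "copies A U CC"
    using inv by simp_all
  show "cross X Y \<subseteq> U"
    if "X \<in> CC" "Y \<in> CC" "X \<noteq> Y" "role ` X \<inter> role ` Y = {}" "X \<inter> B = {}" for X Y
    using inv that by simp
  show "part S p \<subseteq> role ` X" if "X \<in> CC" "p \<in> role ` X" for X p
    using inv that by blast
  show "induced S (role ` X) \<subseteq> pattern A X" if "X \<in> CC" for X
    using inv that by simp
qed

section \<open>The three kinds of moves of Avoider\<close>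

lemma move_junk:
  assumes inv: "phase_inv S B A U CC" and a: "a \<in> junk U CC"
  shows "phase_inv S B (insert a A) (U - {a}) CC"
    "\<And>X. X \<in> CC \<Longrightarrow> realized X \<inter> insert a A = realized X \<inter> A"
    "\<And>X Y. X \<in> CC \<Longrightarrow> Y \<in> CC \<Longrightarrow> open_pair U X Y \<Longrightarrow> open_pair (U - {a}) X Y"
    "junk (U - {a}) CC = junk U CC - {a}"
proof -
  note D = phase_invD[OF inv]
  have not: "a \<notin> realized X" if "X \<in> CC" for X using a that unfolding junk_def by blast
  show same: "realized X \<inter> insert a A = realized X \<inter> A" if "X \<in> CC" for X
    using not[OF that] by blast
  have pat: "pattern (insert a A) X = pattern A X" if "X \<in> CC" for X
    using same[OF that] by (rule pattern_cong)
  show op: "open_pair (U - {a}) X Y" if "X \<in> CC" "Y \<in> CC" "open_pair U X Y" for X Y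
    using a that unfolding junk_def open_pair_def by blast
  have op': "open_pair (U - {a}) X Y \<longleftrightarrow> open_pair U X Y" if "X \<in> CC" "Y \<in> CC" for X Y
    using op[OF that] unfolding open_pair_def by blast
  have "copies (insert a A) (U - {a}) CC"
    using D(3) unfolding copies_def by (simp add: pat) blast
  moreover have "cross X Y \<subseteq> U - {a}"
    if "X \<in> CC" "Y \<in> CC" "X \<noteq> Y" "role ` X \<inter> role ` Y = {}" "X \<inter> B = {}" for X Y
    using D(4)[OF that] op[OF that(1,2)] that unfolding open_pair_def by blast
  ultimately show "phase_inv S B (insert a A) (U - {a}) CC"
    using D(1,2,5,6) unfolding phase_inv_def by (simp add: pat) blast
  show "junk (U - {a}) CC = junk U CC - {a}"
    unfolding junk_def using op' by blast
qed


lemma connected_by_mono: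
  assumes "connected_by S D" "S \<subseteq> S'"
  shows "connected_by S' D"
  using assms(1) reach_mono[OF assms(2)] unfolding connected_by_def by (meson subsetD)

text \<open>Roles are injective on \<open>X\<close>, so a free edge inside \<open>X\<close> is new
  to its pattern and \<open>X\<close> is advanced afterwards. Other copies are disjoint from
  \<open>X\<close> and keep their patterns.\<close>

lemma move_chord:
  assumes inv: "phase_inv S B A U CC" and X: "X \<in> CC" and a: "a \<in> realized X" "a \<in> U"
  shows "phase_inv S B (insert a A) (U - {a}) CC"
    and "\<And>Y. Y \<in> CC \<Longrightarrow> Y \<inter> X = {} \<Longrightarrow> realized Y \<inter> insert a A = realized Y \<inter> A"
    and "progress S A CC + 1 \<le> progress S (insert a A) CC"
    and "available S B A CC p \<le> available S B (insert a A) CC p"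
proof -
  note D = phase_invD[OF inv]
  have aA: "a \<notin> A" using D(2) a(2) by blast
  have aX: "a \<subseteq> X" "a \<noteq> {}" using realizedD[OF a(1)] by auto
  have not: "a \<notin> realized Y" if "Y \<in> CC" "Y \<noteq> X" for Y
  proof
    assume "a \<in> realized Y"
    then have "a \<subseteq> Y" using realizedD by blast
    then obtain x where "x \<in> X" "x \<in> Y" using aX by blast
    then show False using copies_disjoint[OF D(3) X that(1)] that(2) by blast
  qed
  have same: "realized Y \<inter> insert a A = realized Y \<inter> A" if "Y \<in> CC" "Y \<noteq> X" for Y
    using not[OF that] by blast
  then have pat: "pattern (insert a A) Y = pattern A Y" if "Y \<in> CC" "Y \<noteq> X" for Y
    using that by (intro pattern_cong) blast
  show "realized Y \<inter> insert a A = realized Y \<inter> A" if "Y \<in> CC" "Y \<inter> X = {}" for Y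
    using same[OF that(1)] that(2) copiesD(2)[OF D(3) X] by blast
  have eqX: "realized X \<inter> insert a A = insert a (realized X \<inter> A)" using a(1) by blast
  have patX: "pattern (insert a A) X = insert (role ` a) (pattern A X)"
    unfolding pattern_def eqX by simp
  have mono: "pattern A Y \<subseteq> pattern (insert a A) Y" for Y
    unfolding pattern_def by blast
  have new: "role ` a \<notin> pattern A X"
  proof
    assume "role ` a \<in> pattern A X"
    then obtain f where f: "f \<in> realized X" "f \<in> A" "role ` f = role ` a"
      unfolding pattern_def by auto
    then have "f = a"
      using inj_onD[OF realized_image_inj[OF copiesD(3)[OF D(3) X]], of f a] a(1) by simp
    then show False using f(2) aA by simp
  qed
  have advX: "advanced S (insert a A) X"
    using new D(6)[OF X] unfolding advanced_def patX by blast
  have adv: "advanced S (insert a A) Y \<longleftrightarrow> advanced S A Y" if "Y \<in> CC" "Y \<noteq> X" for Y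
    unfolding advanced_def pat[OF that] ..
  have "copies (insert a A) (U - {a}) CC"
    unfolding copies_def
  proof (intro conjI ballI)
    show "disjoint CC" using D(3) unfolding copies_def by blast
    fix Y assume Y: "Y \<in> CC"
    show "Y \<subseteq> {..<n}" "Y \<noteq> {}" "inj_on role Y" using copiesD[OF D(3) Y] by blast+
    show "realized Y \<subseteq> insert a A \<union> (U - {a})" using copiesD(4)[OF D(3) Y] by blast
    show "connected_by (pattern (insert a A) Y) (role ` Y)"
      by (rule connected_by_mono[OF copiesD_connected[OF D(3) Y] mono])
  qed
  moreover have "cross Y Z \<subseteq> U - {a}"
    if "Y \<in> CC" "Z \<in> CC" "Y \<noteq> Z" "role ` Y \<inter> role ` Z = {}" "Y \<inter> B = {}" for Y Z
    using D(4)[OF that] cross_not_realized[OF D(3) that(1,2,3) X, of a] a(1) by blast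
  moreover have "induced S (role ` Y) \<subseteq> pattern (insert a A) Y" if "Y \<in> CC" for Y
    using D(6)[OF that] mono[of Y] by blast
  ultimately show "phase_inv S B (insert a A) (U - {a}) CC"
    using D(1,2,5) unfolding phase_inv_def by (auto simp del: insert_iff)
  have fin: "finite CC" using copies_finite[OF D(3)] .
  let ?R = "{Y \<in> CC. advanced S A Y} - {X}"
  have finR: "finite ?R" using fin by simp
  have "progress S A CC \<le> (\<Sum>Y\<in>?R. card (realized Y \<inter> A)) + card (realized X \<inter> A)"
    unfolding progress_def using fin by (cases "X \<in> {Y \<in> CC. advanced S A Y}") (auto simp: sum.remove)
  moreover have "progress S (insert a A) CC =
      (\<Sum>Y\<in>?R. card (realized Y \<inter> A)) + (card (realized X \<inter> A) + 1)"
  proof -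
    have "{Y \<in> CC. advanced S (insert a A) Y} = insert X ?R"
      using advX adv X by blast
    then have "progress S (insert a A) CC = (\<Sum>Y\<in>insert X ?R. card (realized Y \<inter> insert a A))"
      unfolding progress_def by simp
    also have "\<dots> = (\<Sum>Y\<in>?R. card (realized Y \<inter> insert a A)) + card (realized X \<inter> insert a A)"
      using finR by (subst sum.insert) (auto simp: add.commute)
    also have "(\<Sum>Y\<in>?R. card (realized Y \<inter> insert a A)) = (\<Sum>Y\<in>?R. card (realized Y \<inter> A))"
      using same by (intro sum.cong) auto
    also have "card (realized X \<inter> insert a A) = card (realized X \<inter> A) + 1"
    proof -
      have "finite (realized X)"
        unfolding realized_def using copiesD(5)[OF D(3) X] by (simp add: finite_imp_finite_nsets)
      then show ?thesis unfolding eqX using aA by simp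
    qed
    finally show ?thesis .
  qed
  ultimately show "progress S A CC + 1 \<le> progress S (insert a A) CC" by simp
  show "available S B A CC p \<le> available S B (insert a A) CC p"
    unfolding available_def
  proof (rule card_mono)
    show "finite {X \<in> CC. p \<in> role ` X \<and> (advanced S (insert a A) X \<or> X \<inter> B = {})}"
      using fin by simp
    show "{X \<in> CC. p \<in> role ` X \<and> (advanced S A X \<or> X \<inter> B = {})}
        \<subseteq> {X \<in> CC. p \<in> role ` X \<and> (advanced S (insert a A) X \<or> X \<inter> B = {})}"
      using adv advX by blast
  qed
qed

text \<open>The union replaces both copies. Openness of the pair supplies what is needed: disjoint
  roles make \<open>role\<close> injective on the union, and free cross edges mean that Enforcer
  owns nothing in it.\<close>

lemma move_merge:
  assumes inv: "phase_inv S B A U CC" and X: "X \<in> CC" and Y: "Y \<in> CC" and op: "open_pair U X Y"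
    and a: "a \<in> cross X Y" and S: "S \<subseteq> E"
  defines "CC' \<equiv> insert (X \<union> Y) (CC - {X, Y})"
  shows "phase_inv S B (insert a A) (U - {a}) CC'"
    and "\<And>W. W \<in> CC \<Longrightarrow> W \<inter> (X \<union> Y) = {} \<Longrightarrow> W \<in> CC' \<and> realized W \<inter> insert a A = realized W \<inter> A"
    and "progress S A CC + 1 \<le> progress S (insert a A) CC'"
    and "available S B A CC p \<le> available S B (insert a A) CC' p"
    and "card (X \<union> Y) \<le> card V"
proof -
  note D = phase_invD[OF inv]
  let ?A = "insert a A" and ?U = "U - {a}" and ?Z = "X \<union> Y"
  have XY: "X \<noteq> Y" "role ` X \<inter> role ` Y = {}" "cross X Y \<subseteq> U"
    using op unfolding open_pair_def by blast+
  have aU: "a \<in> U" using a XY(3) by blast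
  have aA: "a \<notin> A" using D(2) aU by blast
  obtain x y where xy: "a = {x, y}" "x \<in> X" "y \<in> Y" "{role x, role y} \<in> E"
    using a by (rule crossE)
  have disj: "X \<inter> Y = {}" using copies_disjoint[OF D(3) X Y] XY(1) by blast
  have not: "a \<notin> realized W" if "W \<in> CC" for W
    using cross_not_realized[OF D(3) X Y XY(1) that a] .
  have same: "realized W \<inter> ?A = realized W \<inter> A" if "W \<in> CC" for W
    using not[OF that] by blast
  have pat: "pattern ?A W = pattern A W" if "W \<in> CC" for W
    using same[OF that] by (rule pattern_cong)
  have adv: "advanced S ?A W \<longleftrightarrow> advanced S A W" if "W \<in> CC" for W
    unfolding advanced_def pat[OF that] ..
  have other: "W \<inter> ?Z = {}" if "W \<in> CC - {X, Y}" for W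
    using copies_disjoint[OF D(3) X, of W] copies_disjoint[OF D(3) Y, of W] that by blast
  show "W \<in> CC' \<and> realized W \<inter> ?A = realized W \<inter> A" if "W \<in> CC" "W \<inter> ?Z = {}" for W
  proof -
    have "W \<noteq> X" "W \<noteq> Y" using that copiesD(2)[OF D(3)] X Y by blast+
    then show ?thesis using that same unfolding CC'_def by blast
  qed
  have Z_new: "?Z \<notin> CC - {X, Y}" using other[of ?Z] xy by blast
  have realZ: "realized ?Z = realized X \<union> realized Y \<union> cross X Y" by (rule realized_Un[OF disj])
  have crossA: "cross X Y \<inter> A = {}" using XY(3) D(2) by blast
  have realZA: "realized ?Z \<inter> ?A = insert a (realized X \<inter> A \<union> realized Y \<inter> A)"
    unfolding realZ using crossA a not[OF X] not[OF Y] by blast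
  have patZ: "pattern ?A ?Z = insert (role ` a) (pattern A X \<union> pattern A Y)"
    unfolding pattern_def realZA by blast
  have inj: "inj_on role ?Z"
    using copiesD(3)[OF D(3) X] copiesD(3)[OF D(3) Y] XY(2) by (auto simp: inj_on_Un)
  have subZ: "?Z \<subseteq> {..<n}" using copiesD(1)[OF D(3)] X Y by blast
  have "role ` ?Z \<subseteq> V" using role_in subZ by auto
  then show "card ?Z \<le> card V" by (rule card_inj_on_le[OF inj _ finite_V])
  have connZ: "connected_by (pattern ?A ?Z) (role ` ?Z)"
  proof -
    have cX: "(p, q) \<in> reach (pattern ?A ?Z)" if "p \<in> role ` X" "q \<in> role ` X" for p q
    proof -
      have "connected_by (pattern ?A ?Z) (role ` X)"
        by (rule connected_by_mono[OF copiesD_connected[OF D(3) X]]) (use patZ in blast)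
      then show ?thesis using that by (simp only: connected_by_def)
    qed
    have cY: "(p, q) \<in> reach (pattern ?A ?Z)" if "p \<in> role ` Y" "q \<in> role ` Y" for p q
    proof -
      have "connected_by (pattern ?A ?Z) (role ` Y)"
        by (rule connected_by_mono[OF copiesD_connected[OF D(3) Y]]) (use patZ in blast)
      then show ?thesis using that by (simp only: connected_by_def)
    qed
    have link: "(role x, role y) \<in> reach (pattern ?A ?Z)"
      by (rule reach_edge, unfold patZ) (simp add: xy(1))
    have XtoY: "(p, q) \<in> reach (pattern ?A ?Z)" if "p \<in> role ` X" "q \<in> role ` Y" for p q
    proof -
      have "(p, role x) \<in> reach (pattern ?A ?Z)" using cX[OF that(1)] xy(2) by blast
      moreover have "(role y, q) \<in> reach (pattern ?A ?Z)" using cY[OF _ that(2)] xy(3) by blast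
      ultimately show ?thesis using reach_trans[OF reach_trans[OF _ link]] by blast
    qed
    show ?thesis
      unfolding connected_by_def
    proof (intro ballI)
      fix p q assume pq: "p \<in> role ` ?Z" "q \<in> role ` ?Z"
      then consider "p \<in> role ` X" "q \<in> role ` X" | "p \<in> role ` Y" "q \<in> role ` Y"
        | "p \<in> role ` X" "q \<in> role ` Y" | "q \<in> role ` X" "p \<in> role ` Y"
        unfolding image_Un by fast
      then show "(p, q) \<in> reach (pattern ?A ?Z)"
      proof cases
        case 1 then show ?thesis by (rule cX)
      next
        case 2 then show ?thesis by (rule cY)
      next
        case 3 then show ?thesis by (rule XtoY)
      next
        case 4 then show ?thesis by (intro reach_sym[OF XtoY])
      qed
    qed
  qed
  \<comment> \<open>The image of \<open>a\<close> is not in \<open>S\<close>: otherwise the role of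
    \<open>y\<close> would be in the part of the role of \<open>x\<close>, hence a role in
    \<open>X\<close> as well.\<close>
  have advZ: "advanced S ?A ?Z"
  proof -
    have "role ` a \<notin> S"
    proof
      assume "role ` a \<in> S"
      then have "{role x, role y} \<in> S" using xy(1) by simp
      then have "role y \<in> part S (role x)" unfolding part_def using reach_edge by simp
      then have "role y \<in> role ` X" using D(5)[OF X, of "role x"] xy(2) by blast
      then show False using XY(2) xy(3) by blast
    qed
    then show ?thesis unfolding advanced_def patZ induced_def by blast
  qed
  have dis: "disjoint CC'"
    unfolding CC'_def disjoint_def
    using D(3) other unfolding copies_def disjoint_def by (auto simp: Int_commute)
  have "copies ?A ?U CC'"
    unfolding copies_def
  proof (intro conjI ballI)
    show "disjoint CC'" by (rule dis)
    fix W assume W: "W \<in> CC'"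
    consider "W = ?Z" | "W \<in> CC" using W unfolding CC'_def by blast
    then have "W \<subseteq> {..<n} \<and> W \<noteq> {} \<and> inj_on role W \<and> realized W \<subseteq> ?A \<union> ?U \<and>
        connected_by (pattern ?A W) (role ` W)"
    proof cases
      case 1
      have "realized ?Z \<subseteq> ?A \<union> ?U"
        unfolding realZ using copiesD(4)[OF D(3) X] copiesD(4)[OF D(3) Y] XY(3) by blast
      then show ?thesis using 1 subZ inj connZ xy(2) by blast
    next
      case 2
      have "realized W \<subseteq> ?A \<union> ?U" using copiesD(4)[OF D(3) 2] by blast
      then show ?thesis using copiesD(1,2,3)[OF D(3) 2] copiesD_connected[OF D(3) 2] pat[OF 2] by simp
    qed
    then show "W \<subseteq> {..<n}" "W \<noteq> {}" "inj_on role W" "realized W \<subseteq> ?A \<union> ?U"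
        "connected_by (pattern ?A W) (role ` W)" by simp_all
  qed
  \<comment> \<open>If the union avoids \<open>B\<close> or the roles of another copy, so do both
    halves. The edge \<open>a\<close> belongs to no pair other than \<open>X\<close> and
    \<open>Y\<close>.\<close>
  moreover have "cross W W' \<subseteq> ?U"
    if W: "W \<in> CC'" "W' \<in> CC'" "W \<noteq> W'" "role ` W \<inter> role ` W' = {}" "W \<inter> B = {}" for W W'
  proof -
    have notin: "a \<notin> cross P Q" if "P \<in> CC - {X, Y}" "Q \<in> CC" "P \<noteq> Q" for P Q
      using cross_unique[OF D(3) _ that(2) X Y XY(1) _ a, of P] that by blast
    have notin': "a \<notin> cross Q P" if "P \<in> CC - {X, Y}" "Q \<in> CC" "P \<noteq> Q" for P Q
      using notin[OF that] cross_sym by simp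
    consider "W = ?Z" "W' \<in> CC - {X, Y}" | "W' = ?Z" "W \<in> CC - {X, Y}"
      | "W \<in> CC - {X, Y}" "W' \<in> CC - {X, Y}"
      using W unfolding CC'_def by blast
    then show ?thesis
    proof cases
      case 1
      then have ne: "X \<noteq> W'" "Y \<noteq> W'" and W': "W' \<in> CC" by blast+
      have "cross X W' \<subseteq> U" by (rule D(4)[OF X W' ne(1)]) (use W(4,5) 1(1) in blast)+
      moreover have "cross Y W' \<subseteq> U" by (rule D(4)[OF Y W' ne(2)]) (use W(4,5) 1(1) in blast)+
      ultimately show ?thesis
        unfolding 1(1) cross_Un using notin'[OF 1(2) X] notin'[OF 1(2) Y] ne by blast
    next
      case 2
      then have ne: "W \<noteq> X" "W \<noteq> Y" and W': "W \<in> CC" by blast+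
      have "cross W X \<subseteq> U" by (rule D(4)[OF W' X ne(1)]) (use W(4,5) 2(1) in blast)+
      moreover have "cross W Y \<subseteq> U" by (rule D(4)[OF W' Y ne(2)]) (use W(4,5) 2(1) in blast)+
      ultimately show ?thesis
        unfolding 2(1) cross_Un using notin[OF 2(2) X] notin[OF 2(2) Y] ne by blast
    next
      case 3
      then show ?thesis using D(4)[OF _ _ W(3,4,5)] notin[OF 3(1) _ W(3)] by blast
    qed
  qed
  moreover have "part S p \<subseteq> role ` W" if "W \<in> CC'" "p \<in> role ` W" for W p
    using that D(5)[of W p] D(5)[OF X, of p] D(5)[OF Y, of p] unfolding CC'_def by blast
  moreover have "induced S (role ` W) \<subseteq> pattern ?A W" if W: "W \<in> CC'" for W
  proof (cases "W = ?Z")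
    case False
    then have "W \<in> CC" using W unfolding CC'_def by blast
    then show ?thesis using D(6)[of W] pat[of W] by simp
  next
    case True
    show ?thesis
    proof
      fix e assume e: "e \<in> induced S (role ` W)"
      have eS: "e \<in> S" and sub: "e \<subseteq> role ` X \<union> role ` Y" using e True unfolding induced_def by auto
      obtain p q where pq: "e = {p, q}"
        using eS S E_subset unfolding nsets_def by (auto simp: card_2_iff)
      have q: "q \<in> part S p" using eS reach_edge unfolding part_def pq by simp
      have in_pattern: "e \<in> pattern ?A W" if T: "T \<in> CC" "p \<in> role ` T" "pattern A T \<subseteq> pattern ?A W" for T
      proof -
        have "e \<subseteq> role ` T" using D(5)[OF T(1,2)] q T(2) unfolding pq by blast
        then have "e \<in> induced S (role ` T)" using eS unfolding induced_def by simp
        then show ?thesis using D(6)[OF T(1)] T(3) by blast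
      qed
      have "p \<in> role ` X \<or> p \<in> role ` Y" using sub unfolding pq by blast
      then show "e \<in> pattern ?A W"
        using in_pattern[OF X] in_pattern[OF Y] unfolding True patZ by blast
    qed
  qed
  ultimately show "phase_inv S B ?A ?U CC'"
    using D(1,2) unfolding phase_inv_def by (auto simp del: insert_iff)
  have fin: "finite CC" using copies_finite[OF D(3)] .
  have finreal: "finite (realized W)" if "W \<in> CC" for W
    unfolding realized_def using copiesD(5)[OF D(3) that] by (simp add: finite_imp_finite_nsets)
  let ?R = "{W \<in> CC. advanced S A W} - {X, Y}"
  let ?f = "\<lambda>W. card (realized W \<inter> A)"
  have finR: "finite ?R" using fin by simp
  \<comment> \<open>\<open>X\<close> and \<open>Y\<close> are included whether advanced or not,
    because their union is advanced and inherits the edges of both.\<close>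
  have "progress S A CC \<le> sum ?f (?R \<union> {X, Y})"
    unfolding progress_def by (rule sum_mono2) (use finR in auto)
  also have "\<dots> = sum ?f ?R + (?f X + ?f Y)"
    using finR XY(1) by (subst sum.union_disjoint) auto
  finally have le: "progress S A CC \<le> sum ?f ?R + (?f X + ?f Y)" .
  have "card (realized ?Z \<inter> ?A) = ?f X + ?f Y + 1"
  proof -
    have "realized X \<inter> realized Y = {}"
      using realizedD[of _ X] realizedD[of _ Y] disj by blast
    then have "card (realized X \<inter> A \<union> realized Y \<inter> A) = ?f X + ?f Y"
      using finreal[OF X] finreal[OF Y] by (intro card_Un_disjoint) auto
    then show ?thesis unfolding realZA using finreal[OF X] finreal[OF Y] aA by simp
  qed
  moreover have "progress S ?A CC' = card (realized ?Z \<inter> ?A) + sum ?f ?R"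
  proof -
    have "{W \<in> CC'. advanced S ?A W} = insert ?Z ?R"
      using advZ adv unfolding CC'_def by blast
    then have "progress S ?A CC' = (\<Sum>W\<in>insert ?Z ?R. card (realized W \<inter> ?A))"
      unfolding progress_def by simp
    also have "\<dots> = card (realized ?Z \<inter> ?A) + (\<Sum>W\<in>?R. card (realized W \<inter> ?A))"
      using finR Z_new by (intro sum.insert) auto
    also have "(\<Sum>W\<in>?R. card (realized W \<inter> ?A)) = sum ?f ?R"
      using same by (intro sum.cong) auto
    finally show ?thesis .
  qed
  ultimately show "progress S A CC + 1 \<le> progress S ?A CC'" using le by simp
  show "available S B A CC p \<le> available S B ?A CC' p"
  proof -
    let ?P = "{W \<in> CC. p \<in> role ` W \<and> (advanced S A W \<or> W \<inter> B = {})}"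
    let ?P' = "{W \<in> CC'. p \<in> role ` W \<and> (advanced S ?A W \<or> W \<inter> B = {})}"
    have finP': "finite ?P'" using fin unfolding CC'_def by simp
    have sub: "?P - {X, Y} \<subseteq> ?P'" using adv unfolding CC'_def by blast
    show ?thesis
    proof (cases "p \<in> role ` ?Z")
      case True
      then have "insert ?Z (?P - {X, Y}) \<subseteq> ?P'" using sub advZ unfolding CC'_def by blast
      then have "card (insert ?Z (?P - {X, Y})) \<le> card ?P'" by (rule card_mono[OF finP'])
      moreover have "card (insert ?Z (?P - {X, Y})) = card (?P - {X, Y}) + 1"
        using fin Z_new by (subst card_insert_disjoint) auto
      \<comment> \<open>\<open>X\<close> and \<open>Y\<close> share no role, so at most one of them
        counted for \<open>p\<close>; the union takes its place.\<close>
      moreover have "card ?P \<le> card (?P - {X, Y}) + 1"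
      proof -
        have "\<exists>T. ?P \<subseteq> insert T (?P - {X, Y})"
        proof (cases "p \<in> role ` X")
          case True
          then have "p \<notin> role ` Y" using XY(2) by blast
          then show ?thesis by (intro exI[of _ X]) blast
        next
          case False
          then show ?thesis by (intro exI[of _ Y]) blast
        qed
        then obtain T where "?P \<subseteq> insert T (?P - {X, Y})" ..
        then have "card ?P \<le> card (insert T (?P - {X, Y}))" by (rule card_mono[rotated]) (use fin in simp)
        also have "\<dots> \<le> card (?P - {X, Y}) + 1" using fin by (simp add: card_insert_if)
        finally show ?thesis .
      qed
      ultimately show ?thesis unfolding available_def by linarith
    next
      case False
      then have "?P \<subseteq> ?P'" using sub by blast
      then show ?thesis unfolding available_def by (rule card_mono[OF finP'])
    qed
  qed
qed

end

section \<open>Edges that Enforcer sacrifices\<close>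

text \<open>Whole units are taken first. If units have two edges and \<open>m\<close> is odd, one
  more unit is broken, and its other edge is the only leftover.\<close>

lemma select_units:
  fixes UU :: "'b set set"
  assumes fin: "finite UU" and disj: "disjoint UU" and units: "\<And>u. u \<in> UU \<Longrightarrow> finite u \<and> card u = c"
    and c: "c = 1 \<or> c = 2" and m: "m \<le> card (\<Union>UU)"
  obtains T where "T \<subseteq> \<Union>UU" "card T = m"
    "card {e \<in> \<Union>UU - T. \<exists>u\<in>UU. e \<in> u \<and> u \<inter> T \<noteq> {}} \<le> (if c = 2 \<and> odd m then 1 else 0)"
proof -
  have card_Union: "card (\<Union>VV) = c * card VV" if "VV \<subseteq> UU" for VV
  proof -
    have "card (\<Union>VV) = (\<Sum>u\<in>VV. card u)"
    proof (rule card_Union_disjoint)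
      show "pairwise disjnt VV"
        using disj that unfolding disjoint_def pairwise_def disjnt_def by blast
    qed (use units that in blast)
    also have "\<dots> = (\<Sum>u\<in>VV. c)" using units that by (intro sum.cong) auto
    finally show ?thesis by simp
  qed
  let ?k = "m div c"
  have "c * ?k \<le> m" by simp
  then have "c * ?k \<le> c * card UU" using m card_Union[OF subset_refl] by linarith
  then have "?k \<le> card UU" using c by auto
  then obtain VV where VV: "VV \<subseteq> UU" "card VV = ?k" using obtain_subset_with_card_n by metis
  have finV: "finite (\<Union>VV)" using finite_subset[OF VV(1) fin] VV(1) units by blast
  have full: "u \<in> VV" if u: "u \<in> UU" "u \<inter> \<Union>VV \<noteq> {}" for u
  proof -
    obtain v where v: "v \<in> VV" "u \<inter> v \<noteq> {}" using u(2) by blast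
    then have "u = v" using disj u(1) VV(1) unfolding disjoint_def by blast
    then show ?thesis using v by simp
  qed
  show thesis
  proof (cases "c * ?k = m")
    case True
    have none: "{e \<in> \<Union>UU - \<Union>VV. \<exists>u\<in>UU. e \<in> u \<and> u \<inter> \<Union>VV \<noteq> {}} = {}"
      using full by blast
    show ?thesis
    proof (rule that[of "\<Union>VV"])
      show "\<Union>VV \<subseteq> \<Union>UU" using VV(1) by blast
      show "card (\<Union>VV) = m" using card_Union[OF VV(1)] VV(2) True by simp
    qed (simp only: none card.empty le0)
  next
    case False
    then have c2: "c = 2" using c by auto
    then have odd: "odd m" using False by (metis dvd_mult_div_cancel)
    then have mk: "m = 2 * ?k + 1" using c2 by simp
    have "?k \<noteq> card UU" using m card_Union[OF subset_refl] mk c2 by simp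
    then have "VV \<noteq> UU" using VV(2) by auto
    then obtain u where u: "u \<in> UU" "u \<notin> VV" using VV(1) by blast
    then obtain x where x: "x \<in> u" using units[of u] c2 by fastforce
    have disj_u: "u \<inter> \<Union>VV = {}" using full[OF u(1)] u(2) by blast
    let ?T = "insert x (\<Union>VV)"
    have sub: "{e \<in> \<Union>UU - ?T. \<exists>u\<in>UU. e \<in> u \<and> u \<inter> ?T \<noteq> {}} \<subseteq> u - {x}"
    proof
      fix e assume "e \<in> {e \<in> \<Union>UU - ?T. \<exists>u\<in>UU. e \<in> u \<and> u \<inter> ?T \<noteq> {}}"
      then obtain v where v: "v \<in> UU" "e \<in> v" "v \<inter> ?T \<noteq> {}" "e \<notin> ?T" by blast
      then have "v \<notin> VV" by blast
      then have "x \<in> v" using full[OF v(1)] v(3) by blast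
      then have "v = u" using disj v(1) u(1) x unfolding disjoint_def by blast
      then show "e \<in> u - {x}" using v by blast
    qed
    have "card {e \<in> \<Union>UU - ?T. \<exists>u\<in>UU. e \<in> u \<and> u \<inter> ?T \<noteq> {}} \<le> card (u - {x})"
      by (rule card_mono[OF _ sub]) (use units[OF u(1)] in simp)
    also have "\<dots> = 1" using units[OF u(1)] x c2 by simp
    finally have 1: "card {e \<in> \<Union>UU - ?T. \<exists>u\<in>UU. e \<in> u \<and> u \<inter> ?T \<noteq> {}} \<le> 1" .
    show ?thesis
    proof (rule that[of ?T])
      show "?T \<subseteq> \<Union>UU" using VV(1) u(1) x by blast
      have "x \<notin> \<Union>VV" using disj_u x by blast
      then show "card ?T = m" using finV card_Union[OF VV(1)] VV(2) mk c2 by simp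
    qed (use 1 odd c2 in simp)
  qed
qed

context roles
begin

text \<open>A unit consists of all cross edges between two copies that are not advanced, one from
  each block. Once Enforcer claims one of them the pair is no longer open and the rest of the unit
  is junk, so units are best spent as a whole.\<close>

definition units :: "'a set set \<Rightarrow> nat set set \<Rightarrow> nat set set \<Rightarrow> nat set set \<Rightarrow> nat set set \<Rightarrow>
    nat set set \<Rightarrow> nat set set set" where
  "units S S1 S2 A U CC = {cross X Y | X Y. X \<in> CC \<inter> S1 \<and> Y \<in> CC \<inter> S2 \<and>
     \<not> advanced S A X \<and> \<not> advanced S A Y \<and> open_pair U X Y}"

lemma unitsE:
  assumes "u \<in> units S S1 S2 A U CC"
  obtains X Y where "u = cross X Y" "X \<in> CC" "X \<in> S1" "Y \<in> CC" "Y \<in> S2" "X \<noteq> Y"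
    "role ` X \<inter> role ` Y = {}" "cross X Y \<subseteq> U" "\<not> advanced S A X" "\<not> advanced S A Y"
  using assms unfolding units_def open_pair_def by blast

lemma unitsI:
  assumes "X \<in> CC" "X \<in> S1" "Y \<in> CC" "Y \<in> S2" "X \<noteq> Y"
    "role ` X \<inter> role ` Y = {}" "cross X Y \<subseteq> U" "\<not> advanced S A X" "\<not> advanced S A Y"
  shows "cross X Y \<in> units S S1 S2 A U CC"
  using assms unfolding units_def open_pair_def by blast

lemma units_subset: "\<Union> (units S S1 S2 A U CC) \<subseteq> U"
proof
  fix e assume "e \<in> \<Union> (units S S1 S2 A U CC)"
  then obtain u where u: "u \<in> units S S1 S2 A U CC" "e \<in> u" by blast
  show "e \<in> U" by (rule unitsE[OF u(1)]) (use u(2) in blast)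
qed

lemma units_disjoint:
  assumes "copies A U CC"
  shows "disjoint (units S S1 S2 A U CC)"
  unfolding disjoint_def
proof (intro ballI impI)
  fix u v assume u: "u \<in> units S S1 S2 A U CC" and v: "v \<in> units S S1 S2 A U CC" and ne: "u \<noteq> v"
  obtain X Y where X: "u = cross X Y" "X \<in> CC" "Y \<in> CC" "X \<noteq> Y" by (rule unitsE[OF u]) blast
  obtain X' Y' where X': "v = cross X' Y'" "X' \<in> CC" "Y' \<in> CC" "X' \<noteq> Y'" by (rule unitsE[OF v]) blast
  show "u \<inter> v = {}"
  proof (rule ccontr)
    assume "u \<inter> v \<noteq> {}"
    then obtain e where "e \<in> cross X Y" "e \<in> cross X' Y'" using X(1) X'(1) by blast
    then have "X = X' \<and> Y = Y' \<or> X = Y' \<and> Y = X'"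
      using cross_unique[OF assms X(2,3) X'(2,3,4)] by blast
    then show False using ne X(1) X'(1) cross_sym by blast
  qed
qed

lemma units_finite:
  assumes "copies A U CC"
  shows "finite (units S S1 S2 A U CC)"
proof -
  have "units S S1 S2 A U CC \<subseteq> (\<lambda>(X, Y). cross X Y) ` (CC \<times> CC)"
    unfolding units_def by auto
  then show ?thesis using finite_subset copies_finite[OF assms] by (meson finite_SigmaI finite_imageI)
qed

definition links :: "'a set \<Rightarrow> 'a set \<Rightarrow> 'a set set" where
  "links Q Q' = {e \<in> E. \<exists>p\<in>Q. \<exists>q\<in>Q'. e = {p, q}}"

text \<open>Roles identify the edges between two copies with edges of the target, so all units of a
  phase have the same size.\<close>

lemma card_cross:
  assumes "inj_on role X" "inj_on role Y" "role ` X \<inter> role ` Y = {}"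
  shows "card (cross X Y) = card (links (role ` X) (role ` Y))"
proof -
  have inj: "inj_on role (X \<union> Y)" using assms by (auto simp: inj_on_Un)
  have "cross X Y \<subseteq> Pow (X \<union> Y)" unfolding cross_def by blast
  then have "inj_on ((`) role) (cross X Y)"
    by (rule inj_on_subset[OF inj_on_image_Pow[OF inj]])
  moreover have "(`) role ` cross X Y = links (role ` X) (role ` Y)"
  proof
    show "(`) role ` cross X Y \<subseteq> links (role ` X) (role ` Y)"
      unfolding links_def cross_def by auto
    show "links (role ` X) (role ` Y) \<subseteq> (`) role ` cross X Y"
    proof
      fix e assume "e \<in> links (role ` X) (role ` Y)"
      then obtain x y where xy: "x \<in> X" "y \<in> Y" "e = {role x, role y}" "e \<in> E"
        unfolding links_def by blast
      then have "{x, y} \<in> cross X Y" unfolding cross_def by blast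
      then have "role ` {x, y} \<in> (`) role ` cross X Y" by (rule imageI)
      then show "e \<in> (`) role ` cross X Y" using xy(3) by simp
    qed
  qed
  ultimately show ?thesis using card_image by fastforce
qed

lemma units_realized_disjoint:
  assumes "copies A U CC" "u \<in> units S S1 S2 A U CC" "X \<in> CC"
  shows "u \<inter> realized X = {}"
proof -
  obtain Y Z where "u = cross Y Z" "Y \<in> CC" "Z \<in> CC" "Y \<noteq> Z" by (rule unitsE[OF assms(2)]) blast
  then show ?thesis using cross_not_realized[OF assms(1) _ _ _ assms(3)] by blast
qed

text \<open>Junk lies outside all copies and open pairs, and sacrificed edges have both ends in the
  blocks, so nothing protected is lost. An edge newly becomes junk only if another edge of its unit
  is taken.\<close>

lemma enforcer_reply:
  assumes inv: "phase_inv S (\<Union>S1 \<union> \<Union>S2) A U CC" and J: "J \<subseteq> junk U CC"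
    and T: "T \<subseteq> \<Union> (units S S1 S2 A U CC)"
  shows "phase_inv S (\<Union>S1 \<union> \<Union>S2) A (U - (J \<union> T)) CC"
    and "{u \<in> units S S1 S2 A U CC. u \<inter> T = {}} \<subseteq> units S S1 S2 A (U - (J \<union> T)) CC"
    and "junk (U - (J \<union> T)) CC \<subseteq> (junk U CC - J) \<union>
      {e \<in> \<Union> (units S S1 S2 A U CC) - T. \<exists>u \<in> units S S1 S2 A U CC. e \<in> u \<and> u \<inter> T \<noteq> {}}"
proof -
  note D = phase_invD[OF inv]
  let ?UU = "units S S1 S2 A U CC" and ?U = "U - (J \<union> T)"
  have J_real: "e \<notin> realized X" if "e \<in> J" "X \<in> CC" for e X
    using that J unfolding junk_def by blast
  have J_open: "e \<notin> cross X Y" if "e \<in> J" "X \<in> CC" "Y \<in> CC" "open_pair U X Y" for e X Y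
    using that J unfolding junk_def by blast
  have T_real: "e \<notin> realized X" if e: "e \<in> T" and X: "X \<in> CC" for e X
  proof -
    obtain u where "u \<in> ?UU" "e \<in> u" using e T by blast
    then show ?thesis using units_realized_disjoint[OF D(3) _ X] by blast
  qed
  have T_block: "e \<subseteq> \<Union>S1 \<union> \<Union>S2" if e: "e \<in> T" for e
  proof -
    obtain u where u: "u \<in> ?UU" "e \<in> u" using e T by blast
    obtain X Y where X: "u = cross X Y" "X \<in> S1" "Y \<in> S2" by (rule unitsE[OF u(1)]) blast
    then have "e \<in> cross X Y" using u(2) by simp
    then obtain x y where "e = {x, y}" "x \<in> X" "y \<in> Y" by (rule crossE)
    then show ?thesis using X by blast
  qed
  have "copies A ?U CC"
    unfolding copies_def
  proof (intro conjI ballI)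
    show "disjoint CC" using D(3) unfolding copies_def by blast
    fix X assume X: "X \<in> CC"
    show "X \<subseteq> {..<n}" "X \<noteq> {}" "inj_on role X" using copiesD[OF D(3) X] by blast+
    show "connected_by (pattern A X) (role ` X)" by (rule copiesD_connected[OF D(3) X])
    show "realized X \<subseteq> A \<union> ?U"
      using copiesD(4)[OF D(3) X] J_real[OF _ X] T_real[OF _ X] by blast
  qed
  moreover have "cross X Y \<subseteq> ?U"
    if X: "X \<in> CC" "Y \<in> CC" "X \<noteq> Y" "role ` X \<inter> role ` Y = {}" "X \<inter> (\<Union>S1 \<union> \<Union>S2) = {}" for X Y
  proof
    fix e assume e: "e \<in> cross X Y"
    have sub: "cross X Y \<subseteq> U" by (rule D(4)[OF X])
    then have "open_pair U X Y" using X unfolding open_pair_def by blast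
    then have "e \<notin> J" using J_open[OF _ X(1,2)] e by blast
    moreover have "e \<notin> T"
    proof
      assume "e \<in> T"
      moreover obtain x y where "e = {x, y}" "x \<in> X" using e by (rule crossE)
      ultimately show False using T_block[of e] X(5) by blast
    qed
    ultimately show "e \<in> ?U" using sub e by blast
  qed
  ultimately show "phase_inv S (\<Union>S1 \<union> \<Union>S2) A ?U CC"
    using D(1,2,5,6) unfolding phase_inv_def by (auto simp del: Un_iff)
  show "{u \<in> ?UU. u \<inter> T = {}} \<subseteq> units S S1 S2 A ?U CC"
  proof
    fix u assume "u \<in> {u \<in> ?UU. u \<inter> T = {}}"
    then have u: "u \<in> ?UU" "u \<inter> T = {}" by blast+
    obtain X Y where X: "u = cross X Y" "X \<in> CC" "X \<in> S1" "Y \<in> CC" "Y \<in> S2" "X \<noteq> Y"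
      "role ` X \<inter> role ` Y = {}" "cross X Y \<subseteq> U" "\<not> advanced S A X" "\<not> advanced S A Y"
      by (rule unitsE[OF u(1)])
    have "open_pair U X Y" using X unfolding open_pair_def by blast
    then have "cross X Y \<subseteq> ?U" using J_open[OF _ X(2,4)] X(1,8) u(2) by blast
    then show "u \<in> units S S1 S2 A ?U CC"
      unfolding X(1) by (intro unitsI X)
  qed
  show "junk ?U CC \<subseteq> (junk U CC - J) \<union> {e \<in> \<Union> ?UU - T. \<exists>u \<in> ?UU. e \<in> u \<and> u \<inter> T \<noteq> {}}"
  proof
    fix e assume e: "e \<in> junk ?U CC"
    then have eU: "e \<in> U" "e \<notin> J" "e \<notin> T" and e_real: "\<And>X. X \<in> CC \<Longrightarrow> e \<notin> realized X"
      and e_open: "\<And>X Y. X \<in> CC \<Longrightarrow> Y \<in> CC \<Longrightarrow> open_pair ?U X Y \<Longrightarrow> e \<notin> cross X Y"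
      unfolding junk_def by blast+
    show "e \<in> (junk U CC - J) \<union> {e \<in> \<Union> ?UU - T. \<exists>u \<in> ?UU. e \<in> u \<and> u \<inter> T \<noteq> {}}"
    proof (cases "e \<in> junk U CC")
      case True
      then show ?thesis using eU by blast
    next
      case False
      then obtain X Y where X: "X \<in> CC" "Y \<in> CC" "open_pair U X Y" "e \<in> cross X Y"
        using eU(1) e_real unfolding junk_def by blast
      then have "\<not> open_pair ?U X Y" using e_open by blast
      then obtain t where t: "t \<in> cross X Y" "t \<in> T"
        using X(3) J_open[OF _ X(1,2,3)] unfolding open_pair_def by blast
      then obtain u where u: "u \<in> ?UU" "t \<in> u" using T by blast
      obtain X' Y' where X': "u = cross X' Y'" "X' \<in> CC" "Y' \<in> CC" "X' \<noteq> Y'"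
        by (rule unitsE[OF u(1)]) blast
      have "X = X' \<and> Y = Y' \<or> X = Y' \<and> Y = X'"
        using cross_unique[OF D(3) X(1,2) X'(2,3,4) t(1)] u(2) X'(1) by blast
      then have "cross X Y = u" using X'(1) cross_sym[of X Y] by blast
      then show ?thesis using X(4) u(1) t eU by blast
    qed
  qed
qed

end

section \<open>Forcing one of the threats\<close>

lemma enforcer_pos_if_won:
  assumes mono: "\<And>A A'. P A \<Longrightarrow> A \<subseteq> A' \<Longrightarrow> P A'" and "finite U" "P A"
  shows "enforcer_pos b P A U"
  using assms(2,3)
proof (induction "card U" arbitrary: A U rule: less_induct)
  case less
  show ?case
  proof (cases "U = {}")
    case True
    then show ?thesis using less.prems by (auto intro: enforcer_pos.finished)
  next
    case False
    then show ?thesis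
    proof (rule enforcer_pos.move)
      fix a assume a: "a \<in> U"
      obtain B where B: "B \<subseteq> U - {a}" "card B = min b (card (U - {a}))"
        using obtain_subset_with_card_n[OF min.cobounded2] by metis
      have "U - {a} - B \<subset> U" using a by blast
      then have "card (U - {a} - B) < card U" using less.prems(1) by (rule psubset_card_mono[rotated])
      then have "enforcer_pos b P (insert a A) (U - {a} - B)"
        using less.prems mono[OF less.prems(2), of "insert a A"] by (intro less.hyps) auto
      then show "\<exists>B. B \<subseteq> U - {a} \<and> card B = min b (card (U - {a})) \<and>
          enforcer_pos b P (insert a A) (U - {a} - B)" using B by blast
    qed
  qed
qed

lemma enforcer_pos_only_threats:
  assumes mono: "\<And>A A'. P A \<Longrightarrow> A \<subseteq> A' \<Longrightarrow> P A'" and "finite U" "U \<noteq> {}"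
    and threat: "\<And>a. a \<in> U \<Longrightarrow> P (insert a A)"
  shows "enforcer_pos b P A U"
  using assms(3)
proof (rule enforcer_pos.move)
  fix a assume a: "a \<in> U"
  obtain B where B: "B \<subseteq> U - {a}" "card B = min b (card (U - {a}))"
    using obtain_subset_with_card_n[OF min.cobounded2] by metis
  have "enforcer_pos b P (insert a A) (U - {a} - B)"
    using assms(2) by (intro enforcer_pos_if_won[OF mono] threat a) auto
  then show "\<exists>B. B \<subseteq> U - {a} \<and> card B = min b (card (U - {a})) \<and>
      enforcer_pos b P (insert a A) (U - {a} - B)" using B by blast
qed

text \<open>Enforcer claims threats only when nothing else is left. If he is never forced to, then
  Avoider's last move is made on a board of \<open>card U mod (b + 1)\<close> edges, all of them threats.\<close>

lemma enforcer_pos_threats: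
  assumes mono: "\<And>A A'. P A \<Longrightarrow> A \<subseteq> A' \<Longrightarrow> P A'"
    and "finite U" "R \<subseteq> U" "0 < card U mod (b + 1)" "card U mod (b + 1) \<le> card R"
    and "\<And>a. a \<in> R \<Longrightarrow> P (insert a A)"
  shows "enforcer_pos b P A U"
  using assms(2-)
proof (induction "card U" arbitrary: A U rule: less_induct)
  case less
  have finR: "finite R" using finite_subset[OF less.prems(2,1)] .
  have "U \<noteq> {}" using less.prems(3) by auto
  then show ?case
  proof (rule enforcer_pos.move)
    fix a assume a: "a \<in> U"
    have fin: "finite (U - {a})" using less.prems(1) by simp
    show "\<exists>B. B \<subseteq> U - {a} \<and> card B = min b (card (U - {a})) \<and>
        enforcer_pos b P (insert a A) (U - {a} - B)"
    proof (cases "a \<in> R")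
      case True
      obtain B where B: "B \<subseteq> U - {a}" "card B = min b (card (U - {a}))"
        using obtain_subset_with_card_n[OF min.cobounded2] by metis
      have "enforcer_pos b P (insert a A) (U - {a} - B)"
        using less.prems(1,5) True by (intro enforcer_pos_if_won[OF mono]) auto
      then show ?thesis using B by blast
    next
      case False
      have mono': "P (insert r (insert a A))" if "r \<in> R" for r
        by (rule mono[OF less.prems(5)[OF that]]) blast
      have R: "R \<subseteq> U - {a}" using less.prems(2) False by blast
      let ?N = "U - {a} - R"
      show ?thesis
      proof (cases "b \<le> card ?N")
        case True
        then obtain B where B: "B \<subseteq> ?N" "card B = b" using obtain_subset_with_card_n by metis
        have "card ?N \<le> card (U - {a})" using fin by (intro card_mono) auto
        then have min: "card B = min b (card (U - {a}))" using B(2) True by simp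
        have cardU: "card (U - {a} - B) = card U - (b + 1)"
          by (rule card_after_round[OF less.prems(1) a _ min]) (use B(1) in blast)
        have "card U > 0" using a less.prems(1) card_gt_0_iff by blast
        then have "b + 1 \<le> card U" using B(2) min a less.prems(1) by simp
        then have mod: "card (U - {a} - B) mod (b + 1) = card U mod (b + 1)"
          unfolding cardU by (rule le_mod_geq[symmetric])
        have "enforcer_pos b P (insert a A) (U - {a} - B)"
        proof (rule less.hyps)
          show "card (U - {a} - B) < card U" using cardU \<open>card U > 0\<close> by simp
          show "R \<subseteq> U - {a} - B" using R B(1) by blast
        qed (use less.prems mod mono' in simp_all)
        then show ?thesis using B(1) min by blast
      next
        case False
        \<comment> \<open>Fewer than \<open>b\<close> harmless edges are left. Enforcer takes all of
          them, so that Avoider's next move must be a threat.\<close>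
        let ?m = "min b (card (U - {a}))"
        have sub: "?N \<subseteq> U - {a}" by blast
        have "card ?N \<le> ?m" using False card_mono[OF fin sub] by simp
        moreover have "?m \<le> card (U - {a})" by simp
        ultimately obtain B where B: "?N \<subseteq> B" "B \<subseteq> U - {a}" "card B = ?m"
          using exists_subset_between[OF _ _ sub fin] by metis
        have cardU: "card (U - {a} - B) = card U - (b + 1)"
          by (rule card_after_round[OF less.prems(1) a B(2,3)])
        \<comment> \<open>Otherwise this was the last round. A positive remainder excludes
          \<open>card U = b + 1\<close>, so \<open>card U\<close> is its own remainder and at most
          \<open>card R\<close>, although \<open>R\<close> lies in \<open>U - {a}\<close>.\<close>
        have "U - {a} - B \<noteq> {}"
        proof
          assume "U - {a} - B = {}"
          then have "card U \<le> b + 1" using cardU by (metis card.empty diff_is_0_eq)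
          then have "card U mod (b + 1) = card U"
            using less.prems(3) by (metis mod_self le_neq_implies_less mod_less less_irrefl)
          then have "card U \<le> card R" using less.prems(4) by simp
          also have "\<dots> \<le> card (U - {a})" by (rule card_mono[OF fin R])
          also have "\<dots> < card U" using a less.prems(1) by (intro psubset_card_mono) auto
          finally show False by simp
        qed
        then have "enforcer_pos b P (insert a A) (U - {a} - B)"
          using fin B(1) mono' by (intro enforcer_pos_only_threats[OF mono]) auto
        then show ?thesis using B by blast
      qed
    qed
  qed
qed

lemma contains_copy_mono: "contains_copy W F V E \<Longrightarrow> F \<subseteq> F' \<Longrightarrow> contains_copy W F' V E"
  unfolding contains_copy_def by (elim exE, rule exI) auto

context roles
begin

text \<open>The embedding is the inverse of \<open>role\<close> on \<open>Z\<close>.\<close>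

lemma copy_if_pattern:
  assumes Z: "Z \<subseteq> {..<n}" "inj_on role Z" "role ` Z = V" and pat: "E \<subseteq> pattern A Z"
  shows "contains_copy {..<n} A V E"
  unfolding contains_copy_def
proof (intro exI conjI ballI)
  let ?f = "the_inv_into Z role"
  show "inj_on ?f V" using inj_on_the_inv_into[OF Z(2)] Z(3) by simp
  show "?f ` V \<subseteq> {..<n}" using the_inv_into_onto[OF Z(2)] Z(1,3) by simp
  fix e assume "e \<in> E"
  then obtain g where g: "g \<in> realized Z" "g \<in> A" "e = role ` g"
    using pat unfolding pattern_def by blast
  have "?f ` (role ` g) = g"
    using realizedD[OF g(1)] the_inv_into_f_f[OF Z(2)] by (force simp: image_image)
  then show "?f ` e \<in> A" using g by simp
qed

lemma part_E: "v \<in> V \<Longrightarrow> part E v = V"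
proof -
  assume v: "v \<in> V"
  have "(v, u) \<in> reach E" if "u \<in> V" for u
    using connected v that unfolding connected_graph_def by simp
  then have "V \<subseteq> part E v" unfolding part_def by (simp add: subset_iff)
  then show ?thesis using part_subset[OF E_subset v] by simp
qed

end

section \<open>One phase of Enforcer's strategy\<close>

lemma part_closed:
  assumes closed: "\<And>e. e \<in> S \<Longrightarrow> e \<inter> D \<noteq> {} \<Longrightarrow> e \<subseteq> D" and p: "p \<in> D"
  shows "part S p \<subseteq> D"
proof
  fix q assume "q \<in> part S p"
  then have "(p, q) \<in> reach S" by (simp add: part_def)
  then show "q \<in> D"
  proof (induction rule: rtrancl_induct)
    case (step y z)
    then have "{y, z} \<in> S" by simp
    then show ?case using closed[of "{y, z}"] step.IH by auto
  qed (rule p)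
qed

context roles
begin

definition cls :: "nat set set \<Rightarrow> nat set set \<Rightarrow> 'a set \<Rightarrow> 'a set set \<Rightarrow> nat set set" where
  "cls A CC D P = {Y\<in>CC. role ` Y = D \<and> pattern A Y = P}"

lemma card_incident_le:
  assumes "finite W"
  shows "card {e \<in> complete_edges n. e \<inter> W \<noteq> {}} \<le> card W * n"
proof -
  have "{e \<in> complete_edges n. e \<inter> W \<noteq> {}} \<subseteq> (\<lambda>(w, z). {w, z}) ` (W \<times> {..<n})"
  proof
    fix e assume e: "e \<in> {e \<in> complete_edges n. e \<inter> W \<noteq> {}}"
    then obtain w where w: "w \<in> e" "w \<in> W" by blast
    obtain x y where xy: "e = {x, y}" "x < n" "y < n"
      using e unfolding nsets_def by (auto simp: card_2_iff)
    then have "e = {w, y} \<or> e = {w, x}" using w(1) by auto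
    then show "e \<in> (\<lambda>(w, z). {w, z}) ` (W \<times> {..<n})" using w(2) xy by auto
  qed
  then have "card {e \<in> complete_edges n. e \<inter> W \<noteq> {}} \<le> card ((\<lambda>(w, z). {w, z}) ` (W \<times> {..<n}))"
    by (rule card_mono[rotated]) (use assms in simp)
  also have "\<dots> \<le> card (W \<times> {..<n})" by (rule card_image_le) (use assms in simp)
  finally show ?thesis unfolding card_cartesian_product card_lessThan .
qed

text \<open>A unit is lost only if one of its copies lies in \<open>W\<close>, and then all its
  edges meet \<open>W\<close>. With a bias of at least \<open>card V * n\<close>, one move of
  Avoider thus costs at most \<open>b\<close> such edges.\<close>

lemma units_loss:
  assumes inv: "phase_inv S B A U CC"
    and W: "finite W" "card W \<le> card V" "a \<subseteq> W" "a \<noteq> {}"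
    and part_W: "\<And>X. X \<in> CC \<Longrightarrow> X \<subseteq> W \<or> X \<inter> W = {}"
    and keep: "\<And>X. X \<in> CC \<Longrightarrow> X \<inter> W = {} \<Longrightarrow> X \<in> CC' \<and> realized X \<inter> insert a A = realized X \<inter> A"
  shows "card (\<Union> (units S S1 S2 A U CC)) \<le> card (\<Union> (units S S1 S2 (insert a A) (U - {a}) CC')) + card V * n"
proof -
  note D = phase_invD[OF inv]
  let ?N = "{e \<in> complete_edges n. e \<inter> W \<noteq> {}}"
  let ?u = "\<Union> (units S S1 S2 (insert a A) (U - {a}) CC')"
  have sub: "\<Union> (units S S1 S2 A U CC) \<subseteq> ?u \<union> ?N"
  proof
    fix e assume e: "e \<in> \<Union> (units S S1 S2 A U CC)"
    then obtain u where u: "u \<in> units S S1 S2 A U CC" "e \<in> u" by blast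
    have eU: "e \<in> complete_edges n" using units_subset e D(1) by blast
    obtain X Y where X: "u = cross X Y" "X \<in> CC" "X \<in> S1" "Y \<in> CC" "Y \<in> S2" "X \<noteq> Y"
      "role ` X \<inter> role ` Y = {}" "cross X Y \<subseteq> U" "\<not> advanced S A X" "\<not> advanced S A Y"
      by (rule unitsE[OF u(1)])
    obtain x y where xy: "e = {x, y}" "x \<in> X" "y \<in> Y" using u(2) X(1) crossE by metis
    show "e \<in> ?u \<union> ?N"
    proof (cases "X \<inter> W = {} \<and> Y \<inter> W = {}")
      case True
      have keepX: "X \<in> CC'" "pattern (insert a A) X = pattern A X"
        using keep[OF X(2)] True pattern_cong by metis+
      have keepY: "Y \<in> CC'" "pattern (insert a A) Y = pattern A Y"
        using keep[OF X(4)] True pattern_cong by metis+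
      have "a \<notin> cross X Y"
      proof
        assume "a \<in> cross X Y"
        then obtain x y where "a = {x, y}" "x \<in> X" by (rule crossE)
        then show False using W(3) True by blast
      qed
      then have "cross X Y \<subseteq> U - {a}" using X(8) by blast
      then have "u \<in> units S S1 S2 (insert a A) (U - {a}) CC'"
        unfolding X(1) using X(3,5,6,7,9,10) keepX keepY
        by (intro unitsI) (simp_all add: advanced_def)
      then show ?thesis using u(2) by blast
    next
      case False
      then have "X \<subseteq> W \<or> Y \<subseteq> W" using part_W X(2,4) by blast
      then show ?thesis using xy eU by blast
    qed
  qed
  have "finite (\<Union> (units S S1 S2 (insert a A) (U - {a}) CC'))"
    by (rule finite_subset[OF units_subset])
      (use finite_subset[OF D(1)] in simp)
  then have "card (\<Union> (units S S1 S2 A U CC)) \<le> card (?u \<union> ?N)"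
    by (intro card_mono[OF _ sub]) simp
  also have "\<dots> \<le> card ?u + card ?N" by (rule card_Un_le)
  also have "card ?N \<le> card V * n"
    using card_incident_le[OF W(1)] W(2) by (meson le_trans mult_le_mono1)
  finally show ?thesis by simp
qed

lemma cls_step:
  assumes "\<And>Y. Y \<in> CC' \<Longrightarrow> Y = Z \<or> Y \<in> CC \<and> realized Y \<inter> A' = realized Y \<inter> A"
  shows "cls A' CC' D P \<subseteq> insert Z (cls A CC D P)"
proof
  fix Y assume Y: "Y \<in> cls A' CC' D P"
  then have "Y = Z \<or> Y \<in> CC \<and> realized Y \<inter> A' = realized Y \<inter> A" using assms unfolding cls_def by blast
  then show "Y \<in> insert Z (cls A CC D P)"
    using Y pattern_cong[of Y A' A] unfolding cls_def by auto
qed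

text \<open>By the definition of \<open>junk\<close>, a free edge is junk, inside a copy, or between
  an open pair. Only the copy \<open>Z\<close> that is changed or created can enter a class, so a
  class that was below its quota stays below quota plus 1.\<close>

lemma avoider_step:
  assumes inv: "phase_inv S B A U CC" and a: "a \<in> U" and S: "S \<subseteq> E"
  obtains CC' Z where "phase_inv S B (insert a A) (U - {a}) CC'"
    "\<And>v. available S B A CC v \<le> available S B (insert a A) CC' v"
    "\<And>D P. cls (insert a A) CC' D P \<subseteq> insert Z (cls A CC D P)"
    "a \<in> junk U CC \<and> junk (U - {a}) CC' = junk U CC - {a} \<and>
       progress S (insert a A) CC' = progress S A CC \<and>
       units S S1 S2 A U CC \<subseteq> units S S1 S2 (insert a A) (U - {a}) CC' \<or>
     progress S A CC + 1 \<le> progress S (insert a A) CC' \<and>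
       card (\<Union> (units S S1 S2 A U CC)) \<le> card (\<Union> (units S S1 S2 (insert a A) (U - {a}) CC')) + card V * n"
proof -
  note D = phase_invD[OF inv]
  consider "a \<in> junk U CC" | X where "X \<in> CC" "a \<in> realized X"
    | X Y where "X \<in> CC" "Y \<in> CC" "open_pair U X Y" "a \<in> cross X Y"
    using a unfolding junk_def by blast
  then show thesis
  proof cases
    case 1
    note M = move_junk[OF inv 1]
    have pat: "pattern (insert a A) X = pattern A X" if "X \<in> CC" for X
      by (rule pattern_cong[OF M(2)[OF that]])
    have adv: "advanced S (insert a A) X \<longleftrightarrow> advanced S A X" if "X \<in> CC" for X
      unfolding advanced_def pat[OF that] ..
    show ?thesis
    proof (rule that[OF M(1), of "{}"])
      show "available S B A CC v \<le> available S B (insert a A) CC v" for v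
        unfolding available_def using adv by (intro eq_refl arg_cong[of _ _ card]) blast
      show "cls (insert a A) CC D P \<subseteq> insert {} (cls A CC D P)" for D P
        by (rule cls_step) (use M(2) in blast)
      have "{X. X \<in> CC \<and> advanced S (insert a A) X} = {X. X \<in> CC \<and> advanced S A X}"
        using adv by blast
      then have "progress S (insert a A) CC = progress S A CC"
        unfolding progress_def using M(2) by (intro sum.cong) auto
      moreover have "units S S1 S2 A U CC \<subseteq> units S S1 S2 (insert a A) (U - {a}) CC"
        unfolding units_def using M(3) adv by blast
      ultimately show "a \<in> junk U CC \<and> junk (U - {a}) CC = junk U CC - {a} \<and>
         progress S (insert a A) CC = progress S A CC \<and>
         units S S1 S2 A U CC \<subseteq> units S S1 S2 (insert a A) (U - {a}) CC \<or>
        progress S A CC + 1 \<le> progress S (insert a A) CC \<and>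
         card (\<Union> (units S S1 S2 A U CC)) \<le> card (\<Union> (units S S1 S2 (insert a A) (U - {a}) CC)) + card V * n"
        using 1 M(4) by blast
    qed
  next
    case (2 X)
    note M = move_chord[OF inv 2 a]
    have sep: "Y = X \<or> Y \<inter> X = {}" if "Y \<in> CC" for Y
      using copies_disjoint[OF D(3) that 2(1)] by blast
    show ?thesis
    proof (rule that[OF M(1), of X])
      show "available S B A CC v \<le> available S B (insert a A) CC v" for v by (rule M(4))
      show "cls (insert a A) CC D P \<subseteq> insert X (cls A CC D P)" for D P
        by (rule cls_step) (use M(2) sep in blast)
      have "card (\<Union> (units S S1 S2 A U CC)) \<le> card (\<Union> (units S S1 S2 (insert a A) (U - {a}) CC)) + card V * n"
      proof (rule units_loss[OF inv])
        show "finite X" "card X \<le> card V" using copiesD[OF D(3) 2(1)] by simp_all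
        show "a \<subseteq> X" "a \<noteq> {}" using realizedD[OF 2(2)] by simp_all
      qed (use sep M(2) in blast)+
      with M(3) show "a \<in> junk U CC \<and> junk (U - {a}) CC = junk U CC - {a} \<and>
         progress S (insert a A) CC = progress S A CC \<and>
         units S S1 S2 A U CC \<subseteq> units S S1 S2 (insert a A) (U - {a}) CC \<or>
        progress S A CC + 1 \<le> progress S (insert a A) CC \<and>
         card (\<Union> (units S S1 S2 A U CC)) \<le> card (\<Union> (units S S1 S2 (insert a A) (U - {a}) CC)) + card V * n"
        by blast
    qed
  next
    case (3 X Y)
    note M = move_merge[OF inv 3 S]
    let ?C = "insert (X \<union> Y) (CC - {X, Y})"
    have sep: "W = X \<or> W = Y \<or> W \<inter> (X \<union> Y) = {}" if "W \<in> CC" for W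
      using copies_disjoint[OF D(3) that 3(1)] copies_disjoint[OF D(3) that 3(2)] by blast
    show ?thesis
    proof (rule that[OF M(1), of "X \<union> Y"])
      show "available S B A CC v \<le> available S B (insert a A) ?C v" for v by (rule M(4))
      show "cls (insert a A) ?C D P \<subseteq> insert (X \<union> Y) (cls A CC D P)" for D P
        by (rule cls_step) (use M(2) sep in blast)
      have "card (\<Union> (units S S1 S2 A U CC)) \<le> card (\<Union> (units S S1 S2 (insert a A) (U - {a}) ?C)) + card V * n"
      proof (rule units_loss[OF inv])
        show "finite (X \<union> Y)" using copiesD(5)[OF D(3)] 3(1,2) by simp
        obtain x y where "a = {x, y}" "x \<in> X" "y \<in> Y" using 3(4) by (rule crossE)
        then show "a \<subseteq> X \<union> Y" "a \<noteq> {}" by auto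
      qed (use sep M(2,5) in blast)+
      with M(3) show "a \<in> junk U CC \<and> junk (U - {a}) ?C = junk U CC - {a} \<and>
         progress S (insert a A) ?C = progress S A CC \<and>
         units S S1 S2 A U CC \<subseteq> units S S1 S2 (insert a A) (U - {a}) ?C \<or>
        progress S A CC + 1 \<le> progress S (insert a A) ?C \<and>
         card (\<Union> (units S S1 S2 A U CC)) \<le> card (\<Union> (units S S1 S2 (insert a A) (U - {a}) ?C)) + card V * n"
        by blast
    qed
  qed
qed

text \<open>There are at most \<open>2 ^ (card V + card E)\<close> pairs of a role set and a
  pattern. With the factor \<open>2 ^ card E\<close> of the later \<open>quota\<close>, this is the
  origin of the power of 2 in \<open>\<eta>\<close>.\<close>

lemma count_classes:
  assumes C: "copies A U CC" and F: "F \<subseteq> CC" and M: "0 \<le> (M::real)"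
    and le: "\<And>X. X \<in> F \<Longrightarrow> real (card (cls A CC (role ` X) (pattern A X))) \<le> M"
  shows "real (card F) \<le> 2 ^ (card V + card E) * M"
proof -
  let ?I = "Pow V \<times> Pow E"
  let ?G = "\<lambda>(D, P). {X\<in>F. role ` X = D \<and> pattern A X = P}"
  have finCC: "finite CC" by (rule copies_finite[OF C])
  have finF: "finite F" by (rule finite_subset[OF F finCC])
  have "F \<subseteq> (\<Union>i\<in>?I. ?G i)"
  proof
    fix X assume X: "X \<in> F"
    then have "role ` X \<in> Pow V" using copiesD(6)[OF C] F by blast
    moreover have "pattern A X \<in> Pow E" using pattern_subset unfolding induced_def by blast
    ultimately show "X \<in> (\<Union>i\<in>?I. ?G i)" using X by auto
  qed
  then have "card F \<le> card (\<Union>i\<in>?I. ?G i)"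
    by (rule card_mono[rotated]) (use finF finite_V finite_E in auto)
  also have "\<dots> \<le> (\<Sum>i\<in>?I. card (?G i))"
    by (rule card_UN_le) (use finite_V finite_E in simp)
  finally have "real (card F) \<le> real (\<Sum>i\<in>?I. card (?G i))" by (rule of_nat_mono)
  also have "\<dots> = (\<Sum>i\<in>?I. real (card (?G i)))" by simp
  also have "\<dots> \<le> (\<Sum>i\<in>?I. M)"
  proof (rule sum_mono)
    fix i assume "i \<in> ?I"
    obtain D P where i: "i = (D, P)" by (cases i)
    show "real (card (?G i)) \<le> M"
    proof (cases "?G i = {}")
      case True
      then show ?thesis using M by simp
    next
      case False
      then obtain X where X: "X \<in> F" "role ` X = D" "pattern A X = P" using i by auto
      have "?G i \<subseteq> cls A CC D P" unfolding i cls_def using F by auto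
      then have "card (?G i) \<le> card (cls A CC D P)"
        by (rule card_mono[rotated]) (use finCC in \<open>simp add: cls_def\<close>)
      then show ?thesis using le[OF X(1)] X(2,3) by simp
    qed
  qed
  also have "\<dots> = 2 ^ (card V + card E) * M"
    using finite_V finite_E by (simp add: card_Pow card_cartesian_product power_add)
  finally show ?thesis .
qed

text \<open>The last inequality uses that the sacrificed edges join two parts of least total weight.\<close>

lemma advanced_weight:
  assumes inv: "phase_inv S B A U CC" and S: "S \<subseteq> E" "card S + 2 \<le> card E"
    and X: "X \<in> CC" "advanced S A X" and no: "\<not> contains_copy {..<n} A V E"
  defines "w \<equiv> \<lambda>v. weight (card E) (induced S (part S v))"
  shows "pattern A X \<subset> E"
    and "\<And>v. v \<in> role ` X \<Longrightarrow> w v + 1 \<le> weight (card E) (pattern A X)"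
    and "\<And>p q. (\<And>u v. {u, v} \<in> E - S \<Longrightarrow> part S u \<noteq> part S v \<Longrightarrow> w p + w q \<le> w u + w v) \<Longrightarrow>
       p \<in> V \<Longrightarrow> q \<in> V \<Longrightarrow> part S p \<noteq> part S q \<Longrightarrow> w p + w q + 1 \<le> weight (card E) (pattern A X)"
proof -
  note D = phase_invD[OF inv]
  let ?P = "pattern A X" and ?D = "role ` X"
  have PE: "?P \<subseteq> E" and PD: "\<And>e. e \<in> ?P \<Longrightarrow> e \<subseteq> ?D"
    using pattern_subset[of A X] unfolding induced_def by blast+
  show PE': "?P \<subset> E"
  proof (rule ccontr)
    assume "\<not> ?thesis"
    then have eq: "?P = E" using PE by blast
    obtain p where p: "p \<in> ?D" using copiesD(2)[OF D(3) X(1)] by blast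
    \<comment> \<open>By connectedness a pattern equal to \<open>E\<close> covers all roles and
      would be a finished copy.\<close>
    have "part E p \<subseteq> ?D"
      by (rule part_closed[OF _ p]) (use PD eq in blast)
    moreover have "p \<in> V" using p copiesD(6)[OF D(3) X(1)] by blast
    ultimately have "?D = V" using part_E copiesD(6)[OF D(3) X(1)] by blast
    then show False
      using copy_if_pattern[OF copiesD(1,3)[OF D(3) X(1)]] eq no by blast
  qed
  have finP: "finite ?P" by (rule finite_subset[OF PE finite_E])
  have ind: "induced S (part S v) \<subseteq> induced S ?D" if "v \<in> ?D" for v
    using D(5)[OF X(1) that] unfolding induced_def by blast
  have psub: "induced S ?D \<subset> ?P" using D(6)[OF X(1)] X(2) unfolding advanced_def by blast
  show "w v + 1 \<le> weight (card E) ?P" if "v \<in> ?D" for v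
    unfolding w_def using ind[OF that] psub by (intro weight_strict_mono[OF finP]) blast
  fix p q
  assume min: "\<And>u v. {u, v} \<in> E - S \<Longrightarrow> part S u \<noteq> part S v \<Longrightarrow> w p + w q \<le> w u + w v"
    and pq: "p \<in> V" "q \<in> V" "part S p \<noteq> part S q"
  obtain e where e: "e \<in> ?P" "e \<notin> induced S ?D" using psub by blast
  have eS: "e \<notin> S" using e PD unfolding induced_def by blast
  obtain u v where uv: "e = {u, v}" "u \<noteq> v"
    using e(1) PE E_subset unfolding nsets_def by (auto simp: card_2_iff)
  have uD: "u \<in> ?D" "v \<in> ?D" using PD[OF e(1)] uv(1) by auto
  have one: "at_most_one_cycle ?P"
    using one_cycle is_cycle_mono[OF _ PE] unfolding at_most_one_cycle_def by blast
  have S_ne: "f \<noteq> {}" if "f \<in> S" for f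
    using that S(1) E_subset unfolding nsets_def by force
  have disj: "induced S (part S u') \<inter> induced S (part S v') = {}" if "part S u' \<noteq> part S v'" for u' v'
    using part_disjoint[OF that] S_ne unfolding induced_def by blast
  show "w p + w q + 1 \<le> weight (card E) ?P"
  proof (cases "part S u = part S v")
    case False
    \<comment> \<open>The extra edge links two parts inside the copy, so their weights add up, and
      minimality compares them with those of \<open>p\<close> and \<open>q\<close>.\<close>
    have "w u + w v + 1 \<le> weight (card E) ?P"
      unfolding w_def
    proof (rule weight_superadditive[OF one finP])
      show "insert e (induced S (part S u) \<union> induced S (part S v)) \<subseteq> ?P"
        using e(1) ind[OF uD(1)] ind[OF uD(2)] psub by blast
      show "e \<notin> induced S (part S u) \<union> induced S (part S v)"
        using eS unfolding induced_def by blast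
    qed (rule disj[OF False])
    moreover have "w p + w q \<le> w u + w v" using min[of u v] e(1) PE eS uv(1) False by blast
    ultimately show ?thesis by simp
  next
    case True
    then have "v \<in> part S u" by simp
    then have reach: "(u, v) \<in> reach S" unfolding part_def by simp
    have new: "{u, v} \<in> E - S" using e(1) PE eS uv(1) by blast
    have "insert {u, v} (induced S (part S u)) \<subseteq> ?P" using e(1) uv(1) ind[OF uD(1)] psub by blast
    note chord = chord_weight[OF one_cycle finite_E S(1) new uv(2) reach this PE]
    \<comment> \<open>The extra edge closes the cycle. Then \<open>S\<close> is acyclic and two
      disjoint parts weigh at most \<open>card S\<close> together, whereas the pattern weighs more
      than \<open>card E\<close>.\<close>
    have "\<not> has_cycle (induced S (part S x))" for x
      using chord(2) has_cycle_mono[of "induced S (part S x)" S] unfolding induced_def by blast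
    then have w: "w x = card (induced S (part S x))" for x unfolding w_def weight_def by simp
    have finS: "finite S" by (rule finite_subset[OF S(1) finite_E])
    have "w p + w q = card (induced S (part S p) \<union> induced S (part S q))"
      unfolding w using finS disj[OF pq(3)] by (intro card_Un_disjoint[symmetric]) (simp_all add: induced_def)
    also have "\<dots> \<le> card S" by (rule card_mono[OF finS]) (auto simp: induced_def)
    finally show ?thesis using S(2) chord(1) by simp
  qed
qed

end

section \<open>Enforcer's strategy\<close>

text \<open>A pattern of weight \<open>w\<close> is to occur about \<open>\<mu> * \<eta> ^ w\<close>
  times, and \<open>feasible\<close> keeps this number at least 4 for proper subgraphs. Rounding the
  two blocks turns the 80 into 20: they span at least 20 times the product of \<open>b\<close>,
  \<open>card E\<close> and the bound on advanced copies, while a phase consumes 5 times that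
  product and \<open>5 * b\<close>. The second alternative of \<open>threats\<close> serves the
  unicyclic case, where a single class may have to supply \<open>\<rho>\<close> threats and units
  may have two edges.\<close>

locale enforcer_game = roles V E n role
  for V :: "'a set" and E :: "'a set set" and n :: nat and role :: "nat \<Rightarrow> 'a" +
  fixes b \<rho> :: nat and \<mu> \<eta> :: real
  assumes two_edges: "2 \<le> card E"
    and bias: "card V * n \<le> b" "1 \<le> b"
    and mu_pos: "0 < \<mu>"
    and eta_def: "\<eta> = \<mu> / (80 * real b * real (card E) * 2 ^ (card V + 2 * card E))"
    and feasible: "\<And>P. P \<subset> E \<Longrightarrow> 4 \<le> \<mu> * \<eta> ^ weight (card E) P"
    and rho: "1 \<le> \<rho>" "card (complete_edges n) mod (b + 1) = \<rho>"
    and threats: "\<not> has_cycle E \<and> real \<rho> \<le> \<mu> \<or>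
      even b \<and> (\<forall>P. P \<subset> E \<longrightarrow> real \<rho> \<le> \<mu> * \<eta> ^ weight (card E) P)"
    and classes: "\<And>v. v \<in> V \<Longrightarrow> 2 ^ card E * \<mu> \<le> real (card {x \<in> {..<n}. role x = v})"
begin

abbreviation wins :: "nat set set \<Rightarrow> nat set set \<Rightarrow> bool" where
  "wins \<equiv> enforcer_pos b (\<lambda>A. contains_copy {..<n} A V E)"

definition part_weight :: "'a set set \<Rightarrow> 'a \<Rightarrow> nat" where
  "part_weight S v = weight (card E) (induced S (part S v))"

text \<open>The power of 2 at least halves whenever \<open>S\<close> grows. This pays for a phase: a
  quarter of the demand may be set aside in a block and a quarter may advance.\<close>

definition required :: "'a set set \<Rightarrow> 'a \<Rightarrow> real" where
  "required S v = 2 ^ (card E - card S) * \<mu> * \<eta> ^ part_weight S v"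

text \<open>The power of 2 is the largest one in \<open>required\<close>, so a pattern that reaches
  its quota meets the demand of the next state at once.\<close>

definition quota :: "'a set set \<Rightarrow> real" where
  "quota P = 2 ^ card E * \<mu> * \<eta> ^ weight (card E) P"

text \<open>The situation between two phases: no copy is advanced and there are no blocks, so all
  role-disjoint pairs can be merged.\<close>

definition state :: "'a set set \<Rightarrow> nat set set \<Rightarrow> nat set set \<Rightarrow> bool" where
  "state S A U \<longleftrightarrow> U \<subseteq> complete_edges n \<and> A \<inter> U = {} \<and> card U mod (b + 1) = \<rho> \<and>
     (\<exists>CC. copies A U CC \<and>
       (\<forall>X\<in>CC. (\<exists>v\<in>V. role ` X = part S v) \<and> \<not> advanced S A X) \<and>
       (\<forall>X\<in>CC. \<forall>Y\<in>CC. X \<noteq> Y \<and> role ` X \<inter> role ` Y = {} \<longrightarrow> cross X Y \<subseteq> U) \<and>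
       (\<forall>v\<in>V. required S v \<le> real (card {X\<in>CC. role ` X = part S v})))"

lemma E_doubleton: "e \<in> E \<Longrightarrow> \<exists>p q. e = {p, q}"
proof -
  assume "e \<in> E"
  then have "card e = 2" using E_subset unfolding nsets_def by blast
  then show ?thesis by (auto simp: card_2_iff)
qed

lemma copies_subset:
  assumes C: "copies A U CC" and sub: "C \<subseteq> CC"
  shows "copies A U C"
  unfolding copies_def
proof (intro conjI ballI)
  have "disjoint CC" using C unfolding copies_def by simp
  then show "disjoint C" using sub by (rule pairwise_subset)
  fix X assume "X \<in> C"
  then have X: "X \<in> CC" using sub by blast
  show "X \<subseteq> {..<n}" "X \<noteq> {}" "inj_on role X" "realized X \<subseteq> A \<union> U"
    using copiesD[OF C X] by simp_all
  show "connected_by (pattern A X) (role ` X)" by (rule copiesD_connected[OF C X])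
qed

lemma card_E_pos: "0 < real (card E)"
  using two_edges by simp

lemma mu_le: "\<mu> \<le> real b"
proof -
  obtain v where v: "v \<in> V" using V_nonempty by blast
  have "\<mu> \<le> 2 ^ card E * \<mu>" using mu_pos by (simp add: mult_le_cancel_right1)
  also have "\<dots> \<le> real (card {x \<in> {..<n}. role x = v})" by (rule classes[OF v])
  also have "\<dots> \<le> real (card {..<n})" by (intro of_nat_mono card_mono) auto
  also have "\<dots> \<le> real b"
  proof -
    have "1 * n \<le> card V * n"
      using finite_V V_nonempty by (intro mult_le_mono1) (simp add: Suc_le_eq card_gt_0_iff)
    from order_trans[OF this bias(1)] have "n \<le> b" by (simp only: mult_1)
    then show ?thesis by simp
  qed
  finally show ?thesis .
qed

lemma eta_pos: "0 < \<eta>"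
  unfolding eta_def using mu_pos bias card_E_pos by simp

lemma eta_eq: "80 * real b * real (card E) * 2 ^ (card V + 2 * card E) * \<eta> = \<mu>"
  unfolding eta_def using bias card_E_pos by simp

text \<open>It follows from \<open>\<mu> \<le> b\<close>, and makes advanced copies rare compared
  with the copies of any part they contain.\<close>

lemma eta_le: "80 * 2 ^ (card V + 2 * card E) * \<eta> \<le> 1"
proof -
  have "(80 * 2 ^ (card V + 2 * card E) * \<eta>) * real b \<le>
      (80 * 2 ^ (card V + 2 * card E) * \<eta>) * (real b * real (card E))"
    using eta_pos bias two_edges by (intro mult_left_mono) auto
  also have "\<dots> = \<mu>" using eta_eq by (simp add: mult_ac)
  also have "\<dots> \<le> 1 * real b" using mu_le by simp
  finally show ?thesis using bias by (simp add: mult_le_cancel_right)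
qed

lemma eta_le_1: "\<eta> \<le> 1"
proof -
  have "1 * \<eta> \<le> 80 * 2 ^ (card V + 2 * card E) * \<eta>"
    using eta_pos by (intro mult_right_mono) (simp_all add: order_trans[OF _ mult_mono[of 1 80 1]])
  then show ?thesis using eta_le by linarith
qed

lemma quota_pos: "0 < quota P"
  unfolding quota_def using mu_pos eta_pos by simp

lemma wins_if_copy:
  assumes "contains_copy {..<n} A V E" "U \<subseteq> complete_edges n"
  shows "wins A U"
proof (rule enforcer_pos_if_won)
  show "finite U" using finite_subset[OF assms(2)] by simp
qed (use assms(1) contains_copy_mono in blast)+

text \<open>When a new connected pattern has become frequent enough, its copies, together with the
  untouched copies of the disjoint parts, realize a larger edge set.\<close>

lemma state_if_frequent:
  assumes inv: "phase_inv S B A U CC" and S: "S \<subseteq> E" "card S + 2 \<le> card E"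
    and rem: "card U mod (b + 1) = \<rho>" and no: "\<not> contains_copy {..<n} A V E"
    and X: "X \<in> CC" "advanced S A X"
    and frequent: "quota (pattern A X) \<le> real (card (cls A CC (role ` X) (pattern A X)))"
    and bound: "\<And>D P. P \<noteq> induced S D \<Longrightarrow> real (card (cls A CC D P)) < quota P + 1"
    and av: "\<And>v. v \<in> V \<Longrightarrow> 3 / 4 * required S v \<le> real (available S B A CC v)"
  shows "state (S \<union> pattern A X) A U" and "S \<subset> S \<union> pattern A X"
proof -
  note D = phase_invD[OF inv]
  note AW = advanced_weight[OF inv S _ _ no]
  let ?P = "pattern A X" and ?D = "role ` X"
  let ?S = "S \<union> ?P"
  have finCC: "finite CC" by (rule copies_finite[OF D(3)])
  have PE: "?P \<subset> E" by (rule AW(1)[OF X])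
  have PD: "e \<subseteq> ?D" if "e \<in> ?P" for e
    using that pattern_subset[of A X] unfolding induced_def by blast
  have "induced S ?D \<subseteq> ?P" by (rule D(6)[OF X(1)])
  then have PS: "\<not> ?P \<subseteq> S" using X(2) PD unfolding advanced_def induced_def by blast
  then show sub: "S \<subset> ?S" by blast
  have finS: "finite ?S" using S(1) PE finite_subset[OF _ finite_E, of ?S] by blast
  have card: "card S + 1 \<le> card ?S" using psubset_card_mono[OF finS sub] by simp
  have E_nonempty: "e \<noteq> {}" if "e \<in> E" for e using that E_subset unfolding nsets_def by force
  have S_closed: "e \<subseteq> ?D" if e: "e \<in> S" "e \<inter> ?D \<noteq> {}" for e
  proof -
    obtain p' q' where p'q': "e = {p', q'}" using E_doubleton e(1) S(1) by blast
    then obtain p q where pq: "e = {p, q}" "p \<in> ?D"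
      using e(2) by (cases "p' \<in> ?D") (auto simp: insert_commute)
    then have "q \<in> part S p" using e(1) reach_edge unfolding part_def by simp
    then show ?thesis using D(5)[OF X(1) pq(2)] pq by blast
  qed
  have part_in: "part ?S v = ?D" if v: "v \<in> ?D" for v
  proof
    show "part ?S v \<subseteq> ?D" by (rule part_closed[OF _ v]) (use S_closed PD in blast)
    show "?D \<subseteq> part ?S v"
    proof
      fix q assume q: "q \<in> ?D"
      have "connected_by ?S ?D"
        by (rule connected_by_mono[OF copiesD_connected[OF D(3) X(1)]]) simp
      then have "(v, q) \<in> reach ?S" using v q by (simp only: connected_by_def)
      then show "q \<in> part ?S v" by (simp add: part_def)
    qed
  qed
  have part_disj: "part S v \<inter> ?D = {}" if v: "v \<notin> ?D" for v
  proof (rule ccontr)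
    assume "part S v \<inter> ?D \<noteq> {}"
    then obtain q where q: "q \<in> part S v" "q \<in> ?D" by blast
    then have "part S v \<subseteq> ?D" using part_eq[OF q(1)] D(5)[OF X(1) q(2)] by simp
    then show False using v self_in_part[of v S] by blast
  qed
  have part_out: "part ?S v = part S v" if v: "v \<notin> ?D" for v
  proof
    show "part ?S v \<subseteq> part S v"
    proof (rule part_closed)
      fix e assume e: "e \<in> ?S" "e \<inter> part S v \<noteq> {}"
      have "e \<notin> ?P" using e(2) PD part_disj[OF v] by blast
      then have eS: "e \<in> S" using e(1) by blast
      then obtain p q where pq: "e = {p, q}" using E_doubleton S(1) by blast
      have "p \<in> part S q" "q \<in> part S p"
        using eS reach_edge[of p q S] reach_edge[of q p S] unfolding part_def pq by (simp_all add: insert_commute)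
      then show "e \<subseteq> part S v"
        using e(2) part_eq[of p S v] part_eq[of q S v] unfolding pq by blast
    qed simp
    show "part S v \<subseteq> part ?S v" unfolding part_def using reach_mono[of S ?S] by blast
  qed
  have ind_D: "induced ?S ?D = ?P" using D(6)[OF X(1)] PD unfolding induced_def by blast
  have ind_out: "induced ?S T = induced S T" if T: "T \<inter> ?D = {}" for T
  proof -
    have "e \<notin> ?P" if "e \<subseteq> T" for e
    proof
      assume e: "e \<in> ?P"
      then have "e \<subseteq> T \<inter> ?D" using PD[OF e] that by blast
      then have "e = {}" using T by blast
      moreover have "e \<in> E" using e PE by blast
      ultimately show False using E_nonempty by blast
    qed
    then show ?thesis unfolding induced_def by blast
  qed
  \<comment> \<open>Kept are the copies with the frequent pattern and the plain copies that meet
    neither its roles nor the blocks; all others are abandoned.\<close>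
  define C1 where "C1 = cls A CC ?D ?P"
  define C2 where "C2 = {Y\<in>CC. \<not> advanced S A Y \<and> role ` Y \<inter> ?D = {} \<and> Y \<inter> B = {}}"
  have base: "role ` Y = part S v" if Y: "Y \<in> CC" "\<not> advanced S A Y" "v \<in> role ` Y" for Y v
  proof
    show "part S v \<subseteq> role ` Y" by (rule D(5)[OF Y(1,3)])
    show "role ` Y \<subseteq> part S v"
    proof
      fix q assume q: "q \<in> role ` Y"
      have "pattern A Y \<subseteq> S" using Y(2) unfolding advanced_def induced_def by blast
      then have "connected_by S (role ` Y)"
        by (rule connected_by_mono[OF copiesD_connected[OF D(3) Y(1)]])
      then have "(v, q) \<in> reach S" using Y(3) q by (simp only: connected_by_def)
      then show "q \<in> part S v" by (simp add: part_def)
    qed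
  qed
  let ?C = "C1 \<union> C2"
  have C_sub: "?C \<subseteq> CC" unfolding C1_def C2_def cls_def by blast
  have h1: "copies A U ?C"
    by (rule copies_subset[OF D(3) C_sub])
  have h2: "(\<exists>v\<in>V. role ` Y = part ?S v) \<and> \<not> advanced ?S A Y" if Y: "Y \<in> ?C" for Y
  proof -
    have YC: "Y \<in> CC" using Y C_sub by blast
    obtain v where v: "v \<in> role ` Y" using copiesD(2)[OF D(3) YC] by blast
    have vV: "v \<in> V" using v copiesD(6)[OF D(3) YC] by blast
    show ?thesis
    proof (cases "Y \<in> C1")
      case True
      then have eq: "role ` Y = ?D" "pattern A Y = ?P" unfolding C1_def cls_def by blast+
      then have "role ` Y = part ?S v" using part_in v by simp
      moreover have "\<not> advanced ?S A Y" unfolding advanced_def eq ind_D by simp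
      ultimately show ?thesis using vV by blast
    next
      case False
      then have Y2: "\<not> advanced S A Y" "role ` Y \<inter> ?D = {}" using Y unfolding C2_def by blast+
      have "role ` Y = part ?S v" using base[OF YC Y2(1) v] part_out[of v] v Y2(2) by blast
      moreover have "\<not> advanced ?S A Y"
        using Y2 ind_out[OF Y2(2)] unfolding advanced_def by simp
      ultimately show ?thesis using vV by blast
    qed
  qed
  have h3: "cross Y Z \<subseteq> U" if YZ: "Y \<in> ?C" "Z \<in> ?C" "Y \<noteq> Z" "role ` Y \<inter> role ` Z = {}" for Y Z
  proof -
    have C: "Y \<in> CC" "Z \<in> CC" using YZ(1,2) C_sub by blast+
    \<comment> \<open>Two copies of the frequent pattern have equal roles, so in a role-disjoint
      pair one copy avoids the blocks.\<close>
    have "Y \<in> C2 \<or> Z \<in> C2"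
    proof (rule ccontr)
      assume "\<not> ?thesis"
      then have "Y \<in> C1" "Z \<in> C1" using YZ(1,2) by simp_all
      then have "role ` Y = role ` Z" unfolding C1_def cls_def by simp
      then show False using YZ(4) copiesD(2)[OF D(3) C(1)] by simp
    qed
    then show ?thesis
    proof
      assume "Y \<in> C2"
      then have "Y \<inter> B = {}" unfolding C2_def by blast
      then show ?thesis by (rule D(4)[OF C YZ(3,4)])
    next
      assume "Z \<in> C2"
      then have "Z \<inter> B = {}" unfolding C2_def by blast
      then have "cross Z Y \<subseteq> U" using D(4)[OF C(2,1)] YZ(3,4) by blast
      then show ?thesis by (simp only: cross_sym)
    qed
  qed
  have h4: "required ?S v \<le> real (card {Y\<in>?C. role ` Y = part ?S v})" if v: "v \<in> V" for v
  proof (cases "v \<in> ?D")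
    case True
    have "required ?S v \<le> quota ?P"
      unfolding required_def quota_def part_weight_def part_in[OF True] ind_D
      using mu_pos eta_pos by (intro mult_right_mono power_increasing) auto
    also note frequent
    also have "card (cls A CC ?D ?P) \<le> card {Y\<in>?C. role ` Y = part ?S v}"
    proof (rule card_mono)
      show "finite {Y\<in>?C. role ` Y = part ?S v}" using finite_subset[OF C_sub finCC] by simp
      show "cls A CC ?D ?P \<subseteq> {Y\<in>?C. role ` Y = part ?S v}"
        unfolding part_in[OF True] C1_def cls_def by blast
    qed
    finally show ?thesis by simp
  next
    case False
    let ?w = "part_weight S v"
    let ?F = "{Y\<in>CC. v \<in> role ` Y \<and> advanced S A Y}"
    let ?M = "2 * 2 ^ card E * \<mu> * \<eta> ^ (?w + 1)"
    have F: "real (card ?F) \<le> 2 ^ (card V + card E) * ?M"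
    proof (rule count_classes[OF D(3)])
      show "0 \<le> ?M" using mu_pos eta_pos by simp
      fix Y assume "Y \<in> ?F"
      then have Y: "Y \<in> CC" "v \<in> role ` Y" "advanced S A Y" by blast+
      let ?Q = "pattern A Y"
      have "4 \<le> \<mu> * \<eta> ^ weight (card E) ?Q" by (rule feasible[OF AW(1)[OF Y(1,3)]])
      also have "\<dots> = 1 * (\<mu> * \<eta> ^ weight (card E) ?Q)" by simp
      also have "\<dots> \<le> 2 ^ card E * (\<mu> * \<eta> ^ weight (card E) ?Q)"
        using mu_pos eta_pos by (intro mult_right_mono) auto
      \<comment> \<open>A class is smaller than quota plus 1, hence at most twice the quota.\<close>
      finally have q: "1 \<le> quota ?Q" unfolding quota_def by (simp add: mult.assoc)
      have "real (card (cls A CC (role ` Y) ?Q)) \<le> 2 * quota ?Q"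
        using bound[of ?Q "role ` Y"] Y(3) q unfolding advanced_def by fastforce
      also have "\<dots> \<le> ?M"
      proof -
        have "\<eta> ^ weight (card E) ?Q \<le> \<eta> ^ (?w + 1)"
          using AW(2)[OF Y(1,3,2)] eta_pos eta_le_1 unfolding part_weight_def
          by (intro power_decreasing) auto
        then show ?thesis unfolding quota_def using mu_pos by (simp add: mult_left_mono)
      qed
      finally show "real (card (cls A CC (role ` Y) ?Q)) \<le> ?M" .
    qed blast
    have "2 ^ (card V + card E) * ?M = (2 * 2 ^ (card V + 2 * card E) * \<eta>) * (\<mu> * \<eta> ^ ?w)"
    proof -
      have "card V + 2 * card E = (card V + card E) + card E" by simp
      then have "(2::real) ^ (card V + 2 * card E) = 2 ^ (card V + card E) * 2 ^ card E"
        by (simp only: power_add)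
      then show ?thesis by (simp add: mult_ac)
    qed
    also have "\<dots> \<le> 1 * (\<mu> * \<eta> ^ ?w)"
      using eta_le eta_pos mu_pos by (intro mult_right_mono) auto
    also have "\<dots> \<le> 1 / 4 * required S v"
    proof -
      \<comment> \<open>Two edges are missing, so \<open>required\<close> contains a factor 4, and
        the advanced copies use up at most a quarter of it.\<close>
      have "(2::real) ^ 2 \<le> 2 ^ (card E - card S)" using S(2) by (intro power_increasing) auto
      then have "4 * (\<mu> * \<eta> ^ ?w) \<le> 2 ^ (card E - card S) * (\<mu> * \<eta> ^ ?w)"
        using mu_pos eta_pos by (intro mult_right_mono) auto
      then show ?thesis unfolding required_def by (simp add: mult.assoc)
    qed
    finally have F': "real (card ?F) \<le> 1 / 4 * required S v" using F by linarith
    have "available S B A CC v \<le> card {Y\<in>?C. role ` Y = part ?S v} + card ?F"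
    proof -
      have "{Y \<in> CC. v \<in> role ` Y \<and> (advanced S A Y \<or> Y \<inter> B = {})} \<subseteq>
          {Y\<in>?C. role ` Y = part ?S v} \<union> ?F"
      proof
        fix Y assume "Y \<in> {Y \<in> CC. v \<in> role ` Y \<and> (advanced S A Y \<or> Y \<inter> B = {})}"
        then have Y: "Y \<in> CC" "v \<in> role ` Y" "advanced S A Y \<or> Y \<inter> B = {}" by blast+
        show "Y \<in> {Y\<in>?C. role ` Y = part ?S v} \<union> ?F"
        proof (cases "advanced S A Y")
          case False
          have "role ` Y = part S v" by (rule base[OF Y(1) False Y(2)])
          then have "role ` Y = part ?S v \<and> Y \<in> C2"
            using part_out[OF \<open>v \<notin> ?D\<close>] part_disj[OF \<open>v \<notin> ?D\<close>] False Y unfolding C2_def by simp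
          then show ?thesis by blast
        qed (use Y in blast)
      qed
      then have "available S B A CC v \<le> card ({Y\<in>?C. role ` Y = part ?S v} \<union> ?F)"
        unfolding available_def
        by (rule card_mono[rotated]) (use finCC finite_subset[OF C_sub finCC] in simp)
      also have "\<dots> \<le> card {Y\<in>?C. role ` Y = part ?S v} + card ?F" by (rule card_Un_le)
      finally show ?thesis .
    qed
    \<comment> \<open>Three quarters were available and at most one quarter advanced. The remaining
      half is enough for an unchanged part, as \<open>S\<close> has grown.\<close>
    then have half: "1 / 2 * required S v \<le> real (card {Y\<in>?C. role ` Y = part ?S v})"
      using F' av[OF v] by linarith
    have "required ?S v \<le> 1 / 2 * required S v"
    proof -
      have w: "part_weight ?S v = ?w"
        unfolding part_weight_def part_out[OF False] ind_out[OF part_disj[OF False]] ..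
      have "card E - card S = Suc (card E - card S - 1)" using S(2) by simp
      then have eq: "(2::real) ^ (card E - card S) = 2 * 2 ^ (card E - card S - 1)"
        by (metis power_Suc)
      have "(2::real) ^ (card E - card ?S) \<le> 2 ^ (card E - card S - 1)"
        using card by (intro power_increasing) auto
      then have "2 ^ (card E - card ?S) * (\<mu> * \<eta> ^ ?w) \<le> 2 ^ (card E - card S - 1) * (\<mu> * \<eta> ^ ?w)"
        using mu_pos eta_pos by (intro mult_right_mono) auto
      then show ?thesis unfolding required_def w eq by (simp add: mult.assoc)
    qed
    then show ?thesis using half by linarith
  qed
  show "state ?S A U"
    unfolding state_def
  proof (intro conjI exI[of _ ?C] ballI impI)
    fix Y Z assume "Y \<in> ?C" "Z \<in> ?C" "Y \<noteq> Z \<and> role ` Y \<inter> role ` Z = {}"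
    then show "cross Y Z \<subseteq> U" using h3[of Y Z] by simp
  next
    fix Y assume "Y \<in> ?C"
    from h2[OF this] show "\<exists>v\<in>V. role ` Y = part ?S v" "\<not> advanced ?S A Y" by (rule conjunct1, rule conjunct2)
  qed (use D(1,2) rem h1 h4 in simp_all)
qed


text \<open>A second linking edge closes a cycle of the target, which excludes the acyclic
  alternative of \<open>threats\<close> and so makes \<open>b\<close> even. A third one would be a
  second chord.\<close>

lemma card_links:
  assumes S: "S \<subseteq> E" and e: "{p, q} \<in> E" and ne: "part S p \<noteq> part S q"
  shows "card (links (part S p) (part S q)) = 1 \<or> card (links (part S p) (part S q)) = 2 \<and> even b"
proof -
  let ?L = "links (part S p) (part S q)"
  have pq: "{p, q} \<in> ?L" 
  proof -
    have "p \<in> part S p" "q \<in> part S q" by simp_all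
    then have "\<exists>x\<in>part S p. \<exists>y\<in>part S q. {p, q} = {x, y}" by blast
    then show ?thesis unfolding links_def using e by simp
  qed
  show ?thesis
  proof (cases "?L = {{p, q}}")
    case True
    then show ?thesis by simp
  next
    case False
    then obtain f where f: "f \<in> ?L" "f \<noteq> {p, q}" using pq by blast
    then obtain p2 q2 where f': "f = {p2, q2}" "p2 \<in> part S p" "q2 \<in> part S q" "{p2, q2} \<in> E"
      unfolding links_def by blast
    have "g = f" if g: "g \<in> ?L" "g \<noteq> {p, q}" for g
    proof -
      obtain p3 q3 where g': "g = {p3, q3}" "p3 \<in> part S p" "q3 \<in> part S q" "{p3, q3} \<in> E"
        using g(1) unfolding links_def by blast
      have "{p2, q2} = {p3, q3}"
        by (rule at_most_two_linking_edges(2)[OF one_cycle S E_subset ne e self_in_part self_in_part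
              f'(4,2,3) _ g'(4,2,3)]) (use f(2) f'(1) g(2) g'(1) in simp_all)
      then show ?thesis using f'(1) g'(1) by simp
    qed
    then have "?L = {{p, q}, f}" using pq f by blast
    then have "card ?L = 2" using f(2) by simp
    moreover have "has_cycle E"
      by (rule at_most_two_linking_edges(1)[OF one_cycle S E_subset ne e self_in_part self_in_part
            f'(4,2,3) _ f'(4,2,3)]) (use f(2) f'(1) in simp_all)
    ultimately show ?thesis using threats by blast
  qed
qed

text \<open>Enforcer takes \<open>b\<close> junk edges if there are that many; otherwise all junk,
  filled up by whole units as far as possible. Then at most one edge of a broken unit remains as
  junk.\<close>

lemma enforcer_reply_exists:
  assumes inv: "phase_inv S (\<Union>S1 \<union> \<Union>S2) A U CC"
    and size: "\<And>u. u \<in> units S S1 S2 A U CC \<Longrightarrow> card u = c" and c: "c = 1 \<or> c = 2"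
    and many: "b \<le> card (\<Union> (units S S1 S2 A U CC))"
  obtains R where "R \<subseteq> U" "card R = b" "phase_inv S (\<Union>S1 \<union> \<Union>S2) A (U - R) CC"
    "b \<le> card (junk U CC) \<and> card (junk (U - R) CC) + b \<le> card (junk U CC) \<and>
       card (\<Union> (units S S1 S2 A U CC)) \<le> card (\<Union> (units S S1 S2 A (U - R) CC)) \<or>
     card (junk U CC) < b \<and>
       card (junk (U - R) CC) \<le> (if c = 2 \<and> odd (b - card (junk U CC)) then 1 else 0) \<and>
       card (\<Union> (units S S1 S2 A U CC)) + card (junk U CC) \<le> card (\<Union> (units S S1 S2 A (U - R) CC)) + b +
         (if c = 2 \<and> odd (b - card (junk U CC)) then 1 else 0)"
proof -
  note D = phase_invD[OF inv]
  let ?UU = "units S S1 S2 A U CC" and ?J = "junk U CC"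
  have finU: "finite U" using finite_subset[OF D(1)] by simp
  have finV: "finite (\<Union> (units S S1 S2 A U' CC))" if "finite U'" for U'
    by (rule finite_subset[OF units_subset that])
  have JU: "?J \<subseteq> U" unfolding junk_def by blast
  have finJ: "finite ?J" by (rule finite_subset[OF JU finU])
  show thesis
  proof (cases "b \<le> card ?J")
    case True
    then obtain R where R: "R \<subseteq> ?J" "card R = b" using obtain_subset_with_card_n by metis
    note reply = enforcer_reply[OF inv R(1), of "{}", simplified]
    have "card (junk (U - R) CC) \<le> card (?J - R)"
      using reply(3) finJ by (intro card_mono) auto
    also have "\<dots> = card ?J - b" using R finJ finite_subset[OF R(1) finJ] by (simp add: card_Diff_subset)
    finally have "card (junk (U - R) CC) + b \<le> card ?J" using True by simp
    moreover have "card (\<Union>?UU) \<le> card (\<Union> (units S S1 S2 A (U - R) CC))"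
      using reply(2) finV[of "U - R"] finU by (intro card_mono Union_mono) auto
    ultimately show ?thesis using that[of R] R JU reply(1) True by blast
  next
    case False
    let ?m = "b - card ?J"
    let ?l = "if c = 2 \<and> odd ?m then 1 else 0 :: nat"
    have unit: "finite u \<and> card u = c" if "u \<in> ?UU" for u
    proof -
      have "u \<subseteq> U" using units_subset that by blast
      then show ?thesis using finite_subset[OF _ finU] size[OF that] by blast
    qed
    have m: "?m \<le> card (\<Union>?UU)" using many by simp
    obtain T where T: "T \<subseteq> \<Union>?UU" "card T = ?m"
      and left: "card {e \<in> \<Union>?UU - T. \<exists>u\<in>?UU. e \<in> u \<and> u \<inter> T \<noteq> {}} \<le> ?l"
      by (rule select_units[OF units_finite[OF D(3)] units_disjoint[OF D(3)] unit c m])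
    let ?R = "?J \<union> T" and ?left = "{e \<in> \<Union>?UU - T. \<exists>u\<in>?UU. e \<in> u \<and> u \<inter> T \<noteq> {}}"
    note reply = enforcer_reply[OF inv subset_refl T(1)]
    have finT: "finite T" by (rule finite_subset[OF T(1) finV[OF finU]])
    have finL: "finite ?left" by (rule finite_subset[OF _ finV[OF finU]]) blast
    have disj: "?J \<inter> T = {}"
    proof (rule ccontr)
      assume "?J \<inter> T \<noteq> {}"
      then obtain e u where e: "e \<in> ?J" "u \<in> ?UU" "e \<in> u" using T(1) by blast
      obtain X Y where X: "u = cross X Y" "X \<in> CC" "Y \<in> CC" "X \<noteq> Y"
        "role ` X \<inter> role ` Y = {}" "cross X Y \<subseteq> U" by (rule unitsE[OF e(2)])
      have "open_pair U X Y" using X unfolding open_pair_def by simp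
      then show False using e X unfolding junk_def by blast
    qed
    have "card (junk (U - ?R) CC) \<le> card ?left"
      using reply(3) by (intro card_mono[OF finL]) simp
    then have 1: "card (junk (U - ?R) CC) \<le> ?l" using left by linarith
    have "card (\<Union>?UU) \<le> card (\<Union> (units S S1 S2 A (U - ?R) CC) \<union> (T \<union> ?left))"
    proof (rule card_mono)
      show "finite (\<Union> (units S S1 S2 A (U - ?R) CC) \<union> (T \<union> ?left))"
        using finV[of "U - ?R"] finU finT finL by simp
      show "\<Union>?UU \<subseteq> \<Union> (units S S1 S2 A (U - ?R) CC) \<union> (T \<union> ?left)"
      proof
        fix e assume "e \<in> \<Union>?UU"
        then obtain u where u: "u \<in> ?UU" "e \<in> u" by blast
        show "e \<in> \<Union> (units S S1 S2 A (U - ?R) CC) \<union> (T \<union> ?left)"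
        proof (cases "u \<inter> T = {}")
          case True
          then have "u \<in> units S S1 S2 A (U - ?R) CC" using reply(2) u(1) by blast
          then show ?thesis using u(2) by blast
        qed (use u in blast)
      qed
    qed
    also have "\<dots> \<le> card (\<Union> (units S S1 S2 A (U - ?R) CC)) + card (T \<union> ?left)" by (rule card_Un_le)
    also have "card (T \<union> ?left) \<le> card T + card ?left" by (rule card_Un_le)
    finally have 2: "card (\<Union>?UU) \<le> card (\<Union> (units S S1 S2 A (U - ?R) CC)) + (?m + ?l)"
      using T(2) left by linarith
    have "card ?R = b" using disj finJ finT T(2) False by (simp add: card_Un_disjoint)
    moreover have "?R \<subseteq> U" using JU T(1) units_subset by blast
    ultimately show ?thesis using that[of ?R] reply(1) 1 2 False by simp
  qed
qed

text \<open>A single junk edge lets Avoider force a reply of \<open>b\<close> sacrificed edges that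
  leaves no junk; the rise from \<open>b\<close> to \<open>2 * b\<close> pays for it. With more
  junk, a reply that touches units costs at most \<open>b\<close> and leaves at most one junk edge,
  so the rise from 0 suffices again.\<close>

definition offset :: "nat \<Rightarrow> nat" where
  "offset j = (if j = 0 then 2 * b else if j = 1 then b else 0)"

text \<open>If no junk is left, Avoider's next move makes progress; the potential \<open>offset\<close> accounts
  for this. A single junk edge may remain, but as \<open>b\<close> is even if units have two edges, there is
  none left after the round in which Avoider takes it.\<close>

definition phase_pos :: "'a set set \<Rightarrow> nat set set \<Rightarrow> nat set set \<Rightarrow> real \<Rightarrow>
    nat set set \<Rightarrow> nat set set \<Rightarrow> nat set set \<Rightarrow> bool" where
  "phase_pos S S1 S2 \<sigma> A U CC \<longleftrightarrow> phase_inv S (\<Union>S1 \<union> \<Union>S2) A U CC \<and> card U mod (b + 1) = \<rho> \<and>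
     (\<forall>v\<in>V. 3 / 4 * required S v \<le> real (available S (\<Union>S1 \<union> \<Union>S2) A CC v)) \<and>
     (\<forall>D P. P \<noteq> induced S D \<longrightarrow> real (card (cls A CC D P)) < quota P + 1) \<and>
     \<sigma> \<le> real (card (\<Union> (units S S1 S2 A U CC)) + 5 * (b * progress S A CC) + offset (card (junk U CC)))"

text \<open>While no class is frequent, advanced copies are few and progress is small, so the
  potential certifies enough units for a reply. It never falls below \<open>\<sigma>\<close>:
  progress pays through the term with factor 5, moves on junk through \<open>offset\<close>.\<close>

lemma phase_step:
  assumes pos: "phase_pos S S1 S2 \<sigma> A U CC" and S: "S \<subseteq> E" "card S + 2 \<le> card E"
    and pq: "p \<in> V" "q \<in> V" "part S p \<noteq> part S q" "{p, q} \<in> E"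
    and min: "\<And>u v. {u, v} \<in> E - S \<Longrightarrow> part S u \<noteq> part S v \<Longrightarrow>
       part_weight S p + part_weight S q \<le> part_weight S u + part_weight S v"
    and blocks: "\<And>X. X \<in> S1 \<Longrightarrow> role ` X = part S p" "\<And>X. X \<in> S2 \<Longrightarrow> role ` X = part S q"
    and \<sigma>: "5 * real b * real (card E) * 2 ^ (card V + 2 * card E) * (\<mu> * \<eta> ^ (part_weight S p + part_weight S q + 1))
       + 5 * real b \<le> \<sigma>"
    and no: "\<not> contains_copy {..<n} A V E"
    and rare: "\<And>D P. P \<noteq> induced S D \<Longrightarrow> real (card (cls A CC D P)) < quota P"
    and a: "a \<in> U"
  shows "\<exists>R CC'. R \<subseteq> U - {a} \<and> card R = b \<and> phase_pos S S1 S2 \<sigma> (insert a A) (U - {a} - R) CC'"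
proof -
  let ?B = "\<Union>S1 \<union> \<Union>S2"
  let ?w = "part_weight S p + part_weight S q + 1"
  let ?W = "2 ^ (card V + 2 * card E) :: real"
  have inv: "phase_inv S ?B A U CC" and rem: "card U mod (b + 1) = \<rho>"
    and av: "\<And>v. v \<in> V \<Longrightarrow> 3 / 4 * required S v \<le> real (available S ?B A CC v)"
    and pot: "\<sigma> \<le> real (card (\<Union> (units S S1 S2 A U CC)) + 5 * (b * progress S A CC) + offset (card (junk U CC)))"
    using pos unfolding phase_pos_def by blast+
  note D = phase_invD[OF inv]
  have finU: "finite U" using finite_subset[OF D(1)] by simp
  have finCC: "finite CC" by (rule copies_finite[OF D(3)])
  let ?F = "{X \<in> CC. advanced S A X}"
  have "real (card ?F) \<le> 2 ^ (card V + card E) * (2 ^ card E * \<mu> * \<eta> ^ ?w)"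
  proof (rule count_classes[OF D(3)])
    show "0 \<le> 2 ^ card E * \<mu> * \<eta> ^ ?w" using mu_pos eta_pos by simp
    fix X assume "X \<in> ?F"
    then have X: "X \<in> CC" "advanced S A X" by blast+
    have "real (card (cls A CC (role ` X) (pattern A X))) \<le> quota (pattern A X)"
      using rare[of "pattern A X" "role ` X"] X(2) unfolding advanced_def by simp
    also have "\<dots> \<le> 2 ^ card E * \<mu> * \<eta> ^ ?w"
    proof -
      have "?w \<le> weight (card E) (pattern A X)"
        using advanced_weight(3)[OF inv S X no _ pq(1,2,3)] min unfolding part_weight_def by blast
      then show ?thesis
        unfolding quota_def using mu_pos eta_pos eta_le_1
        by (intro mult_left_mono power_decreasing) auto
    qed
    finally show "real (card (cls A CC (role ` X) (pattern A X))) \<le> 2 ^ card E * \<mu> * \<eta> ^ ?w" .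
  qed blast
  also have "\<dots> = ?W * (\<mu> * \<eta> ^ ?w)"
  proof -
    have "card V + 2 * card E = (card V + card E) + card E" by simp
    then have "?W = 2 ^ (card V + card E) * 2 ^ card E" by (simp only: power_add)
    then show ?thesis by (simp add: mult_ac)
  qed
  finally have F: "real (card ?F) \<le> ?W * (\<mu> * \<eta> ^ ?w)" .
  have "progress S A CC \<le> (\<Sum>X\<in>?F. card E)"
    unfolding progress_def
    by (rule sum_mono) (use card_realized_le copiesD(3)[OF D(3)] in blast)
  then have "progress S A CC \<le> card ?F * card E" by simp
  then have "real (progress S A CC) \<le> real (card ?F) * real (card E)"
    by (metis of_nat_le_iff of_nat_mult)
  also have "\<dots> \<le> (?W * (\<mu> * \<eta> ^ ?w)) * real (card E)"
    using F by (intro mult_right_mono) auto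
  finally have "5 * real b * real (progress S A CC) \<le> 5 * real b * ((?W * (\<mu> * \<eta> ^ ?w)) * real (card E))"
    by (intro mult_left_mono) auto
  then have "5 * real b * real (progress S A CC) + 5 * real b \<le> \<sigma>"
    using \<sigma> by (simp add: mult_ac)
  then have "5 * real b \<le> real (card (\<Union> (units S S1 S2 A U CC)) + offset (card (junk U CC)))"
    using pot by (simp add: mult_ac)
  moreover have "offset (card (junk U CC)) \<le> 2 * b" unfolding offset_def by simp
  \<comment> \<open>Of the certified \<open>5 * b\<close>, at most \<open>2 * b\<close> come from
    the offset.\<close>
  ultimately have many: "3 * b \<le> card (\<Union> (units S S1 S2 A U CC))" by linarith
  obtain CC' Z where inv': "phase_inv S ?B (insert a A) (U - {a}) CC'"
    and av': "\<And>v. available S ?B A CC v \<le> available S ?B (insert a A) CC' v"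
    and cls': "\<And>D P. cls (insert a A) CC' D P \<subseteq> insert Z (cls A CC D P)"
    and alt: "a \<in> junk U CC \<and> junk (U - {a}) CC' = junk U CC - {a} \<and>
       progress S (insert a A) CC' = progress S A CC \<and>
       units S S1 S2 A U CC \<subseteq> units S S1 S2 (insert a A) (U - {a}) CC' \<or>
     progress S A CC + 1 \<le> progress S (insert a A) CC' \<and>
       card (\<Union> (units S S1 S2 A U CC)) \<le> card (\<Union> (units S S1 S2 (insert a A) (U - {a}) CC')) + card V * n"
    by (rule avoider_step[OF inv a S(1), where ?S1.0 = S1 and ?S2.0 = S2]) (rule that)
  note D' = phase_invD[OF inv']
  let ?A = "insert a A" and ?U = "U - {a}"
  let ?s = "card (\<Union> (units S S1 S2 A U CC))" and ?j = "card (junk U CC)" and ?g = "b * progress S A CC"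
  let ?s' = "card (\<Union> (units S S1 S2 ?A ?U CC'))" and ?j' = "card (junk ?U CC')" and ?g' = "b * progress S ?A CC'"
  have finJ: "finite (junk U CC)" using finite_subset[OF _ finU, of "junk U CC"] unfolding junk_def by simp
  have alt': "1 \<le> ?j \<and> ?j' + 1 = ?j \<and> ?g' = ?g \<and> ?s \<le> ?s' \<or> ?g + b \<le> ?g' \<and> ?s \<le> ?s' + b"
    using alt
  proof
    assume J: "a \<in> junk U CC \<and> junk ?U CC' = junk U CC - {a} \<and>
       progress S ?A CC' = progress S A CC \<and>
       units S S1 S2 A U CC \<subseteq> units S S1 S2 ?A ?U CC'"
    then have eq: "junk ?U CC' = junk U CC - {a}" and aJ: "a \<in> junk U CC" by blast+
    have "?j' + 1 = ?j" unfolding eq using card_Suc_Diff1[OF finJ aJ] by linarith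
    moreover have "?s \<le> ?s'"
    proof (rule card_mono)
      show "finite (\<Union> (units S S1 S2 ?A ?U CC'))"
        by (rule finite_subset[OF units_subset]) (use finU in simp)
      show "\<Union> (units S S1 S2 A U CC) \<subseteq> \<Union> (units S S1 S2 ?A ?U CC')" using J by blast
    qed
    moreover have "?g' = ?g" using J by presburger
    ultimately show ?thesis by linarith
  next
    assume P: "progress S A CC + 1 \<le> progress S ?A CC' \<and> ?s \<le> ?s' + card V * n"
    then have "b * (progress S A CC + 1) \<le> ?g'" by (intro mult_le_mono2) simp
    then show ?thesis using P bias(1) by simp
  qed
  let ?c = "card (links (part S p) (part S q))"
  have c: "?c = 1 \<or> ?c = 2 \<and> even b" by (rule card_links[OF S(1) pq(4,3)])
  have size: "card u = ?c" if u: "u \<in> units S S1 S2 ?A ?U CC'" for u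
  proof -
    obtain X Y where X: "u = cross X Y" "X \<in> CC'" "X \<in> S1" "Y \<in> CC'" "Y \<in> S2" "role ` X \<inter> role ` Y = {}"
      by (rule unitsE[OF u]) blast
    have "card (cross X Y) = card (links (role ` X) (role ` Y))"
      by (rule card_cross[OF copiesD(3)[OF D'(3) X(2)] copiesD(3)[OF D'(3) X(4)] X(6)])
    then show ?thesis using X(1) blocks(1)[OF X(3)] blocks(2)[OF X(5)] by simp
  qed
  have bs: "b \<le> ?s'" using many alt' by linarith
  have c12: "?c = 1 \<or> ?c = 2" using c by blast
  obtain R where R: "R \<subseteq> ?U" "card R = b" and invR: "phase_inv S ?B ?A (?U - R) CC'"
    and altR: "b \<le> ?j' \<and> card (junk (?U - R) CC') + b \<le> ?j' \<and>
       ?s' \<le> card (\<Union> (units S S1 S2 ?A (?U - R) CC')) \<or>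
     ?j' < b \<and> card (junk (?U - R) CC') \<le> (if ?c = 2 \<and> odd (b - ?j') then 1 else 0) \<and>
       ?s' + ?j' \<le> card (\<Union> (units S S1 S2 ?A (?U - R) CC')) + b +
         (if ?c = 2 \<and> odd (b - ?j') then 1 else 0)"
    by (rule enforcer_reply_exists[OF inv' size c12 bs]) (assumption, rule that)
  let ?s'' = "card (\<Union> (units S S1 S2 ?A (?U - R) CC'))" and ?j'' = "card (junk (?U - R) CC')"
  have even: "even b" if "?c = 2" using c that by simp
  have key: "?s + 5 * ?g + offset ?j \<le> ?s'' + 5 * ?g' + offset ?j''"
    using alt'
  proof
    assume J: "1 \<le> ?j \<and> ?j' + 1 = ?j \<and> ?g' = ?g \<and> ?s \<le> ?s'"
    show ?thesis using altR
    proof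
      assume "b \<le> ?j' \<and> ?j'' + b \<le> ?j' \<and> ?s' \<le> ?s''"
      moreover from this have "offset ?j \<le> offset ?j''" using J bias(2) unfolding offset_def by auto
      ultimately show ?thesis using J by linarith
    next
      assume L: "?j' < b \<and> ?j'' \<le> (if ?c = 2 \<and> odd (b - ?j') then 1 else 0) \<and>
        ?s' + ?j' \<le> ?s'' + b + (if ?c = 2 \<and> odd (b - ?j') then 1 else 0)"
      show ?thesis
      proof (cases "?j' = 0")
        case True
        \<comment> \<open>Units of two edges occur only for even \<open>b\<close>, so a reply of
          exactly \<open>b\<close> sacrificed edges breaks no unit.\<close>
        then have l: "(if ?c = 2 \<and> odd (b - ?j') then 1 else 0) = (0 :: nat)" using even by simp
        have "?j'' = 0" "?s' \<le> ?s'' + b" using L True unfolding l by linarith+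
        moreover from this have "offset ?j'' = 2 * b" unfolding offset_def by simp
        moreover have "offset ?j = b" using J True unfolding offset_def by auto
        ultimately show ?thesis using J by linarith
      next
        case False
        have "?j'' \<le> 1" "?s' + ?j' \<le> ?s'' + b + 1" using L by (auto split: if_splits)
        then have "?s' \<le> ?s'' + b" "b \<le> offset ?j''" using False unfolding offset_def by auto
        moreover have "offset ?j = 0" using J False unfolding offset_def by auto
        ultimately show ?thesis using J by linarith
      qed
    qed
  next
    assume P: "?g + b \<le> ?g' \<and> ?s \<le> ?s' + b"
    \<comment> \<open>Origin of the factor 5: Avoider's move costs at most \<open>b\<close> edges in
      units, the reply at most \<open>b + 1\<close>, and the offset drops by at most
      \<open>2 * b\<close>; as \<open>b\<close> is at least 1, the total is at most
      \<open>5 * b\<close>.\<close>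
    have "?s' \<le> ?s'' + b + 1" using altR by (auto split: if_splits)
    moreover have "offset ?j \<le> 2 * b" unfolding offset_def by simp
    ultimately show ?thesis using P bias(2) by linarith
  qed
  have "phase_pos S S1 S2 \<sigma> ?A (?U - R) CC'"
    unfolding phase_pos_def
  proof (intro conjI allI ballI impI)
    show "phase_inv S ?B ?A (?U - R) CC'" by (rule invR)
    have "b \<le> card ?U" using R finU by (metis card_mono finite_Diff)
    then have min: "card R = min b (card ?U)" using R(2) by simp
    have cardU: "card (?U - R) = card U - (b + 1)" by (rule card_after_round[OF finU a R(1) min])
    have "b + 1 \<le> card U"
      using \<open>b \<le> card ?U\<close> a finU by (metis Suc_eq_plus1 Suc_le_mono card_Suc_Diff1)
    then show "card (?U - R) mod (b + 1) = \<rho>"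
      unfolding cardU using rem le_mod_geq by metis
    fix v assume "v \<in> V"
    then show "3 / 4 * required S v \<le> real (available S ?B ?A CC' v)"
      using av[of v] av'[of v] by linarith
  next
    fix D P assume P: "P \<noteq> induced S D"
    have "finite (cls A CC D P)" unfolding cls_def using finCC by simp
    then have "card (cls ?A CC' D P) \<le> card (insert Z (cls A CC D P))"
      by (intro card_mono cls') simp
    also have "\<dots> \<le> card (cls A CC D P) + 1"
      using \<open>finite (cls A CC D P)\<close> by (simp add: card_insert_if)
    finally show "real (card (cls ?A CC' D P)) < quota P + 1" using rare[OF P] by linarith
  next
    show "\<sigma> \<le> real (?s'' + 5 * ?g' + offset ?j'')"
      using pot key by (meson of_nat_le_iff order_trans)
  qed
  then show ?thesis using R by blast
qed

text \<open>The remainder is positive and preserved, so the board is never exhausted within the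
  phase. As the free edges decrease, a finished copy or a frequent pattern must appear; in the
  latter case \<open>IH\<close> applies to a larger edge set.\<close>

lemma phase_wins:
  assumes pos: "phase_pos S S1 S2 \<sigma> A U CC" and S: "S \<subseteq> E" "card S + 2 \<le> card E"
    and pq: "p \<in> V" "q \<in> V" "part S p \<noteq> part S q" "{p, q} \<in> E"
    and min: "\<And>u v. {u, v} \<in> E - S \<Longrightarrow> part S u \<noteq> part S v \<Longrightarrow>
       part_weight S p + part_weight S q \<le> part_weight S u + part_weight S v"
    and blocks: "\<And>X. X \<in> S1 \<Longrightarrow> role ` X = part S p" "\<And>X. X \<in> S2 \<Longrightarrow> role ` X = part S q"
    and \<sigma>: "5 * real b * real (card E) * 2 ^ (card V + 2 * card E) * (\<mu> * \<eta> ^ (part_weight S p + part_weight S q + 1))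
       + 5 * real b \<le> \<sigma>"
    and IH: "\<And>S' A U. S \<subset> S' \<Longrightarrow> S' \<subseteq> E \<Longrightarrow> state S' A U \<Longrightarrow> wins A U"
  shows "wins A U"
  using pos
proof (induction "card U" arbitrary: A U CC rule: less_induct)
  case less
  have inv: "phase_inv S (\<Union>S1 \<union> \<Union>S2) A U CC" and rem: "card U mod (b + 1) = \<rho>"
    and av: "\<And>v. v \<in> V \<Longrightarrow> 3 / 4 * required S v \<le> real (available S (\<Union>S1 \<union> \<Union>S2) A CC v)"
    and bound: "\<And>D P. P \<noteq> induced S D \<Longrightarrow> real (card (cls A CC D P)) < quota P + 1"
    using less.prems unfolding phase_pos_def by blast+
  note D = phase_invD[OF inv]
  have finU: "finite U" using finite_subset[OF D(1)] by simp
  have U: "U \<noteq> {}" using rem rho(1) by auto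
  consider "contains_copy {..<n} A V E"
    | D P where "\<not> contains_copy {..<n} A V E" "P \<noteq> induced S D" "quota P \<le> real (card (cls A CC D P))"
    | "\<not> contains_copy {..<n} A V E" "\<And>D P. P \<noteq> induced S D \<Longrightarrow> real (card (cls A CC D P)) < quota P"
    by (meson not_le)
  then show ?case
  proof cases
    case 1
    then show ?thesis by (rule wins_if_copy[OF _ D(1)])
  next
    case (2 C P)
    have "cls A CC C P \<noteq> {}" using 2(3) quota_pos[of P] by auto
    then obtain X where X: "X \<in> CC" "role ` X = C" "pattern A X = P" unfolding cls_def by blast
    have adv: "advanced S A X" using X 2(2) unfolding advanced_def by simp
    have freq: "quota (pattern A X) \<le> real (card (cls A CC (role ` X) (pattern A X)))"
      using 2(3) X by simp
    note st = state_if_frequent[OF inv S rem 2(1) X(1) adv freq bound av]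
    have "S \<union> pattern A X \<subseteq> E" using S(1) pattern_subset[of A X] unfolding induced_def by blast
    then show ?thesis using IH[OF st(2) _ st(1)] by blast
  next
    case 3
    from U show ?thesis
    proof (rule enforcer_pos.move)
      fix a assume a: "a \<in> U"
      obtain R CC' where R: "R \<subseteq> U - {a}" "card R = b"
        and pos': "phase_pos S S1 S2 \<sigma> (insert a A) (U - {a} - R) CC'"
        using phase_step[OF less.prems S pq min blocks \<sigma> 3 a] by blast
      have "card (U - {a} - R) < card U"
        using a finU by (intro psubset_card_mono) auto
      then have "wins (insert a A) (U - {a} - R)" using pos' by (rule less.hyps)
      moreover have "card R = min b (card (U - {a}))"
        using R card_mono[OF _ R(1)] finU by simp
      ultimately show "\<exists>B. B \<subseteq> U - {a} \<and> card B = min b (card (U - {a})) \<and> wins (insert a A) (U - {a} - B)"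
        using R(1) by blast
    qed
  qed
qed

end

section \<open>Start of a phase, the last missing edge, and the whole game\<close>

lemma card_le_if_distinct_witnesses:
  assumes "finite R" and ex: "\<And>i. i \<in> I \<Longrightarrow> \<exists>r\<in>R. Q i r"
    and dist: "\<And>i j r. i \<in> I \<Longrightarrow> j \<in> I \<Longrightarrow> Q i r \<Longrightarrow> Q j r \<Longrightarrow> i = j"
  shows "card I \<le> card R"
proof -
  obtain f where f: "\<And>i. i \<in> I \<Longrightarrow> f i \<in> R \<and> Q i (f i)" using ex by metis
  have "inj_on f I"
  proof (rule inj_onI)
    fix i j assume ij: "i \<in> I" "j \<in> I" "f i = f j"
    show "i = j" by (rule dist[OF ij(1,2), of "f i"]) (use f[OF ij(1)] f[OF ij(2)] ij(3) in simp_all)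
  qed
  moreover have "f ` I \<subseteq> R" using f by blast
  ultimately show ?thesis using assms(1) by (rule card_inj_on_le)
qed

context enforcer_game
begin

lemma induced_psubset:
  assumes "S \<subset> E"
  shows "induced S D \<subset> E"
  using assms unfolding induced_def by blast

lemma required_ge:
  assumes "S \<subset> E" "card S + m \<le> card E"
  shows "2 ^ m * (\<mu> * \<eta> ^ part_weight S v) \<le> required S v" and "4 \<le> \<mu> * \<eta> ^ part_weight S v"
proof -
  have "(2::real) ^ m \<le> 2 ^ (card E - card S)" using assms(2) by (intro power_increasing) auto
  then show "2 ^ m * (\<mu> * \<eta> ^ part_weight S v) \<le> required S v"
    unfolding required_def mult.assoc using mu_pos eta_pos by (intro mult_right_mono) auto
  show "4 \<le> \<mu> * \<eta> ^ part_weight S v"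
    unfolding part_weight_def by (rule feasible[OF induced_psubset[OF assms(1)]])
qed

text \<open>The linking edge has least total weight, as \<open>advanced_weight\<close> requires, and
  a quarter of the demanded copies of either part forms a block. At this moment all pairs between
  the blocks are open, so the product of the block sizes is a valid initial value for the
  potential.\<close>

lemma start_phase:
  assumes st: "state S A U" and S: "S \<subseteq> E" "card S + 2 \<le> card E"
    and IH: "\<And>S' A U. S \<subset> S' \<Longrightarrow> S' \<subseteq> E \<Longrightarrow> state S' A U \<Longrightarrow> wins A U"
  shows "wins A U"
proof -
  have SE: "S \<subset> E" using S by auto
  have finS: "finite S" by (rule finite_subset[OF S(1) finite_E])
  let ?link = "\<lambda>(p, q). {p, q} \<in> E - S \<and> part S p \<noteq> part S q"
  let ?m = "\<lambda>(p, q). part_weight S p + part_weight S q"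
  have "\<exists>x. ?link x"
    using exists_linking_edge[OF E_subset finite_E one_cycle S] by auto
  then obtain x where x: "?link x" and x_min: "\<And>y. ?link y \<Longrightarrow> ?m x \<le> ?m y"
    using ex_has_least_nat[of ?link _ ?m] by blast
  obtain p q where pq_def: "x = (p, q)" by (cases x)
  have pq: "{p, q} \<in> E" "{p, q} \<notin> S" and ne: "part S p \<noteq> part S q" using x unfolding pq_def by simp_all
  have min: "part_weight S p + part_weight S q \<le> part_weight S u + part_weight S v"
    if "{u, v} \<in> E - S" "part S u \<noteq> part S v" for u v
    using x_min[of "(u, v)"] that unfolding pq_def by simp
  have pqV: "p \<in> V" "q \<in> V" using pq(1) E_subset unfolding nsets_def by auto
  obtain CC where C: "copies A U CC"
    and part_of: "\<And>X. X \<in> CC \<Longrightarrow> \<exists>v\<in>V. role ` X = part S v" and plain: "\<And>X. X \<in> CC \<Longrightarrow> \<not> advanced S A X"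
    and cross: "\<And>X Y. X \<in> CC \<Longrightarrow> Y \<in> CC \<Longrightarrow> X \<noteq> Y \<Longrightarrow> role ` X \<inter> role ` Y = {} \<Longrightarrow> cross X Y \<subseteq> U"
    and enough: "\<And>v. v \<in> V \<Longrightarrow> required S v \<le> real (card {X\<in>CC. role ` X = part S v})"
    and U: "U \<subseteq> complete_edges n" "A \<inter> U = {}" "card U mod (b + 1) = \<rho>"
    using st unfolding state_def by auto
  have finCC: "finite CC" by (rule copies_finite[OF C])
  \<comment> \<open>A quarter, rounded down. As \<open>required\<close> is at least 16, this is at
    least an eighth of it, and thus half of \<open>\<mu> * \<eta> ^ part_weight S v\<close>.\<close>
  let ?N = "\<lambda>v. nat \<lfloor>required S v / 4\<rfloor>"
  have req: "16 \<le> required S v" "4 * (\<mu> * \<eta> ^ part_weight S v) \<le> required S v" for v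
    using required_ge[OF SE S(2), of v] by simp_all
  have N_le: "real (?N v) \<le> required S v / 4" for v using req(1)[of v] by (intro of_nat_floor) simp
  have N_ge: "\<mu> * \<eta> ^ part_weight S v / 2 \<le> real (?N v)" for v
    using req[of v] by linarith
  have sub_exists: "\<exists>T. T \<subseteq> {X\<in>CC. role ` X = part S v} \<and> card T = ?N v" if "v \<in> V" for v
  proof -
    have "real (?N v) \<le> real (card {X\<in>CC. role ` X = part S v})"
      using N_le[of v] req(1)[of v] enough[OF that] by linarith
    then have "?N v \<le> card {X\<in>CC. role ` X = part S v}" by (simp only: of_nat_le_iff)
    then show ?thesis by (rule obtain_subset_with_card_n) blast
  qed
  obtain S1 where S1: "S1 \<subseteq> {X\<in>CC. role ` X = part S p}" "card S1 = ?N p" using sub_exists[OF pqV(1)] by blast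
  obtain S2 where S2: "S2 \<subseteq> {X\<in>CC. role ` X = part S q}" "card S2 = ?N q" using sub_exists[OF pqV(2)] by blast
  have fin12: "finite S1" "finite S2" using finite_subset[OF S1(1)] finite_subset[OF S2(1)] finCC by simp_all
  let ?B = "\<Union>S1 \<union> \<Union>S2"
  have inv: "phase_inv S ?B A U CC"
    unfolding phase_inv_def
  proof (intro conjI ballI impI)
    fix X Y assume "X \<in> CC" "Y \<in> CC" "X \<noteq> Y \<and> role ` X \<inter> role ` Y = {} \<and> X \<inter> ?B = {}"
    then show "cross X Y \<subseteq> U" using cross by simp
  next
    fix X v assume X: "X \<in> CC" and v: "v \<in> role ` X"
    obtain u where "role ` X = part S u" using part_of[OF X] by blast
    then show "part S v \<subseteq> role ` X" using part_eq[of v S u] v by simp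
  next
    fix X assume "X \<in> CC"
    then show "induced S (role ` X) \<subseteq> pattern A X" using plain[of X] unfolding advanced_def by simp
  qed (use U C in simp_all)
  have av: "3 / 4 * required S v \<le> real (available S ?B A CC v)" if v: "v \<in> V" for v
  proof -
    let ?X = "{X\<in>CC. role ` X = part S v}"
    let ?T = "if part S v = part S p then S1 else if part S v = part S q then S2 else {}"
    have finT: "finite ?T" using fin12 by simp
    have "?X - ?T \<subseteq> {X \<in> CC. v \<in> role ` X \<and> (advanced S A X \<or> X \<inter> ?B = {})}"
    proof
      fix X assume X: "X \<in> ?X - ?T"
      then have XC: "X \<in> CC" and role: "role ` X = part S v" by blast+
      have "X \<notin> S1" "X \<notin> S2" using X S1(1) S2(1) role ne by (auto split: if_splits)
      then have "X \<inter> Z = {}" if "Z \<in> S1 \<union> S2" for Z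
        using copies_disjoint[OF C XC, of Z] that S1(1) S2(1) by blast
      then have "X \<inter> ?B = {}" by blast
      then show "X \<in> {X \<in> CC. v \<in> role ` X \<and> (advanced S A X \<or> X \<inter> ?B = {})}" using XC role by simp
    qed
    then have "card (?X - ?T) \<le> available S ?B A CC v"
      unfolding available_def by (rule card_mono[rotated]) (use finCC in simp)
    moreover have "card ?X - card ?T \<le> card (?X - ?T)" by (rule diff_card_le_card_Diff[OF finT])
    moreover have "real (card ?T) \<le> required S v / 4"
    proof -
      have r: "required S v = required S u" if "part S v = part S u" for u
        unfolding required_def part_weight_def that ..
      show ?thesis
      proof (cases "part S v = part S p")
        case True
        then show ?thesis using N_le[of p] S1(2) r[OF True] by (simp only: if_True simp_thms)
      next
        case False
        show ?thesis
        proof (cases "part S v = part S q")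
          case True
          then show ?thesis using N_le[of q] S2(2) r[OF True] ne by simp
        next
          case q: False
          have "?T = {}" using False q by (simp only: if_False)
          then show ?thesis using req(1)[of v] by (simp only: card.empty)
        qed
      qed
    qed
    ultimately show ?thesis using enough[OF v] by linarith
  qed
  have cls_empty: "cls A CC D P = {}" if "P \<noteq> induced S D" for D P
    using plain that unfolding cls_def advanced_def by blast
  let ?R = "\<Union> (units S S1 S2 A U CC)"
  have "?N p * ?N q \<le> card ?R"
  proof -
    have "card (S1 \<times> S2) \<le> card ?R"
    proof (rule card_le_if_distinct_witnesses[where Q = "\<lambda>(X, Y) e. e \<in> cross X Y"])
      show "finite ?R" by (rule finite_subset[OF units_subset]) (use finite_subset[OF U(1)] in simp)
    next
      fix i assume i: "i \<in> S1 \<times> S2"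
      then obtain X Y where XY: "i = (X, Y)" "X \<in> S1" "Y \<in> S2" by blast
      then have X: "X \<in> CC" "role ` X = part S p" and Y: "Y \<in> CC" "role ` Y = part S q"
        using S1(1) S2(1) by blast+
      have disj: "role ` X \<inter> role ` Y = {}" unfolding X(2) Y(2) by (rule part_disjoint[OF ne])
      have XneY: "X \<noteq> Y" using X(2) Y(2) ne by blast
      have "p \<in> role ` X" "q \<in> role ` Y" unfolding X(2) Y(2) by simp_all
      then obtain x y where "x \<in> X" "y \<in> Y" "p = role x" "q = role y" by blast
      then have e: "{x, y} \<in> cross X Y" using pq(1) unfolding cross_def by blast
      have "cross X Y \<in> units S S1 S2 A U CC"
        by (rule unitsI[OF X(1) XY(2) Y(1) XY(3) XneY disj cross[OF X(1) Y(1) XneY disj] plain[OF X(1)] plain[OF Y(1)]])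
      then show "\<exists>r\<in>?R. (\<lambda>(X, Y) e. e \<in> cross X Y) i r" using e unfolding XY(1) by blast
    next
      fix i j e assume i: "i \<in> S1 \<times> S2" and j: "j \<in> S1 \<times> S2"
        and e: "(\<lambda>(X, Y) e. e \<in> cross X Y) i e" "(\<lambda>(X, Y) e. e \<in> cross X Y) j e"
      obtain X Y X' Y' where XY: "i = (X, Y)" "j = (X', Y')" by (cases i, cases j)
      have m: "X \<in> CC" "Y \<in> CC" "X' \<in> CC" "Y' \<in> CC" "role ` X = part S p" "role ` X' = part S p"
        "role ` Y = part S q" "role ` Y' = part S q"
        using i j subsetD[OF S1(1), of X] subsetD[OF S1(1), of X'] subsetD[OF S2(1), of Y]
          subsetD[OF S2(1), of Y'] unfolding XY by simp_all
      have "X' \<noteq> Y'" "X \<noteq> Y'" using m ne by metis+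
      then show "i = j" using cross_unique[OF C m(1-4), of e] e unfolding XY by simp
    qed
    then show ?thesis using S1(2) S2(2) by (simp add: card_cartesian_product)
  qed
  then have units_ge: "real (?N p * ?N q) \<le> real (card ?R)" by (rule of_nat_mono)
  have pos: "phase_pos S S1 S2 (real (?N p * ?N q)) A U CC"
    unfolding phase_pos_def
  proof (intro conjI ballI allI impI)
    show "real (?N p * ?N q) \<le> real (card ?R + 5 * (b * progress S A CC) + offset (card (junk U CC)))"
      using units_ge by (rule order_trans) (intro of_nat_mono, simp)
    fix D P assume "P \<noteq> induced S D"
    then show "real (card (cls A CC D P)) < quota P + 1"
      using cls_empty quota_pos[of P] by simp
  qed (use inv U(3) av in simp_all)
  have \<sigma>: "5 * real b * real (card E) * 2 ^ (card V + 2 * card E) * (\<mu> * \<eta> ^ (part_weight S p + part_weight S q + 1))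
       + 5 * real b \<le> real (?N p * ?N q)"
  proof -
    let ?w = "part_weight S p + part_weight S q"
    let ?k = "real b * real (card E) * 2 ^ (card V + 2 * card E)"
    \<comment> \<open>Two edges are missing, so this is still a proper subgraph and
      \<open>feasible\<close> applies to it; this controls the summand \<open>5 * b\<close>.\<close>
    have "insert {p, q} S \<subset> E"
    proof -
      have "card (insert {p, q} S) < card E" using pq(2) finS S(2) by simp
      then show ?thesis using pq(1) S(1) by blast
    qed
    note P = this
    have "?w + 1 \<le> weight (card E) (insert {p, q} S)"
      unfolding part_weight_def
    proof (rule weight_superadditive[where e = "{p, q}"])
      show "at_most_one_cycle (insert {p, q} S)"
        using one_cycle is_cycle_mono[of "insert {p, q} S" _ E] P unfolding at_most_one_cycle_def by blast
      have "f \<noteq> {}" if "f \<in> S" for f using that S(1) E_subset unfolding nsets_def by force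
      then show "induced S (part S p) \<inter> induced S (part S q) = {}"
        using part_disjoint[OF ne] unfolding induced_def by blast
    qed (use finS pq(2) in \<open>auto simp: induced_def\<close>)
    then have "\<eta> ^ weight (card E) (insert {p, q} S) \<le> \<eta> ^ (?w + 1)"
      using eta_pos eta_le_1 by (intro power_decreasing) auto
    then have "\<mu> * \<eta> ^ weight (card E) (insert {p, q} S) \<le> \<mu> * \<eta> ^ (?w + 1)"
      using mu_pos by (intro mult_left_mono) auto
    then have m4: "4 \<le> \<mu> * \<eta> ^ (?w + 1)" using feasible[OF P] by linarith
    have "1 * 1 \<le> real (card E) * (2::real) ^ (card V + 2 * card E)"
      using two_edges by (intro mult_mono) auto
    then have "real b * 1 \<le> real b * (real (card E) * 2 ^ (card V + 2 * card E))"
      by (intro mult_left_mono) auto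
    then have k: "real b \<le> ?k" by (simp add: mult.assoc)
    then have bX: "real b * 4 \<le> ?k * (\<mu> * \<eta> ^ (?w + 1))"
      using m4 by (intro mult_mono) auto
    have "20 * (?k * (\<mu> * \<eta> ^ (?w + 1))) = (80 * real b * real (card E) * 2 ^ (card V + 2 * card E) * \<eta>) * (\<mu> * \<eta> ^ ?w) / 4"
      by simp
    also have "\<dots> = (\<mu> * \<eta> ^ part_weight S p / 2) * (\<mu> * \<eta> ^ part_weight S q / 2)"
      unfolding eta_eq by (simp add: power_add)
    also have "\<dots> \<le> real (?N p) * real (?N q)"
      using N_ge mu_pos eta_pos by (intro mult_mono) auto
    finally have "20 * (?k * (\<mu> * \<eta> ^ (?w + 1))) \<le> real (?N p * ?N q)" by simp
    then show ?thesis using bX by (simp add: mult.assoc)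
  qed
  show ?thesis
    by (rule phase_wins[OF pos S pqV ne pq(1) min _ _ \<sigma> IH]) (use S1(1) S2(1) in blast)+
qed


text \<open>Each copy, or each pair of copies, yields its own threat, as different ones share no
  edge. So there are at least as many threats as the remainder requires.\<close>

lemma terminal:
  assumes st: "state S A U" and S: "S \<subseteq> E" "card S + 1 = card E"
  shows "wins A U"
proof -
  have SE: "S \<subset> E" using S by auto
  have finS: "finite S" by (rule finite_subset[OF S(1) finite_E])
  have "card (E - S) = 1" using S finS by (simp add: card_Diff_subset)
  then obtain e where e: "E - S = {e}" by (auto simp: card_1_singleton_iff)
  obtain p q where pq: "e = {p, q}" using E_doubleton e by blast
  have eE: "{p, q} \<in> E" "{p, q} \<notin> S" and E_eq: "E = insert {p, q} S" using e S(1) unfolding pq by blast+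
  have p_ne: "p \<noteq> q" by (rule E_ne[OF eE(1)])
  have pqV: "p \<in> V" "q \<in> V" using eE(1) E_subset unfolding nsets_def by auto
  obtain CC where C: "copies A U CC"
    and plain: "\<And>X. X \<in> CC \<Longrightarrow> \<not> advanced S A X"
    and cross: "\<And>X Y. X \<in> CC \<Longrightarrow> Y \<in> CC \<Longrightarrow> X \<noteq> Y \<Longrightarrow> role ` X \<inter> role ` Y = {} \<Longrightarrow> cross X Y \<subseteq> U"
    and enough: "\<And>v. v \<in> V \<Longrightarrow> required S v \<le> real (card {X\<in>CC. role ` X = part S v})"
    and U: "U \<subseteq> complete_edges n" "A \<inter> U = {}" "card U mod (b + 1) = \<rho>"
    using st unfolding state_def by auto
  have finCC: "finite CC" by (rule copies_finite[OF C])
  have finU: "finite U" using finite_subset[OF U(1)] by simp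
  have S_part: "f \<subseteq> part S v" if f: "f \<in> S" "f \<inter> part S v \<noteq> {}" for f v
  proof -
    obtain x y where xy: "f = {x, y}" using E_doubleton f(1) S(1) by blast
    have "y \<in> part S x" "x \<in> part S y"
      using f(1) reach_edge[of x y S] reach_edge[of y x S] unfolding part_def xy by (simp_all add: insert_commute)
    then have "part S x = part S y" using part_eq[of y S x] by simp
    moreover have "x \<in> part S v \<or> y \<in> part S v" using f(2) unfolding xy by blast
    ultimately have "part S x = part S v" "part S y = part S v"
      using part_eq[of x S v] part_eq[of y S v] by auto
    then have "x \<in> part S v" "y \<in> part S v" using self_in_part[of x S] self_in_part[of y S] by simp_all
    then show ?thesis unfolding xy by simp
  qed
  have pat: "pattern A X = induced S (role ` X)" if "X \<in> CC" for X
    using plain[OF that] unfolding advanced_def by simp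
  let ?C = "\<lambda>v. {X\<in>CC. role ` X = part S v}"
  note req = required_ge[OF SE, of 1, simplified, OF S(2)[THEN eq_refl, simplified]]
  have N: "\<mu> * \<eta> ^ part_weight S v \<le> real (card (?C v))" "4 \<le> real (card (?C v))" if "v \<in> V" for v
    using req[of v] enough[OF that] by linarith+
  have threats_win: "wins A U"
    if R: "R \<subseteq> U" "\<rho> \<le> card R" and copy: "\<And>f. f \<in> R \<Longrightarrow> contains_copy {..<n} (insert f A) V E" for R
  proof (rule enforcer_pos_threats[OF contains_copy_mono finU R(1)])
    show "0 < card U mod (b + 1)" "card U mod (b + 1) \<le> card R" using U(3) rho(1) R(2) by simp_all
  qed (use copy in simp_all)
  show ?thesis
  proof (cases "part S p = part S q")
    case True
    \<comment> \<open>The last edge closes the cycle inside one part, which is then all of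
      \<open>V\<close>: each of its copies lacks just this edge.\<close>
    have "part E p \<subseteq> part S p"
    proof (rule part_closed)
      fix f assume f: "f \<in> E" "f \<inter> part S p \<noteq> {}"
      show "f \<subseteq> part S p"
      proof (cases "f \<in> S")
        case False
        then have "f = {p, q}" using f(1) E_eq by blast
        then show ?thesis using self_in_part[of p S] self_in_part[of q S] True by simp
      qed (rule S_part[OF _ f(2)])
    qed simp
    then have V: "part S p = V" using part_E[OF pqV(1)] part_subset[of S V p] pqV(1) S(1) E_subset by blast
    have ind: "induced S V = S" using S(1) E_subset unfolding induced_def nsets_def by blast
    have "q \<in> part S p" using True by simp
    then have "(p, q) \<in> reach S" unfolding part_def by simp
    then have "\<exists>C. is_cycle (insert {p, q} S) C \<and> {p, q} \<in> C" by (rule cycle_through_edge[OF _ p_ne eE(2)])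
    then have "has_cycle E" unfolding has_cycle_def E_eq by blast
    then have "real \<rho> \<le> \<mu> * \<eta> ^ weight (card E) S" using threats SE by blast
    also have "\<dots> = \<mu> * \<eta> ^ part_weight S p" unfolding part_weight_def V ind ..
    also have "\<dots> \<le> real (card (?C p))" by (rule N(1)[OF pqV(1)])
    finally have rhoN: "\<rho> \<le> card (?C p)" by simp
    let ?Q = "\<lambda>X f. f \<in> realized X \<and> role ` f = {p, q}"
    let ?R = "{f\<in>U. \<exists>X\<in>?C p. ?Q X f}"
    have "card (?C p) \<le> card ?R"
    proof (rule card_le_if_distinct_witnesses[where Q = ?Q])
      show "finite ?R" using finU by simp
    next
      fix X assume "X \<in> ?C p"
      then have X: "X \<in> CC" "role ` X = V" unfolding V by blast+
      then obtain x y where xy: "x \<in> X" "y \<in> X" "role x = p" "role y = q" using pqV by (metis imageE)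
      then have "x \<noteq> y" using p_ne by blast
      then have f: "?Q X {x, y}" using xy eE(1) by (simp add: realized_def)
      have "{x, y} \<notin> A"
      proof
        assume "{x, y} \<in> A"
        then have "role ` {x, y} \<in> pattern A X" using f unfolding pattern_def by blast
        then show False using pat[OF X(1)] f eE(2) unfolding induced_def by simp
      qed
      then have "{x, y} \<in> U" using f copiesD(4)[OF C X(1)] by blast
      then show "\<exists>r\<in>?R. ?Q X r" using f X V by blast
    next
      fix X Y f assume X: "X \<in> ?C p" and Y: "Y \<in> ?C p" and f: "?Q X f" "?Q Y f"
      then have "f \<subseteq> X" "f \<noteq> {}" "f \<subseteq> Y" using realizedD by blast+
      then obtain x where "x \<in> X" "x \<in> Y" by blast
      moreover have "X \<in> CC" "Y \<in> CC" using X Y by simp_all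
      ultimately show "X = Y" using copies_disjoint[OF C] by blast
    qed
    then show ?thesis
    proof (intro threats_win[of ?R])
      fix f assume "f \<in> ?R"
      then obtain X where "X \<in> ?C p" and f: "?Q X f" by blast
      then have X: "X \<in> CC" "role ` X = V" using V by blast+
      show "contains_copy {..<n} (insert f A) V E"
      proof (rule copy_if_pattern[OF copiesD(1,3)[OF C X(1)] X(2)])
        have "S \<subseteq> pattern (insert f A) X"
          using pat[OF X(1)] ind X(2) unfolding pattern_def by blast
        moreover have "{p, q} \<in> pattern (insert f A) X" using f unfolding pattern_def by blast
        ultimately show "E \<subseteq> pattern (insert f A) X" using E_eq by blast
      qed
    qed (use rhoN in auto)
  next
    case False
    have disj: "part S p \<inter> part S q = {}" by (rule part_disjoint[OF False])
    \<comment> \<open>The last edge joins two parts that make up \<open>V\<close>, so every pair of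
      their copies is one edge short.\<close>
    have "part E p \<subseteq> part S p \<union> part S q"
    proof (rule part_closed)
      fix f assume f: "f \<in> E" "f \<inter> (part S p \<union> part S q) \<noteq> {}"
      show "f \<subseteq> part S p \<union> part S q"
      proof (cases "f \<in> S")
        case True
        then show ?thesis using S_part[OF True, of p] S_part[OF True, of q] f(2) by blast
      next
        case False
        then have "f = {p, q}" using f(1) E_eq by blast
        then show ?thesis using self_in_part[of p S] self_in_part[of q S] by simp
      qed
    qed simp
    moreover have "part S p \<subseteq> V" "part S q \<subseteq> V" using part_subset[of S V] pqV S(1) E_subset by blast+
    ultimately have V: "part S p \<union> part S q = V" using part_E[OF pqV(1)] by blast
    let ?Q = "\<lambda>(X, Y) f. f \<in> cross X Y \<and> role ` f = {p, q}"
    let ?R = "{f\<in>U. \<exists>i\<in>?C p \<times> ?C q. ?Q i f}"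
    have memb: "X \<in> CC \<and> Y \<in> CC \<and> X \<noteq> Y \<and> role ` X = part S p \<and> role ` Y = part S q \<and>
        role ` X \<inter> role ` Y = {}" if "(X, Y) \<in> ?C p \<times> ?C q" for X Y
      using that disj False by auto
    have "card (?C p \<times> ?C q) \<le> card ?R"
    proof (rule card_le_if_distinct_witnesses[where Q = ?Q])
      show "finite ?R" using finU by simp
    next
      fix i assume i: "i \<in> ?C p \<times> ?C q"
      obtain X Y where XY: "i = (X, Y)" by (cases i)
      note m = memb[OF i[unfolded XY]]
      have "p \<in> role ` X" "q \<in> role ` Y" using m by simp_all
      then obtain x y where xy: "x \<in> X" "y \<in> Y" "p = role x" "q = role y" by blast
      then have f: "?Q i {x, y}" using eE(1) unfolding XY cross_def by auto
      have "{x, y} \<in> U" using f cross[of X Y] m unfolding XY by auto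
      moreover have "\<exists>i\<in>?C p \<times> ?C q. ?Q i {x, y}" using f i by (rule bexI[where x = i])
      ultimately have "{x, y} \<in> ?R" by simp
      with f show "\<exists>r\<in>?R. ?Q i r" by (rule bexI[where x = "{x, y}"])
    next
      fix i j f assume i: "i \<in> ?C p \<times> ?C q" and j: "j \<in> ?C p \<times> ?C q" and f: "?Q i f" "?Q j f"
      obtain X Y X' Y' where XY: "i = (X, Y)" "j = (X', Y')" by (cases i, cases j)
      note m = memb[OF i[unfolded XY]] and m' = memb[OF j[unfolded XY]]
      have "X = X' \<and> Y = Y' \<or> X = Y' \<and> Y = X'"
        using cross_unique[OF C, of X Y X' Y' f] m m' f unfolding XY by simp
      moreover have "X \<noteq> Y'" using m m' False by auto
      ultimately show "i = j" unfolding XY by simp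
    qed
    moreover have "\<rho> \<le> card (?C p \<times> ?C q)"
    proof -
      have "real \<rho> \<le> real (card (?C p)) * real (card (?C q))"
        using threats
      proof
        \<comment> \<open>Without a cycle the two weights add up to at most \<open>card S\<close>.
          The product of the class sizes is therefore at least \<open>4 * \<mu>\<close>, even where
          the single classes are small.\<close>
        assume acyclic: "\<not> has_cycle E \<and> real \<rho> \<le> \<mu>"
        have no: "\<not> has_cycle T" if "T \<subseteq> S" for T
          using acyclic has_cycle_mono[of T E] that S(1) by blast
        have w: "part_weight S v = card (induced S (part S v))" for v
          using no[of "induced S (part S v)"] unfolding part_weight_def weight_def induced_def by auto
        have ne: "f \<noteq> {}" if "f \<in> S" for f using that S(1) E_subset unfolding nsets_def by force
        have "induced S (part S p) \<inter> induced S (part S q) = {}"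
          using disj ne unfolding induced_def by blast
        then have "part_weight S p + part_weight S q = card (induced S (part S p) \<union> induced S (part S q))"
          unfolding w using finS by (intro card_Un_disjoint[symmetric]) (simp_all add: induced_def)
        also have "\<dots> \<le> card S" by (rule card_mono[OF finS]) (auto simp: induced_def)
        finally have "\<eta> ^ card S \<le> \<eta> ^ (part_weight S p + part_weight S q)"
          using eta_pos eta_le_1 by (intro power_decreasing) auto
        moreover have "4 \<le> \<mu> * \<eta> ^ card S" using feasible[OF SE] no[of S] unfolding weight_def by simp
        ultimately have "4 \<le> \<mu> * \<eta> ^ (part_weight S p + part_weight S q)"
          using mu_pos mult_left_mono[of "\<eta> ^ card S" "\<eta> ^ (part_weight S p + part_weight S q)" \<mu>] by linarith
        then have "\<mu> * 4 \<le> \<mu> * (\<mu> * \<eta> ^ (part_weight S p + part_weight S q))"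
          using mu_pos by (intro mult_left_mono) auto
        also have "\<dots> = (\<mu> * \<eta> ^ part_weight S p) * (\<mu> * \<eta> ^ part_weight S q)" by (simp add: power_add)
        also have "\<dots> \<le> real (card (?C p)) * real (card (?C q))"
          using N(1)[OF pqV(1)] N(1)[OF pqV(2)] mu_pos eta_pos by (intro mult_mono) auto
        finally show ?thesis using acyclic mu_pos by linarith
      next
        \<comment> \<open>The class of \<open>p\<close> alone has at least \<open>\<rho>\<close>
          copies, and the other class is nonempty.\<close>
        assume threat: "even b \<and> (\<forall>P. P \<subset> E \<longrightarrow> real \<rho> \<le> \<mu> * \<eta> ^ weight (card E) P)"
        have "real \<rho> \<le> \<mu> * \<eta> ^ part_weight S p"
          unfolding part_weight_def
          by (rule threat[THEN conjunct2, rule_format, OF induced_psubset[OF SE]])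
        then have "real \<rho> * 1 \<le> real (card (?C p)) * real (card (?C q))"
          using N(1)[OF pqV(1)] N(2)[OF pqV(2)] by (intro mult_mono) linarith+
        then show ?thesis by simp
      qed
      then show ?thesis by (simp add: card_cartesian_product flip: of_nat_mult)
    qed
    ultimately show ?thesis
    proof (intro threats_win[of ?R])
      fix f assume "f \<in> ?R"
      then obtain X Y where XY: "(X, Y) \<in> ?C p \<times> ?C q" and f: "f \<in> cross X Y" "role ` f = {p, q}" by auto
      note m = memb[OF XY]
      have XC: "X \<in> CC" and YC: "Y \<in> CC" using m by blast+
      have XY_disj: "X \<inter> Y = {}" using m copies_disjoint[OF C XC YC] by blast
      have real: "realized (X \<union> Y) = realized X \<union> realized Y \<union> cross X Y" by (rule realized_Un[OF XY_disj])
      show "contains_copy {..<n} (insert f A) V E"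
      proof (rule copy_if_pattern)
        show "X \<union> Y \<subseteq> {..<n}" using copiesD(1)[OF C] XC YC by blast
        show "inj_on role (X \<union> Y)"
          using copiesD(3)[OF C XC] copiesD(3)[OF C YC] m by (auto simp: inj_on_Un)
        show "role ` (X \<union> Y) = V" using m V by (simp add: image_Un)
        have "{p, q} \<in> pattern (insert f A) (X \<union> Y)" using f unfolding pattern_def real by blast
        moreover have "g \<in> pattern (insert f A) (X \<union> Y)" if g: "g \<in> S" for g
        proof -
          have "g \<subseteq> V" "g \<noteq> {}" using g S(1) E_subset unfolding nsets_def by force+
          then have "g \<subseteq> part S p \<or> g \<subseteq> part S q"
            using S_part[OF g, of p] S_part[OF g, of q] V by blast
          then have "g \<in> pattern A X \<or> g \<in> pattern A Y"
            using pat[OF XC] pat[OF YC] m g unfolding induced_def by simp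
          then show ?thesis unfolding pattern_def real by blast
        qed
        ultimately show "E \<subseteq> pattern (insert f A) (X \<union> Y)" using E_eq by blast
      qed
    qed auto
  qed
qed

text \<open>Induction on the number of missing edges. A phase may add several edges at once, even
  all of them; then a copy is already present.\<close>

lemma state_wins:
  assumes "state S A U" "S \<subseteq> E"
  shows "wins A U"
  using assms
proof (induction "card E - card S" arbitrary: S A U rule: less_induct)
  case less
  have le: "card S \<le> card E" by (rule card_mono[OF finite_E less.prems(2)])
  consider "card S + 2 \<le> card E" | "card S + 1 = card E" | "card S = card E" using le by linarith
  then show ?case
  proof cases
    case 1
    show ?thesis
    proof (rule start_phase[OF less.prems 1])
      fix S' A U assume S': "S \<subset> S'" "S' \<subseteq> E" "state S' A U"
      have "card S < card S'" using psubset_card_mono[OF finite_subset[OF S'(2) finite_E] S'(1)] .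
      then show "wins A U" using S' 1 by (intro less.hyps[of S']) auto
    qed
  next
    case 2
    then show ?thesis by (rule terminal[OF less.prems])
  next
    case 3
    then have S: "S = E" using card_subset_eq[OF finite_E less.prems(2)] by simp
    obtain v where v: "v \<in> V" using V_nonempty by blast
    obtain CC where C: "copies A U CC" and plain: "\<And>X. X \<in> CC \<Longrightarrow> \<not> advanced E A X"
      and enough: "\<And>v. v \<in> V \<Longrightarrow> required E v \<le> real (card {X\<in>CC. role ` X = part E v})"
      and U: "U \<subseteq> complete_edges n"
      using less.prems(1) unfolding state_def S by auto
    have "0 < required E v" unfolding required_def using mu_pos eta_pos by simp
    then have "{X\<in>CC. role ` X = part E v} \<noteq> {}" using enough[OF v] by fastforce
    then obtain X where X: "X \<in> CC" "role ` X = V" using part_E[OF v] by auto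
    have "induced E V = E" using E_subset unfolding induced_def nsets_def by blast
    then have "E \<subseteq> pattern A X" using plain[OF X(1)] X(2) unfolding advanced_def by simp
    then have "contains_copy {..<n} A V E" by (rule copy_if_pattern[OF copiesD(1,3)[OF C X(1)] X(2)])
    then show ?thesis by (rule wins_if_copy[OF _ U])
  qed
qed

text \<open>Without edges the parts are single vertices and every board vertex is a copy of its
  role, so \<open>classes\<close> is exactly the demand.\<close>

lemma initial_state: "state {} {} (complete_edges n)"
proof -
  let ?C = "(\<lambda>x. {x}) ` {..<n}"
  have realized: "realized {x} = {}" for x
  proof -
    have "nsets {x} 2 = {}" by (rule nsets_eq_empty) simp_all
    then show ?thesis unfolding realized_def by simp
  qed
  have pattern: "pattern {} X = {}" for X unfolding pattern_def by simp
  have h1: "copies {} (complete_edges n) ?C"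
    unfolding copies_def
  proof (intro conjI ballI)
    show "disjoint ?C" unfolding disjoint_def by auto
    fix X assume "X \<in> ?C"
    then obtain x where x: "X = {x}" "x < n" by auto
    show "X \<subseteq> {..<n}" "X \<noteq> {}" "inj_on role X" "realized X \<subseteq> {} \<union> complete_edges n"
      using x realized by simp_all
    show "connected_by (pattern {} X) (role ` X)" unfolding x(1) connected_by_def by simp
  qed
  have h2: "(\<exists>v\<in>V. role ` X = part {} v) \<and> \<not> advanced {} {} X" if X: "X \<in> ?C" for X
  proof -
    obtain x where x: "X = {x}" "x < n" using X by auto
    have "role ` X = part {} (role x)" unfolding x(1) by simp
    then show ?thesis using role_in[OF x(2)] pattern unfolding advanced_def induced_def by blast
  qed
  have h3: "cross X Y \<subseteq> complete_edges n"
    if XY: "X \<in> ?C" "Y \<in> ?C" for X Y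
  proof
    fix e assume "e \<in> cross X Y"
    then obtain x y where e: "e = {x, y}" "x \<in> X" "y \<in> Y" "{role x, role y} \<in> E" by (rule crossE)
    have "x < n" "y < n" using e(2,3) XY by auto
    moreover have "x \<noteq> y" using E_ne[OF e(4)] by blast
    ultimately show "e \<in> complete_edges n" unfolding e(1) by simp
  qed
  have h4: "required {} v \<le> real (card {X\<in>?C. role ` X = part {} v})" if v: "v \<in> V" for v
  proof -
    have "\<not> has_cycle ({} :: 'a set set)"
      unfolding has_cycle_def using is_cycle_nonempty unfolding is_cycle_def by blast
    then have "required {} v = 2 ^ card E * \<mu>"
      unfolding required_def part_weight_def weight_def induced_def by simp
    also have "\<dots> \<le> real (card {x \<in> {..<n}. role x = v})" by (rule classes[OF v])
    also have "card {x \<in> {..<n}. role x = v} = card ((\<lambda>x. {x}) ` {x \<in> {..<n}. role x = v})"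
      by (rule card_image[symmetric]) simp
    also have "(\<lambda>x. {x}) ` {x \<in> {..<n}. role x = v} = {X\<in>?C. role ` X = part {} v}" by auto
    finally show ?thesis .
  qed
  show ?thesis
    unfolding state_def
  proof (intro conjI exI[of _ ?C] ballI impI)
    fix X assume "X \<in> ?C"
    from h2[OF this] show "\<exists>v\<in>V. role ` X = part {} v" "\<not> advanced {} {} X"
      by (rule conjunct1, rule conjunct2)
  next
    fix X Y assume "X \<in> ?C" "Y \<in> ?C"
    then show "cross X Y \<subseteq> complete_edges n" by (rule h3)
  qed (use rho(2) h1 h4 in simp_all)
qed

theorem enforcer_wins: "Defs.enforcer_wins V E n b"
  by (rule enforcer_wins_if_enforcer_pos, rule state_wins[OF initial_state]) simp

end

section \<open>Thresholds\<close>

lemma finite_edges_within: "A \<subseteq> complete_edges n \<Longrightarrow> finite {e\<in>A. e \<subseteq> S}"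
  using finite_subset[of A "complete_edges n"] by simp

lemma card_parts_meeting_ge_1:
  assumes P: "partition_on {..<n::nat} PP" and x: "x \<in> S" "x < n"
  shows "1 \<le> card {X\<in>PP. X \<inter> S \<noteq> {}}"
proof -
  have fin: "finite {X\<in>PP. X \<inter> S \<noteq> {}}" using finite_partition_of[OF P] by simp
  obtain X where "X \<in> PP" "x \<in> X" using partition_onD1[OF P] x(2) by blast
  then have "X \<in> {X\<in>PP. X \<inter> S \<noteq> {}}" using x(1) by blast
  then have "{X\<in>PP. X \<inter> S \<noteq> {}} \<noteq> {}" by blast
  then show ?thesis using fin by (simp add: Suc_le_eq card_gt_0_iff)
qed

text \<open>A copy is connected and thus lies in one part, where the forest inequality allows fewer
  edges than vertices, hence fewer than \<open>card E\<close>.\<close>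

lemma no_copy_if_small_parts:
  assumes A: "A \<subseteq> complete_edges n" and F: "forest_partition n A PP"
    and small: "\<And>X. X \<in> PP \<Longrightarrow> card X \<le> card E" and conn: "connected_graph V E"
  shows "\<not> contains_copy {..<n} A V E"
proof
  assume "contains_copy {..<n} A V E"
  then obtain f where f: "inj_on f V" "f ` V \<subseteq> {..<n}" "\<And>e. e \<in> E \<Longrightarrow> f ` e \<in> A"
    unfolding contains_copy_def by blast
  have V: "V \<noteq> {}" "E \<subseteq> nsets V 2" and reach: "\<And>u v. u \<in> V \<Longrightarrow> v \<in> V \<Longrightarrow> (u, v) \<in> reach E"
    using conn unfolding connected_graph_def simple_graph_def by simp_all
  have P: "partition_on {..<n} PP" using F unfolding forest_partition_def by simp
  obtain v where v: "v \<in> V" using V(1) by blast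
  have fv: "f v < n" using f(2) v by auto
  obtain X where X: "X \<in> PP" "f v \<in> X" using partition_onD1[OF P] fv by blast
  have "f u \<in> X" if "(v, u) \<in> reach E" for u
    using that
  proof (induction rule: rtrancl_induct)
    case (step y z)
    then have "f ` {y, z} \<in> A" using f(3)[of "{y, z}"] by simp
    then obtain Z where Z: "Z \<in> PP" "f ` {y, z} \<subseteq> Z" using F unfolding forest_partition_def by blast
    then have "Z = X" using partition_disjoint[OF P Z(1) X(1)] step.IH by auto
    then show ?case using Z(2) by simp
  qed (rule X(2))
  then have sub: "f ` V \<subseteq> X" using reach[OF v] by blast
  have inj: "inj_on ((`) f) E"
    by (rule inj_on_subset[OF inj_on_image_Pow[OF f(1)]]) (use V(2) in \<open>auto simp: nsets_def\<close>)
  have "(`) f ` E \<subseteq> {e\<in>A. e \<subseteq> X}"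
  proof
    fix e assume "e \<in> (`) f ` E"
    then obtain g where g: "g \<in> E" "e = f ` g" by blast
    then have "g \<subseteq> V" using V(2) unfolding nsets_def by blast
    then show "e \<in> {e\<in>A. e \<subseteq> X}" using f(3)[OF g(1)] g(2) sub by blast
  qed
  then have "card ((`) f ` E) \<le> card {e\<in>A. e \<subseteq> X}" by (rule card_mono[OF finite_edges_within[OF A]])
  then have "card E \<le> card {e\<in>A. e \<subseteq> X}" using card_image[OF inj] by simp
  moreover have "1 \<le> card {Y\<in>PP. Y \<inter> X \<noteq> {}}" by (rule card_parts_meeting_ge_1[OF P X(2) fv])
  moreover have "X \<subseteq> {..<n}" using partition_onD1[OF P] X(1) by blast
  then have "card {e\<in>A. e \<subseteq> X} + card {Y\<in>PP. Y \<inter> X \<noteq> {}} \<le> card X"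
    using F unfolding forest_partition_def by simp
  ultimately show False using small[OF X(1)] by linarith
qed

text \<open>With two vertices both steps would traverse the same edge; from length three on,
  different steps give different edges.\<close>

lemma card_cyclic_edges:
  assumes "distinct vs" "3 \<le> length vs"
  shows "card (cyclic_edges vs) = length vs"
proof -
  let ?g = "\<lambda>i. {vs ! i, vs ! (Suc i mod length vs)}"
  have "inj_on ?g {..<length vs}"
  proof (rule inj_onI)
    fix i j assume ij: "i \<in> {..<length vs}" "j \<in> {..<length vs}" "?g i = ?g j"
    have s: "Suc k mod length vs = (if Suc k = length vs then 0 else Suc k)" if "k < length vs" for k
      using that by simp
    have lt: "Suc i mod length vs < length vs" "Suc j mod length vs < length vs"
      using assms(2) by (auto intro!: mod_less_divisor)
    have "vs ! i = vs ! j \<or> vs ! i = vs ! (Suc j mod length vs) \<and> vs ! (Suc i mod length vs) = vs ! j"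
      using ij(3) unfolding doubleton_eq_iff by blast
    then have "i = j \<or> i = Suc j mod length vs \<and> Suc i mod length vs = j"
      using nth_eq_iff_index_eq[OF assms(1)] ij(1,2) lt by simp
    then show "i = j" using s[of i] s[of j] ij(1,2) assms(2) by (auto split: if_splits)
  qed
  moreover have "cyclic_edges vs = ?g ` {..<length vs}" unfolding cyclic_edges_def by blast
  ultimately show ?thesis by (simp add: card_image)
qed

text \<open>The image of a cycle has as many edges as vertices, while the forest inequality on its
  vertex set, which meets at least one part, leaves fewer.\<close>

lemma no_copy_if_cycle:
  assumes A: "A \<subseteq> complete_edges n" and F: "forest_partition n A PP"
    and cyc: "has_cycle E" and V: "E \<subseteq> nsets V 2"
  shows "\<not> contains_copy {..<n} A V E"
proof
  assume "contains_copy {..<n} A V E"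
  then obtain f where f: "inj_on f V" "f ` V \<subseteq> {..<n}" "\<And>e. e \<in> E \<Longrightarrow> f ` e \<in> A"
    unfolding contains_copy_def by blast
  have P: "partition_on {..<n} PP" using F unfolding forest_partition_def by simp
  obtain vs where vs: "distinct vs" "3 \<le> length vs" "cyclic_edges vs \<subseteq> E"
    using cyc unfolding has_cycle_def is_cycle_def by blast
  let ?S = "f ` set vs"
  have vs_V: "set vs \<subseteq> V"
  proof
    fix v assume "v \<in> set vs"
    then obtain i where "i < length vs" "v = vs ! i" by (metis in_set_conv_nth)
    then have "{v, vs ! (Suc i mod length vs)} \<in> E" using vs(3) unfolding cyclic_edges_def by blast
    then show "v \<in> V" using V unfolding nsets_def by blast
  qed
  have edge: "e \<subseteq> set vs" if e: "e \<in> cyclic_edges vs" for e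
  proof -
    obtain i where "i < length vs" "e = {vs ! i, vs ! (Suc i mod length vs)}"
      using e unfolding cyclic_edges_def by auto
    moreover have "Suc i mod length vs < length vs" using vs(2) by (intro mod_less_divisor) linarith
    ultimately show ?thesis by simp
  qed
  have "inj_on ((`) f) (cyclic_edges vs)"
    by (rule inj_on_subset[OF inj_on_image_Pow[OF f(1)]]) (use edge vs_V in blast)
  then have "length vs = card ((`) f ` cyclic_edges vs)"
    using card_cyclic_edges[OF vs(1,2)] by (simp add: card_image)
  also have "\<dots> \<le> card {e\<in>A. e \<subseteq> ?S}"
  proof (rule card_mono[OF finite_edges_within[OF A]])
    show "(`) f ` cyclic_edges vs \<subseteq> {e\<in>A. e \<subseteq> ?S}" using f(3) vs(3) edge by blast
  qed
  finally have "length vs \<le> card {e\<in>A. e \<subseteq> ?S}" .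
  moreover have "vs ! 0 \<in> set vs" using vs(2) by (intro nth_mem) linarith
  then have "1 \<le> card {X\<in>PP. X \<inter> ?S \<noteq> {}}"
    using card_parts_meeting_ge_1[OF P, of "f (vs ! 0)" ?S] f(2) vs_V by auto
  moreover have "?S \<subseteq> {..<n}" using f(2) vs_V by blast
  then have "card {e\<in>A. e \<subseteq> ?S} + card {X\<in>PP. X \<inter> ?S \<noteq> {}} \<le> card ?S"
    using F unfolding forest_partition_def by simp
  moreover have "card ?S \<le> length vs" using card_image_le[of "set vs" f] card_length[of vs] by simp
  ultimately show False by linarith
qed

lemma lower_threshold_le:
  assumes "1 \<le> b" "\<not> enforcer_wins V E n b"
  shows "lower_threshold V E n \<le> b"
proof -
  let ?P = "\<lambda>k. \<forall>b. 1 \<le> b \<and> b \<le> k \<longrightarrow> enforcer_wins V E n b"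
  have "?P (GREATEST k. ?P k)"
  proof (rule GreatestI_nat[of ?P 0 b])
    show "\<And>k. ?P k \<Longrightarrow> k \<le> b" using assms by (meson nat_le_linear)
  qed simp
  then have "\<not> b \<le> (GREATEST k. ?P k)" using assms by blast
  then show ?thesis unfolding lower_threshold_def by simp
qed

text \<open>With a larger bias the first reply takes all other edges. Avoider then owns one edge, to
  which an injective map cannot send two. This bound makes the \<open>GREATEST\<close> in the upper
  threshold meaningful.\<close>

lemma enforcer_wins_bound:
  assumes win: "enforcer_wins V E n b" and E: "2 \<le> card E" "E \<subseteq> Pow V"
    and n: "2 \<le> n"
  shows "b \<le> card (complete_edges n)"
proof (rule ccontr)
  assume b: "\<not> ?thesis"
  obtain \<sigma> where \<sigma>: "legal_strategy n b \<sigma>"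
    and copy: "\<And>h. legal_history n b h \<Longrightarrow> unclaimed n h = {} \<Longrightarrow> follows \<sigma> h \<Longrightarrow>
       contains_copy {..<n} (avoider_edges h) V E"
    using win unfolding enforcer_wins_def by blast
  define a where "a = {0, 1 :: nat}"
  have a: "a \<in> unclaimed n []" using n unfolding a_def by simp
  let ?h = "[] @ [(a, \<sigma> [] a)]"
  have reply: "legal_reply n b [] a (\<sigma> [] a)"
    using \<sigma> a legal_history.start unfolding legal_strategy_def by blast
  have "card (unclaimed n [] - {a}) \<le> card (complete_edges n)" by (intro card_mono) auto
  then have "card (\<sigma> [] a) = card (unclaimed n [] - {a})"
    using reply b unfolding legal_reply_def by simp
  then have all: "\<sigma> [] a = unclaimed n [] - {a}"
    using reply card_subset_eq[of "unclaimed n [] - {a}" "\<sigma> [] a"] unfolding legal_reply_def by simp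
  have "contains_copy {..<n} (avoider_edges ?h) V E"
  proof (rule copy)
    show "legal_history n b ?h" by (rule legal_history.round[OF legal_history.start a reply])
    show "unclaimed n ?h = {}" unfolding unclaimed_snoc all by blast
    show "follows \<sigma> ?h" unfolding follows_snoc by (simp add: follows_def)
  qed
  then obtain f where f: "inj_on f V" "\<And>e. e \<in> E \<Longrightarrow> f ` e = a"
    unfolding contains_copy_def avoider_edges_snoc by auto
  have "inj_on ((`) f) E" by (rule inj_on_subset[OF inj_on_image_Pow[OF f(1)] E(2)])
  then have "card E = card ((`) f ` E)" by (simp add: card_image)
  also have "\<dots> \<le> card {a}" by (intro card_mono) (use f(2) in auto)
  finally show False using E(1) by simp
qed

lemma le_upper_threshold:
  assumes win: "enforcer_wins V E n b" and E: "2 \<le> card E" "E \<subseteq> Pow V" and n: "2 \<le> n"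
  shows "b \<le> upper_threshold V E n"
  unfolding upper_threshold_def
proof (rule Greatest_le_nat[where b = "card (complete_edges n)"])
  show "b = 0 \<or> enforcer_wins V E n b" using win by simp
  show "\<And>y. y = 0 \<or> enforcer_wins V E n y \<Longrightarrow> y \<le> card (complete_edges n)"
    using enforcer_wins_bound[OF _ E n] by auto
qed

subsection \<open>Biases with prescribed remainders\<close>

lemma two_choose_two: "2 * (n choose 2) = n * (n - 1)"
proof -
  have "even (n * (n - 1))" by (cases n) auto
  then show ?thesis unfolding choose_two by simp
qed

text \<open>Here \<open>d\<close> stands for \<open>b + 1\<close>. Dividing
  \<open>n * (n - 1)\<close> by an odd number gives \<open>n choose 2 = q * d + r\<close> with
  \<open>2 * r = d + s\<close>, where \<open>s\<close> is the remainder of that division; so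
  \<open>r\<close> is at least half of \<open>d\<close>.\<close>

lemma remainder_large:
  assumes d: "d = (n * (n - 1)) div (2 * q + 1)" and "2 * q + 1 \<le> d"
  shows "d \<le> 2 * ((n choose 2) mod d)"
proof -
  let ?s = "(n * (n - 1)) mod (2 * q + 1)"
  have s: "?s < d" using assms(2) mod_less_divisor[of "2 * q + 1" "n * (n - 1)"] by linarith
  have "2 * (n choose 2) = (2 * q + 1) * d + ?s"
    unfolding two_choose_two d by (metis mult_div_mod_eq)
  then have eq: "2 * (n choose 2) = 2 * (q * d) + (d + ?s)" by (simp add: algebra_simps)
  then have "even (d + ?s)" by (metis dvd_triv_left dvd_add_right_iff)
  then obtain r where r: "d + ?s = 2 * r" by (rule evenE)
  then have "n choose 2 = q * d + r" "r < d" using eq s by linarith+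
  then have "(n choose 2) mod d = r" by simp
  then show ?thesis using r by linarith
qed

text \<open>Subtracting 1 before dividing shifts the remainder from the range 0 to
  \<open>q - 1\<close> to the range 1 to \<open>q\<close>, which excludes 0.\<close>

lemma remainder_small:
  fixes N d q :: nat
  assumes d: "d = (N - 1) div q" and "1 \<le> N" "1 \<le> q" "q < d"
  shows "1 \<le> N mod d" "N mod d \<le> q"
proof -
  let ?s = "(N - 1) mod q"
  have s: "?s < q" using assms(3) by (intro mod_less_divisor) linarith
  have "N - 1 = q * d + ?s" unfolding d by simp
  then have "N = q * d + (?s + 1)" using assms(2) by linarith
  moreover have "?s + 1 < d" using s assms(4) by linarith
  ultimately have "N mod d = ?s + 1" using mod_mult_self3[of q d "?s + 1"] by (simp only: mod_less)
  then show "1 \<le> N mod d" "N mod d \<le> q" using s by simp_all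
qed

text \<open>Write \<open>n = q t + s\<close> with \<open>t = 2 (2 j + 1)\<close> and \<open>2 \<le> s \<le> t + 1\<close>; then \<open>q\<close> times
  \<open>(2 j + 1) (n + s - 1)\<close> misses \<open>n choose 2\<close> by just \<open>s choose 2\<close>.\<close>

lemma remainder_tiny:
  assumes t: "t = 2 * (2 * j + 1)" and n: "t + 2 \<le> n"
  obtains d where "odd d" "(2 * j + 1) * n \<le> d" "d \<le> (2 * j + 1) * (2 * n)"
    "1 \<le> (n choose 2) mod d" "(n choose 2) mod d \<le> t * t"
proof -
  define q where "q = (n - 2) div t"
  \<comment> \<open>The shift by 2 keeps \<open>s\<close> at least 2, so that the remainder
    \<open>s choose 2\<close> is positive.\<close>
  define s where "s = 2 + (n - 2) mod t"
  define d where "d = (2 * j + 1) * (q * t + 2 * s - 1)"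
  have t0: "2 \<le> t" unfolding t by simp
  have s: "2 \<le> s" "s \<le> t + 1"
    using mod_less_divisor[of t "n - 2"] t0 unfolding s_def by linarith+
  have n_eq: "n = q * t + s" using n div_mult_mod_eq[of "n - 2" t] unfolding q_def s_def by linarith
  have q1: "1 \<le> q" using n t0 unfolding q_def by (simp add: Suc_le_eq div_greater_zero_iff)
  have "q * t + 2 * s - 1 = n + (s - 1)" using n_eq s(1) by linarith
  then have d_alt: "d = (2 * j + 1) * (n + (s - 1))" unfolding d_def by (simp only:)
  have r_small: "s choose 2 < d \<and> 1 \<le> s choose 2 \<and> s choose 2 \<le> t * t"
  proof -
    have 2: "2 * (s choose 2) \<le> (t + 1) * t"
      unfolding two_choose_two using s by (intro mult_mono) auto
    also have "\<dots> = 2 * ((2 * j + 1) * (t + 1))" unfolding t by simp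
    finally have "s choose 2 \<le> (2 * j + 1) * (t + 1)" by linarith
    also have "\<dots> < d" unfolding d_alt using n by (intro mult_strict_left_mono) auto
    finally have "s choose 2 < d" .
    moreover have "1 \<le> s choose 2" using s(1) by (simp add: Suc_le_eq)
    moreover have "(t + 1) * t \<le> 2 * (t * t)" using t0 by (simp add: algebra_simps)
    then have "s choose 2 \<le> t * t" using 2 by linarith
    ultimately show ?thesis by blast
  qed
  have "2 * (n choose 2) = 2 * (q * d + (s choose 2))"
  proof -
    define u where "u = s - 1"
    have s_eq: "s = u + 1" using s(1) unfolding u_def by simp
    have "2 * (n choose 2) = n * (n - 1)" by (rule two_choose_two)
    also have "\<dots> = (q * t + s) * (q * t + u)" unfolding n_eq s_eq by simp
    also have "\<dots> = q * (t * (q * t + s + u)) + s * u" by (simp add: algebra_simps)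
    also have "t * (q * t + s + u) = 2 * d"
      unfolding d_alt n_eq t u_def[symmetric] by (simp add: algebra_simps)
    also have "s * u = 2 * (s choose 2)" unfolding two_choose_two u_def ..
    finally show ?thesis by (simp add: algebra_simps)
  qed
  then have "n choose 2 = q * d + (s choose 2)" by simp
  then have "(n choose 2) mod d = s choose 2" using r_small by simp
  moreover have "odd d"
  proof -
    \<comment> \<open>This factor is odd because \<open>t\<close> is even. Hence \<open>d\<close> is
      odd and the bias \<open>d - 1\<close> is even, as units of two edges demand.\<close>
    have "q * t + 2 * s - 1 = 2 * (q * (2 * j + 1) + (s - 1)) + 1" unfolding t using s(1) by (simp add: algebra_simps)
    then show ?thesis unfolding d_def by simp
  qed
  moreover have "(2 * j + 1) * n \<le> d" unfolding d_alt by (intro mult_le_mono2) simp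
  moreover have "d \<le> (2 * j + 1) * (2 * n)" unfolding d_alt using s n by (intro mult_le_mono2) simp
  ultimately show ?thesis using that[of d] r_small by simp
qed

section \<open>Asymptotics and the bounds for both thresholds\<close>

lemma eventually_powr_le:
  assumes "\<alpha> < \<beta>"
  shows "\<forall>\<^sub>F n in sequentially. c * real n powr \<alpha> \<le> real n powr \<beta>"
proof -
  have "(\<lambda>n. real n powr \<alpha>) \<in> o(\<lambda>n. real n powr \<beta>)"
    using powr_smallo_iff[of real sequentially \<alpha> \<beta>] filterlim_real_sequentially assms by simp
  then have "\<forall>\<^sub>F n in sequentially. norm (real n powr \<alpha>) \<le> 1 / (\<bar>c\<bar> + 1) * norm (real n powr \<beta>)"
    by (rule landau_o.smallD) simp
  then show ?thesis
  proof eventually_elim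
    case (elim n)
    then have "real n powr \<alpha> * (\<bar>c\<bar> + 1) \<le> real n powr \<beta>"
      by (simp add: field_simps)
    moreover have "c * real n powr \<alpha> \<le> real n powr \<alpha> * (\<bar>c\<bar> + 1)"
      by (subst mult.commute) (intro mult_left_mono, auto)
    ultimately show ?case by linarith
  qed
qed

lemma ratio_power_ge:
  assumes n: "1 \<le> n" and b: "0 < b" "b \<le> C * real n powr (1 + \<delta>)" and C: "0 < C"
  shows "(1 / C) ^ m * real n powr (- (\<delta> * real m)) \<le> (real n / b) ^ m"
proof -
  have x: "0 < real n" using n by simp
  have "real n powr (1 + \<delta>) * real n powr (- \<delta>) = real n powr 1"
    by (simp flip: powr_add)
  then have "(C * real n powr (1 + \<delta>)) * (1 / C * real n powr (- \<delta>)) = real n"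
    using C x by simp
  moreover have "b * (1 / C * real n powr (- \<delta>)) \<le> (C * real n powr (1 + \<delta>)) * (1 / C * real n powr (- \<delta>))"
    using C b by (intro mult_right_mono) auto
  ultimately have "1 / C * real n powr (- \<delta>) \<le> real n / b"
    using b(1) by (simp add: pos_le_divide_eq mult.commute)
  then have "(1 / C * real n powr (- \<delta>)) ^ m \<le> (real n / b) ^ m"
    using C by (intro power_mono) auto
  moreover have "(real n powr (- \<delta>)) ^ m = real n powr (- (\<delta> * real m))"
    using x by (simp add: powr_power mult.commute)
  ultimately show ?thesis unfolding power_mult_distrib by simp
qed

lemma ratio_power_le:
  assumes n: "1 \<le> n" and b: "real n powr (1 + \<delta>) \<le> C * b" "0 < b" and C: "0 < C"
  shows "(real n / b) ^ m \<le> C ^ m * real n powr (- (\<delta> * real m))"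
proof -
  have x: "0 < real n" using n by simp
  have "real n powr (1 + \<delta>) * real n powr (- \<delta>) = real n powr 1"
    by (simp flip: powr_add)
  then have "real n = real n powr (1 + \<delta>) * real n powr (- \<delta>)" using x by simp
  also have "\<dots> \<le> (C * b) * real n powr (- \<delta>)" using b by (intro mult_right_mono) auto
  finally have "real n / b \<le> C * real n powr (- \<delta>)"
    using b(2) by (simp add: pos_divide_le_eq mult_ac)
  then have "(real n / b) ^ m \<le> (C * real n powr (- \<delta>)) ^ m"
    using b(2) by (intro power_mono) auto
  moreover have "(real n powr (- \<delta>)) ^ m = real n powr (- (\<delta> * real m))"
    using x by (simp add: powr_power mult.commute)
  ultimately show ?thesis unfolding power_mult_distrib by simp
qed

lemma ceiling_power_bounds:
  assumes "1 \<le> n" "0 \<le> \<alpha>"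
  shows "1 \<le> real n powr \<alpha>" "real n powr \<alpha> \<le> real (nat \<lceil>real n powr \<alpha>\<rceil>)"
    "real (nat \<lceil>real n powr \<alpha>\<rceil>) \<le> 2 * real n powr \<alpha>"
proof -
  show 1: "1 \<le> real n powr \<alpha>" using assms by (intro ge_one_powr_ge_zero) auto
  then show "real n powr \<alpha> \<le> real (nat \<lceil>real n powr \<alpha>\<rceil>)" "real (nat \<lceil>real n powr \<alpha>\<rceil>) \<le> 2 * real n powr \<alpha>"
    by linarith+
qed

text \<open>With \<open>q\<close> about \<open>n powr (1 - \<delta>)\<close>, the bias from
  \<open>remainder_large\<close> has order \<open>n powr (1 + \<delta>)\<close>. The upper bound on
  \<open>\<delta>\<close> gives the hypothesis \<open>ge1\<close> of Avoider's strategy, and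
  \<open>1 < \<delta> * real L\<close> gives \<open>big\<close>.\<close>

lemma eventually_lower_threshold_le:
  assumes conn: "connected_graph V E" and L: "2 \<le> L" "L = card E \<or> has_cycle E"
    and \<delta>: "1 < \<delta> * real L" "\<delta> * real (L - 1) \<le> 1"
  shows "\<forall>\<^sub>F n in sequentially. real (lower_threshold V E n) \<le> real n powr (1 + \<delta>)"
proof -
  have V: "E \<subseteq> nsets V 2" using conn unfolding connected_graph_def simple_graph_def by simp
  have \<delta>0: "0 < \<delta>" using \<delta>(1) L(1) by (metis less_trans mult_nonpos_nonneg not_le of_nat_0_le_iff zero_less_one)
  have \<delta>1: "\<delta> \<le> 1"
  proof -
    have "\<delta> * 1 \<le> \<delta> * real (L - 1)" using L(1) \<delta>0 by (intro mult_left_mono) auto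
    then show ?thesis using \<delta>(2) by simp
  qed
  let ?K = "avoider_const (L + 1)"
  have exps: "0 < 1 + \<delta>" "1 < 1 + \<delta>" "1 - \<delta> < 1 + \<delta>" "2 - \<delta> * real (L - 1) < 1 + \<delta>"
  proof -
    have "real L = real (L - 1) + 1" using L(1) by simp
    then have "\<delta> * real L = \<delta> * (real (L - 1) + 1)" by (rule arg_cong)
    also have "\<dots> = \<delta> * real (L - 1) + \<delta>" unfolding distrib_left by simp
    finally show "2 - \<delta> * real (L - 1) < 1 + \<delta>" using \<delta>(1) by linarith
  qed (use \<delta>0 in auto)
  \<comment> \<open>The constants are loose: with \<open>y = n powr (1 + \<delta>)\<close>, the bias
    will lie between \<open>y / 20\<close> and \<open>y\<close>, and each of the two terms of
    \<open>big\<close> is at most \<open>y / 40\<close>.\<close>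
  note ev = eventually_powr_le[OF exps(1), of 60] eventually_powr_le[OF exps(2), of "20 + 80 * ?K"]
    eventually_powr_le[OF exps(3), of 100] eventually_powr_le[OF exps(4), of "80 * ?K * 20 ^ (L - 1)"]
    eventually_ge_at_top[of 2]
  show ?thesis
    using ev
  proof eventually_elim
    case (elim n)
    define y where "y = real n powr (1 + \<delta>)"
    define p where "p = real n powr (1 - \<delta>)"
    define q where "q = nat \<lceil>p\<rceil>"
    define d where "d = (n * (n - 1)) div (2 * q + 1)"
    define b where "b = d - 1"
    have n: "2 \<le> n" "1 \<le> n" using elim(5) by simp_all
    have K: "1 \<le> ?K" by (rule avoider_const_ge_1)
    have y60: "60 \<le> y" using elim(1) n unfolding y_def by simp
    have xy: "(20 + 80 * ?K) * real n \<le> y" using elim(2) n unfolding y_def by simp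
    have py: "100 * p \<le> y" using elim(3) unfolding y_def p_def .
    have p: "1 \<le> p" "p \<le> real q" "real q \<le> 2 * p"
      using ceiling_power_bounds[OF n(2), of "1 - \<delta>"] \<delta>1 unfolding p_def q_def by simp_all
    have "p * y = real n powr 2" unfolding p_def y_def by (simp flip: powr_add)
    then have pxy: "p * y = real n * real n" using n by (simp add: power2_eq_square)
    have nn: "real (n * (n - 1)) = real n * (real n - 1)" using n by (simp add: of_nat_diff)
    have d_le: "real d \<le> y"
    proof -
      have "real d \<le> real (n * (n - 1)) / real (2 * q + 1)" unfolding d_def by (rule of_nat_div_le_of_nat)
      also have "\<dots> \<le> (p * y) / p"
        unfolding nn pxy using p n by (intro frac_le mult_left_mono) auto
      finally show ?thesis using p by simp
    qed
    have d_ge: "y / 10 - 1 \<le> real d"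
    proof -
      have "y / 10 = (p * y / 2) / (5 * p)" using p by simp
      also have "\<dots> \<le> real (n * (n - 1)) / real (2 * q + 1)"
      proof (rule frac_le)
        have "real n * (real n / 2) \<le> real n * (real n - 1)" using n by (intro mult_left_mono) auto
        then show "p * y / 2 \<le> real (n * (n - 1))" unfolding nn pxy by simp
      qed (use p in auto)
      also have "\<dots> \<le> real d + 1"
      proof -
        have "n * (n - 1) < (d + 1) * (2 * q + 1)"
          unfolding d_def using dividend_less_div_times[of "2 * q + 1" "n * (n - 1)"] by (simp add: add.commute)
        then have "real (n * (n - 1)) \<le> real ((d + 1) * (2 * q + 1))" by (intro of_nat_mono less_imp_le)
        also have "\<dots> = (real d + 1) * real (2 * q + 1)" unfolding of_nat_mult by simp
        finally have "real (n * (n - 1)) \<le> (real d + 1) * real (2 * q + 1)" .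
        then show ?thesis by (simp add: pos_divide_le_eq)
      qed
      finally show ?thesis by simp
    qed
    have d1: "1 \<le> d" using d_ge y60 by linarith
    have bd: "b + 1 = d" "real b = real d - 1" unfolding b_def using d1 by simp_all
    have b_ge: "y / 20 \<le> real b" using d_ge bd y60 by linarith
    have b_le: "real b \<le> y" using d_le bd by linarith
    have b0: "0 < real b" using b_ge y60 by linarith
    have "0 \<le> 80 * ?K * real n" using K by simp
    then have "20 * real n \<le> y" using xy unfolding distrib_right by linarith
    then have nb: "n \<le> b" using b_ge by linarith
    have "real (2 * q + 1) \<le> real d" using d_ge py p y60 by simp
    then have "2 * q + 1 \<le> d" by (simp only: of_nat_le_iff)
    then have rem: "b + 1 \<le> 2 * ((n choose 2) mod (b + 1))"
      unfolding bd(1) using remainder_large[OF d_def] by simp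
    have ge1: "1 \<le> real n * (real n / real b) ^ (L - 1)"
    proof -
      have "1 \<le> real n powr (1 - \<delta> * real (L - 1))" using n \<delta>(2) by (intro ge_one_powr_ge_zero) auto
      also have "\<dots> = real n * (1 ^ (L - 1) * real n powr (- (\<delta> * real (L - 1))))"
        using n by (simp add: powr_diff powr_minus divide_inverse)
      also have "\<dots> \<le> real n * (real n / real b) ^ (L - 1)"
        using ratio_power_ge[OF n(2) b0, of 1 \<delta> "L - 1"] b_le unfolding y_def by (intro mult_left_mono) auto
      finally show ?thesis .
    qed
    have big: "2 * ?K * (real n + (real n)\<^sup>2 * (real n / real b) ^ (L - 1)) \<le> real b"
    proof -
      have "(real n)\<^sup>2 * (real n / real b) ^ (L - 1) \<le> (real n)\<^sup>2 * (20 ^ (L - 1) * real n powr (- (\<delta> * real (L - 1))))"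
        using ratio_power_le[OF n(2) _ b0, of \<delta> 20 "L - 1"] b_ge unfolding y_def by (intro mult_left_mono) auto
      also have "\<dots> = 20 ^ (L - 1) * real n powr (2 - \<delta> * real (L - 1))"
        using n by (simp add: powr_diff powr_minus divide_inverse)
      finally have "2 * ?K * ((real n)\<^sup>2 * (real n / real b) ^ (L - 1)) \<le> 2 * ?K * (20 ^ (L - 1) * real n powr (2 - \<delta> * real (L - 1)))"
        using K by (intro mult_left_mono) auto
      also have "\<dots> \<le> y / 40" using elim(4) unfolding y_def by (simp add: mult.assoc)
      finally have 1: "2 * ?K * ((real n)\<^sup>2 * (real n / real b) ^ (L - 1)) \<le> y / 40" .
      have "2 * ?K * real n \<le> y / 40" using xy by (simp add: distrib_right)
      then show ?thesis using 1 b_ge by (simp add: distrib_left)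
    qed
    have "\<not> enforcer_wins V E n b"
    proof (rule avoider_avoids[OF _ nb n(2) ge1 big rem])
      show "1 \<le> L" using L(1) by simp
      fix A PP assume A: "A \<subseteq> complete_edges n" "forest_partition n A PP"
        and small: "\<And>X. X \<in> PP \<Longrightarrow> card X \<le> L"
      show "\<not> contains_copy {..<n} A V E"
        using L(2)
      proof
        assume "L = card E"
        then show ?thesis using no_copy_if_small_parts[OF A _ conn] small by simp
      next
        assume "has_cycle E"
        then show ?thesis by (rule no_copy_if_cycle[OF A _ V])
      qed
    qed
    then have "lower_threshold V E n \<le> b" using b0 by (intro lower_threshold_le) auto
    then show "real (lower_threshold V E n) \<le> real n powr (1 + \<delta>)"
      using b_le unfolding y_def by linarith
  qed
qed

lemma exists_balanced_roles:
  assumes V: "finite V" "V \<noteq> {}"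
  obtains role :: "nat \<Rightarrow> 'a" where "\<And>i. role i \<in> V"
    "\<And>v. v \<in> V \<Longrightarrow> n div card V \<le> card {x \<in> {..<n}. role x = v}"
proof -
  let ?h = "card V"
  have h: "0 < ?h" using V by (simp add: card_gt_0_iff)
  obtain g where g: "bij_betw g {0..<?h} V" using ex_bij_betw_nat_finite[OF V(1)] by blast
  define role where "role i = g (i mod ?h)" for i
  have "role i \<in> V" for i
  proof -
    have "i mod ?h \<in> {0..<?h}" using h by simp
    then show ?thesis using g unfolding role_def bij_betw_def by blast
  qed
  moreover have "n div ?h \<le> card {x \<in> {..<n}. role x = v}" if v: "v \<in> V" for v
  proof -
    have "v \<in> g ` {0..<?h}" using v g unfolding bij_betw_def by simp
    then obtain r where r: "r < ?h" "g r = v" by auto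
    have "inj_on (\<lambda>i. i * ?h + r) {..<n div ?h}" using h by (auto simp: inj_on_def)
    then have "n div ?h = card ((\<lambda>i. i * ?h + r) ` {..<n div ?h})" by (simp add: card_image)
    also have "\<dots> \<le> card {x \<in> {..<n}. role x = v}"
    proof (rule card_mono)
      show "(\<lambda>i. i * ?h + r) ` {..<n div ?h} \<subseteq> {x \<in> {..<n}. role x = v}"
      proof
        fix x assume "x \<in> (\<lambda>i. i * ?h + r) ` {..<n div ?h}"
        then obtain i where i: "i < n div ?h" "x = i * ?h + r" by blast
        have "x < (i + 1) * ?h" using i(2) r(1) by simp
        also have "\<dots> \<le> (n div ?h) * ?h" using i(1) by (intro mult_le_mono1) simp
        also have "\<dots> \<le> n" by simp
        finally have "x < n" .
        moreover have "x mod ?h = r" using i(2) r(1) by simp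
        ultimately show "x \<in> {x \<in> {..<n}. role x = v}" using r(2) unfolding role_def by simp
      qed
    qed simp
    finally show ?thesis .
  qed
  ultimately show thesis by (rule that)
qed

text \<open>The exponents bound the weights of proper subgraphs: \<open>card E - 1\<close> without a
  cycle, and \<open>2 * card E\<close> in general. As \<open>c\<close> depends on the target only,
  what remains is a comparison of exponents of \<open>n\<close>.\<close>

lemma enforcer_wins_if_large:
  fixes V :: "'a set"
  assumes conn: "connected_graph V E" and one: "at_most_one_cycle E" and E: "2 \<le> card E"
  obtains c :: real where "0 < c"
    "\<And>n b. 2 * card V \<le> n \<Longrightarrow> card V * n \<le> b \<Longrightarrow> 1 \<le> (n choose 2) mod (b + 1) \<Longrightarrow>
       \<not> has_cycle E \<and> 4 \<le> c * real n * (c * (real n / real b)) ^ (card E - 1) \<and>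
         real ((n choose 2) mod (b + 1)) \<le> c * real n \<or>
       even b \<and> 4 \<le> c * real n * (c * (real n / real b)) ^ (2 * card E) \<and>
         real ((n choose 2) mod (b + 1)) \<le> c * real n * (c * (real n / real b)) ^ (2 * card E) \<Longrightarrow>
       enforcer_wins V E n b"
proof -
  let ?k = "card E" and ?h = "card V"
  have V: "finite V" "V \<noteq> {}" "E \<subseteq> nsets V 2"
    using conn unfolding connected_graph_def simple_graph_def by simp_all
  have finE: "finite E" using E card.infinite by fastforce
  have h: "1 \<le> real ?h" using V by (simp add: Suc_le_eq card_gt_0_iff)
  \<comment> \<open>Then \<open>2 ^ card E * \<mu>\<close> is \<open>n / (2 * card V)\<close>, which
    each role class attains once \<open>n\<close> is at least \<open>2 * card V\<close>.\<close>
  define c1 where "c1 = 1 / (2 ^ ?k * (2 * real ?h))"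
  define D where "D = 80 * real ?k * 2 ^ (?h + 2 * ?k)"
  \<comment> \<open>This makes \<open>c * (n / b)\<close> the \<open>\<eta>\<close> of the locale;
    as \<open>c \<le> c1\<close>, also \<open>c * n\<close> is at most \<open>\<mu>\<close>.\<close>
  define c where "c = c1 / D"
  have c1: "0 < c1" unfolding c1_def using h by simp
  have "1 * 1 \<le> (80 * real ?k) * (2::real) ^ (?h + 2 * ?k)" using E by (intro mult_mono) auto
  then have D: "1 \<le> D" unfolding D_def by simp
  have c: "0 < c" "c \<le> c1" unfolding c_def using c1 D by (simp_all add: divide_le_eq mult_le_cancel_left1)
  show thesis
  proof (rule that[OF c(1)])
    fix n b
    assume n: "2 * ?h \<le> n" and b: "?h * n \<le> b" and \<rho>: "1 \<le> (n choose 2) mod (b + 1)"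
      and alt: "\<not> has_cycle E \<and> 4 \<le> c * real n * (c * (real n / real b)) ^ (?k - 1) \<and>
         real ((n choose 2) mod (b + 1)) \<le> c * real n \<or>
       even b \<and> 4 \<le> c * real n * (c * (real n / real b)) ^ (2 * ?k) \<and>
         real ((n choose 2) mod (b + 1)) \<le> c * real n * (c * (real n / real b)) ^ (2 * ?k)"
    have n0: "0 < real n" using n h by simp
    have "1 * n \<le> ?h * n" using h by (intro mult_le_mono1) simp
    then have nb: "real n \<le> real b" using b by linarith
    then have b0: "0 < real b" using n0 by linarith
    obtain role :: "nat \<Rightarrow> 'a" where role: "\<And>i. role i \<in> V"
      and bal: "\<And>v. v \<in> V \<Longrightarrow> n div ?h \<le> card {x \<in> {..<n}. role x = v}"
      using exists_balanced_roles[OF V(1,2), of n] by metis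
    define \<mu> where "\<mu> = c1 * real n"
    define \<eta> where "\<eta> = c * (real n / real b)"
    have \<mu>: "0 < \<mu>" unfolding \<mu>_def using c1 n0 by simp
    have \<eta>: "0 < \<eta>" unfolding \<eta>_def using c n0 b0 by simp
    have c_le_1: "c \<le> 1"
    proof -
      have ge: "1 * 1 \<le> (2::real) ^ ?k * (2 * real ?h)" using h by (intro mult_mono) auto
      have "c1 \<le> 1 / 1" unfolding c1_def by (rule frac_le) (use ge in linarith)+
      then show ?thesis using c by linarith
    qed
    have \<eta>1: "\<eta> \<le> 1"
    proof -
      have "\<eta> \<le> 1 * 1" unfolding \<eta>_def using c(1) c_le_1 nb b0 n0 by (intro mult_mono) auto
      then show ?thesis by simp
    qed
    have \<mu>_ge: "c * real n \<le> \<mu>" unfolding \<mu>_def using c n0 by (intro mult_right_mono) auto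
    have grow: "c * real n * \<eta> ^ m \<le> \<mu> * \<eta> ^ w" if "w \<le> m" for w m
      using \<mu> \<mu>_ge \<eta> \<eta>1 that c(1) n0 by (intro mult_mono power_decreasing) auto
    have weight_le: "weight ?k P \<le> (if has_cycle E then 2 * ?k else ?k - 1)" if P: "P \<subset> E" for P
    proof -
      have "card P < ?k" by (rule psubset_card_mono[OF finE P])
      moreover have "has_cycle P \<Longrightarrow> has_cycle E" using has_cycle_mono[of P E] P by blast
      ultimately show ?thesis unfolding weight_def by auto
    qed
    have weight_le': "weight ?k P \<le> 2 * ?k" if P: "P \<subset> E" for P
      using weight_le[OF P] by (auto split: if_splits)
    interpret enforcer_game V E n role b "(n choose 2) mod (b + 1)" \<mu> \<eta>
    proof
      show "connected_graph V E" "at_most_one_cycle E" "2 \<le> card E" "?h * n \<le> b"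
        "1 \<le> (n choose 2) mod (b + 1)" "0 < \<mu>" "\<And>i. i < n \<Longrightarrow> role i \<in> V"
        using conn one E b \<rho> \<mu> role by simp_all
      show "1 \<le> b" using b0 by linarith
      show "\<eta> = \<mu> / (80 * real b * real ?k * 2 ^ (?h + 2 * ?k))"
        unfolding \<eta>_def \<mu>_def c_def D_def by (simp add: mult_ac)
      show "card (complete_edges n) mod (b + 1) = (n choose 2) mod (b + 1)" by (simp add: card_nsets)
      show "4 \<le> \<mu> * \<eta> ^ weight ?k P" if P: "P \<subset> E" for P
        using alt
      proof
        assume A: "\<not> has_cycle E \<and> 4 \<le> c * real n * (c * (real n / real b)) ^ (?k - 1) \<and>
         real ((n choose 2) mod (b + 1)) \<le> c * real n"
        then have "weight ?k P \<le> ?k - 1" using weight_le[OF P] by simp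
        from grow[OF this] show ?thesis using A unfolding \<eta>_def by linarith
      next
        assume A: "even b \<and> 4 \<le> c * real n * (c * (real n / real b)) ^ (2 * ?k) \<and>
         real ((n choose 2) mod (b + 1)) \<le> c * real n * (c * (real n / real b)) ^ (2 * ?k)"
        from grow[OF weight_le'[OF P]] show ?thesis using A unfolding \<eta>_def by linarith
      qed
      show "\<not> has_cycle E \<and> real ((n choose 2) mod (b + 1)) \<le> \<mu> \<or>
        even b \<and> (\<forall>P. P \<subset> E \<longrightarrow> real ((n choose 2) mod (b + 1)) \<le> \<mu> * \<eta> ^ weight ?k P)"
        using alt
      proof
        assume "\<not> has_cycle E \<and> 4 \<le> c * real n * (c * (real n / real b)) ^ (?k - 1) \<and>
         real ((n choose 2) mod (b + 1)) \<le> c * real n"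
        then show ?thesis using \<mu>_ge by linarith
      next
        assume A: "even b \<and> 4 \<le> c * real n * (c * (real n / real b)) ^ (2 * ?k) \<and>
         real ((n choose 2) mod (b + 1)) \<le> c * real n * (c * (real n / real b)) ^ (2 * ?k)"
        have "real ((n choose 2) mod (b + 1)) \<le> \<mu> * \<eta> ^ weight ?k P" if P: "P \<subset> E" for P
          using grow[OF weight_le'[OF P]] A unfolding \<eta>_def by linarith
        then show ?thesis using A by simp
      qed
      show "2 ^ ?k * \<mu> \<le> real (card {x \<in> {..<n}. role x = v})" if v: "v \<in> V" for v
      proof -
        have "2 ^ ?k * \<mu> = real n / (2 * real ?h)" unfolding \<mu>_def c1_def by simp
        also have "\<dots> \<le> real (n div ?h)"
        proof -
          have "n < (n div ?h + 1) * ?h"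
            using dividend_less_div_times[of ?h n] h by (simp add: add.commute)
          moreover have "1 \<le> n div ?h" using n h by (simp add: Suc_le_eq div_greater_zero_iff)
          then have "(n div ?h + 1) * ?h \<le> (2 * (n div ?h)) * ?h" by (intro mult_le_mono1) simp
          moreover have "(2 * (n div ?h)) * ?h = n div ?h * (2 * ?h)" by (simp add: mult_ac)
          ultimately have "n \<le> n div ?h * (2 * ?h)" by linarith
          then have "real n \<le> real (n div ?h * (2 * ?h))" by (rule of_nat_mono)
          then show ?thesis using h by (simp add: pos_divide_le_eq)
        qed
        also have "\<dots> \<le> real (card {x \<in> {..<n}. role x = v})" by (intro of_nat_mono bal v)
        finally show ?thesis .
      qed
    qed
    show "enforcer_wins V E n b" by (rule enforcer_wins)
  qed
qed

text \<open>Write \<open>k\<close> for \<open>card E\<close>. Without a cycle a remainder of order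
  \<open>n powr (1 - \<delta>)\<close>, from \<open>remainder_small\<close>, is below
  \<open>c * n\<close>. With a cycle it may only have order
  \<open>n powr (1 - 2 * k * \<delta>)\<close>; \<open>remainder_tiny\<close> yields order
  \<open>n powr (2 * \<delta>)\<close>, and comparing exponents gives the factor
  \<open>2 * k + 2\<close>.\<close>

lemma eventually_upper_threshold_ge:
  assumes conn: "connected_graph V E" and one: "at_most_one_cycle E" and E: "2 \<le> card E"
    and \<delta>: "0 < \<delta>" "if has_cycle E then \<delta> * (2 * real (card E) + 2) < 1 else \<delta> * (real (card E) - 1) < 1"
  shows "\<forall>\<^sub>F n in sequentially. real n powr (1 + \<delta>) \<le> 16 * real (upper_threshold V E n)"
proof -
  let ?k = "card E" and ?h = "card V"
  have V: "E \<subseteq> Pow V" using conn unfolding connected_graph_def simple_graph_def nsets_def by blast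
  obtain c :: real where c: "0 < c"
    and wins: "\<And>n b. 2 * card V \<le> n \<Longrightarrow> card V * n \<le> b \<Longrightarrow> 1 \<le> (n choose 2) mod (b + 1) \<Longrightarrow>
       \<not> has_cycle E \<and> 4 \<le> c * real n * (c * (real n / real b)) ^ (card E - 1) \<and>
         real ((n choose 2) mod (b + 1)) \<le> c * real n \<or>
       even b \<and> 4 \<le> c * real n * (c * (real n / real b)) ^ (2 * card E) \<and>
         real ((n choose 2) mod (b + 1)) \<le> c * real n * (c * (real n / real b)) ^ (2 * card E) \<Longrightarrow>
       enforcer_wins V E n b"
    by (rule enforcer_wins_if_large[OF conn one E]) blast
  have lower: "C' * real n powr (1 - \<delta> * real m) \<le> c * real n * (c * (real n / b)) ^ m"
    if "1 \<le> n" "0 < b" "b \<le> C * real n powr (1 + \<delta>)" "0 < C" "C' = c * (c / C) ^ m" for C C' b n m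
  proof -
    have "C' * real n powr (1 - \<delta> * real m) = c * real n * (c ^ m * ((1 / C) ^ m * real n powr (- (\<delta> * real m))))"
      using that by (simp add: powr_diff powr_minus divide_inverse power_mult_distrib)
    also have "\<dots> \<le> c * real n * (c ^ m * (real n / b) ^ m)"
      using ratio_power_ge[OF that(1-4)] c by (intro mult_left_mono) auto
    finally show ?thesis by (simp only: power_mult_distrib)
  qed
  show ?thesis
  proof (cases "has_cycle E")
    case False
    have \<delta>k: "0 < 1 - \<delta> * real (?k - 1)" using \<delta>(2) False E by (simp add: of_nat_diff)
    have \<delta>1: "\<delta> < 1"
    proof -
      have "\<delta> * 1 \<le> \<delta> * real (?k - 1)" using \<delta>(1) E by (intro mult_left_mono) auto
      then show ?thesis using \<delta>k by linarith
    qed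
    define C' where "C' = c * (c / 1) ^ (?k - 1)"
    have C': "0 < C'" unfolding C'_def using c by simp
    have exps: "0 < 1 + \<delta>" "1 < 1 + \<delta>" "1 - \<delta> < 1 + \<delta>" "1 - \<delta> < 1" using \<delta>(1) by simp_all
    note ev = eventually_powr_le[OF exps(1), of 60] eventually_powr_le[OF exps(2), of "16 * real ?h"]
      eventually_powr_le[OF exps(3), of 40] eventually_powr_le[OF exps(4), of "2 / c"]
      eventually_powr_le[OF \<delta>k, of "4 / C'"] eventually_ge_at_top[of "2 * ?h + 2"]
    show ?thesis
      using ev
    proof eventually_elim
      case (elim n)
      define y where "y = real n powr (1 + \<delta>)"
      define p where "p = real n powr (1 - \<delta>)"
      define q where "q = nat \<lceil>p\<rceil>"
      define d where "d = ((n choose 2) - 1) div q"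
      define b where "b = d - 1"
      have n: "2 \<le> n" "1 \<le> n" "2 * ?h \<le> n" using elim(6) by simp_all
      have y60: "60 \<le> y" using elim(1) n unfolding y_def by simp
      have py: "40 * p \<le> y" using elim(3) unfolding y_def p_def .
      have p: "1 \<le> p" "p \<le> real q" "real q \<le> 2 * p"
        using ceiling_power_bounds[OF n(2), of "1 - \<delta>"] \<delta>1 unfolding p_def q_def by simp_all
      have q1: "1 \<le> q" using p by linarith
      have "p * y = real n powr 2" unfolding p_def y_def by (simp flip: powr_add)
      then have pxy: "p * y = real n * real n" using n by (simp add: power2_eq_square)
      have N2: "2 * real (n choose 2) = real n * (real n - 1)"
      proof -
        have "2 * real (n choose 2) = real (2 * (n choose 2))" by simp
        also have "\<dots> = real n * real (n - 1)" unfolding two_choose_two by (rule of_nat_mult)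
        finally show ?thesis using n by (simp add: of_nat_diff)
      qed
      have "real n * (real n / 2) \<le> real n * (real n - 1)" using n by (intro mult_left_mono) auto
      then have N_ge: "p * y / 4 \<le> real (n choose 2)" using N2 pxy by simp
      have N_le: "real (n choose 2) \<le> p * y"
      proof -
        have "real n * (real n - 1) \<le> real n * real n" by (intro mult_left_mono) auto
        then show ?thesis using N2 pxy by linarith
      qed
      have "1 * 60 \<le> p * y" using p y60 by (intro mult_mono) auto
      then have N1: "1 \<le> n choose 2" using N_ge by linarith
      have d_le: "real d \<le> y"
      proof -
        have "real d \<le> real ((n choose 2) - 1) / real q" unfolding d_def by (rule of_nat_div_le_of_nat)
        also have "\<dots> \<le> (p * y) / p" using N_le p by (intro frac_le) auto
        finally show ?thesis using p by simp
      qed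
      have d_ge: "y / 8 - 2 \<le> real d"
      proof -
        have "(n choose 2) - 1 < (d + 1) * q"
          unfolding d_def using dividend_less_div_times[of q "(n choose 2) - 1"] q1 by (simp add: add.commute)
        then have "n choose 2 \<le> (d + 1) * q" by linarith
        then have "real (n choose 2) \<le> real ((d + 1) * q)" by (rule of_nat_mono)
        also have "\<dots> = (real d + 1) * real q" unfolding of_nat_mult by simp
        also have "\<dots> \<le> (real d + 1) * (2 * p)" using p by (intro mult_left_mono) auto
        finally have "p * (y / 8) \<le> p * (real d + 1)" using N_ge by (simp add: algebra_simps)
        then have "y / 8 \<le> real d + 1" using p by (simp add: mult_le_cancel_left)
        then show ?thesis by simp
      qed
      have d1: "1 \<le> d" using d_ge y60 by linarith
      have bd: "b + 1 = d" "real b = real d - 1" unfolding b_def using d1 by simp_all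
      have b_ge: "y / 16 \<le> real b" using d_ge bd y60 by linarith
      have b_le: "real b \<le> y" using d_le bd by linarith
      have b0: "0 < real b" using b_ge y60 by linarith
      have "16 * real ?h * real n \<le> y" using elim(2) n unfolding y_def by simp
      then have "real (?h * n) \<le> real b" using b_ge by simp
      then have hb: "?h * n \<le> b" by (simp only: of_nat_le_iff)
      have "real q < real d" using p py b_ge bd y60 by linarith
      then have qd: "q < d" by simp
      note rem = remainder_small[OF d_def N1 q1 qd]
      have "2 / c * p \<le> real n" using elim(4) n unfolding p_def by simp
      then have "2 * p \<le> c * real n" using c by (simp add: field_simps)
      moreover have "real ((n choose 2) mod d) \<le> real q" using rem(2) by simp
      ultimately have \<rho>: "real ((n choose 2) mod d) \<le> c * real n" using p by linarith
      have "4 / C' \<le> real n powr (1 - \<delta> * real (?k - 1))" using elim(5) n by simp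
      then have "4 \<le> C' * real n powr (1 - \<delta> * real (?k - 1))" using C' by (simp add: field_simps)
      also have "\<dots> \<le> c * real n * (c * (real n / real b)) ^ (?k - 1)"
        by (rule lower[OF n(2) b0 _ zero_less_one C'_def]) (use b_le in \<open>simp add: y_def\<close>)
      finally have "enforcer_wins V E n b"
        using rem(1) \<rho> False unfolding bd(1)[symmetric] by (intro wins[OF n(3) hb]) simp_all
      then have "b \<le> upper_threshold V E n" by (rule le_upper_threshold[OF _ E V n(1)])
      then have "real b \<le> real (upper_threshold V E n)" by simp
      then show "real n powr (1 + \<delta>) \<le> 16 * real (upper_threshold V E n)"
        using b_ge unfolding y_def by linarith
    qed
  next
    case True
    have \<delta>k: "\<delta> * (2 * real ?k + 2) < 1" using \<delta>(2) True by simp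
    have \<delta>1: "\<delta> < 1"
    proof -
      have "\<delta> * 1 \<le> \<delta> * (2 * real ?k + 2)" using \<delta>(1) by (intro mult_left_mono) auto
      then show ?thesis using \<delta>k by linarith
    qed
    define C' where "C' = c * (c / 6) ^ (2 * ?k)"
    have C': "0 < C'" unfolding C'_def using c by simp
    have exps: "0 < 1 + \<delta>" "1 < 1 + \<delta>" "\<delta> < 1" "0 < 1 - \<delta> * real (2 * ?k)"
      "2 * \<delta> < 1 - \<delta> * real (2 * ?k)"
      using \<delta>(1) \<delta>1 \<delta>k by (simp_all add: algebra_simps)
    note ev = eventually_powr_le[OF exps(1), of 60] eventually_powr_le[OF exps(2), of "16 * real ?h"]
      eventually_powr_le[OF exps(3), of 8] eventually_powr_le[OF exps(4), of "4 / C'"]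
      eventually_powr_le[OF exps(5), of "36 / C'"] eventually_ge_at_top[of "2 * ?h + 2"]
    show ?thesis
      using ev
    proof eventually_elim
      case (elim n)
      define y where "y = real n powr (1 + \<delta>)"
      define z where "z = real n powr \<delta>"
      \<comment> \<open>This puts \<open>d\<close> between \<open>y\<close> and
        \<open>6 * y\<close>.\<close>
      define j where "j = nat \<lfloor>z\<rfloor>"
      define t where "t = 2 * (2 * j + 1)"
      have n: "2 \<le> n" "1 \<le> n" "2 * ?h \<le> n" using elim(6) by simp_all
      have y60: "60 \<le> y" using elim(1) n unfolding y_def by simp
      have z1: "1 \<le> z" unfolding z_def using n \<delta>(1) by (intro ge_one_powr_ge_zero) auto
      have j: "real j \<le> z" "z \<le> 2 * real j + 1" unfolding j_def using z1 by linarith+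
      have zy: "z * real n = y" unfolding z_def y_def using n by (simp add: powr_add)
      have t6: "real t \<le> 6 * z" unfolding t_def using j z1 by simp
      have "8 * z \<le> real n" using elim(3) n unfolding z_def by simp
      then have "real (t + 2) \<le> real n" using t6 z1 by simp
      then have tn: "t + 2 \<le> n" by (simp only: of_nat_le_iff)
      obtain d where d: "odd d" "(2 * j + 1) * n \<le> d" "d \<le> (2 * j + 1) * (2 * n)"
        and rem: "1 \<le> (n choose 2) mod d" "(n choose 2) mod d \<le> t * t"
        by (rule remainder_tiny[OF t_def tn])
      define b where "b = d - 1"
      have d1: "1 \<le> d" using d(1) by (metis dvd_0_right less_one not_le)
      have bd: "b + 1 = d" "real b = real d - 1" unfolding b_def using d1 by simp_all
      have d_ge: "y \<le> real d"
      proof -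
        have "y \<le> (2 * real j + 1) * real n" unfolding zy[symmetric] using j by (intro mult_right_mono) auto
        also have "\<dots> = real ((2 * j + 1) * n)" by (simp add: distrib_right)
        also have "\<dots> \<le> real d" by (rule of_nat_mono[OF d(2)])
        finally show ?thesis .
      qed
      have d_le: "real d \<le> 6 * y"
      proof -
        have "real d \<le> real ((2 * j + 1) * (2 * n))" by (rule of_nat_mono[OF d(3)])
        also have "\<dots> = (2 * real j + 1) * (2 * real n)" by (simp add: distrib_right)
        also have "\<dots> \<le> (3 * z) * (2 * real n)" using j z1 by (intro mult_right_mono) auto
        finally show ?thesis unfolding zy[symmetric] by simp
      qed
      have b_ge: "y / 16 \<le> real b" using d_ge bd y60 by linarith
      have b_le: "real b \<le> 6 * y" using d_le bd by linarith
      have b0: "0 < real b" using b_ge y60 by linarith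
      have "16 * real ?h * real n \<le> y" using elim(2) n unfolding y_def by simp
      then have "real (?h * n) \<le> real b" using b_ge by simp
      then have hb: "?h * n \<le> b" by (simp only: of_nat_le_iff)
      have "even b" using d(1) bd(1) by (metis even_plus_one_iff)
      have low: "C' * real n powr (1 - \<delta> * real (2 * ?k)) \<le> c * real n * (c * (real n / real b)) ^ (2 * ?k)"
        by (rule lower[OF n(2) b0 _ _ C'_def]) (use b_le in \<open>simp_all add: y_def\<close>)
      have "4 / C' \<le> real n powr (1 - \<delta> * real (2 * ?k))" using elim(4) n by simp
      then have "4 \<le> C' * real n powr (1 - \<delta> * real (2 * ?k))" using C' by (simp add: field_simps)
      then have four: "4 \<le> c * real n * (c * (real n / real b)) ^ (2 * ?k)" using low by linarith
      have "real ((n choose 2) mod d) \<le> real (t * t)" by (rule of_nat_mono[OF rem(2)])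
      also have "\<dots> = real t * real t" by (rule of_nat_mult)
      also have "\<dots> \<le> (6 * z) * (6 * z)" using t6 z1 by (intro mult_mono) auto
      also have "\<dots> = 36 * (z * z)" by simp
      also have "z * z = real n powr (2 * \<delta>)" unfolding z_def by (simp flip: powr_add)
      also have "36 * real n powr (2 * \<delta>) \<le> C' * real n powr (1 - \<delta> * real (2 * ?k))"
        using elim(5) C' by (simp add: field_simps)
      finally have "real ((n choose 2) mod d) \<le> c * real n * (c * (real n / real b)) ^ (2 * ?k)"
        using low by linarith
      then have "enforcer_wins V E n b"
        using rem(1) four \<open>even b\<close> unfolding bd(1)[symmetric] by (intro wins[OF n(3) hb]) simp_all
      then have "b \<le> upper_threshold V E n" by (rule le_upper_threshold[OF _ E V n(1)])
      then have "real b \<le> real (upper_threshold V E n)" by simp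
      then show "real n powr (1 + \<delta>) \<le> 16 * real (upper_threshold V E n)"
        using b_ge unfolding y_def by linarith
    qed
  qed
qed

theorem corollary1p5:
  fixes V :: "'a set" and E :: "'a set set"
  assumes "unicyclic V E \<or> (tree_graph V E \<and> card E \<ge> 2)"
  shows "(\<lambda>n. real (lower_threshold V E n)) \<in> o(\<lambda>n. real (upper_threshold V E n))"
proof -
  have conn: "connected_graph V E"
    using assms unfolding unicyclic_def tree_graph_def by blast
  have one: "at_most_one_cycle E"
    using assms unfolding unicyclic_def tree_graph_def at_most_one_cycle_def by blast
  have finE: "finite E"
    using conn finite_subset[of E "nsets V 2"] finite_imp_finite_nsets
    unfolding connected_graph_def simple_graph_def by blast
  have E: "2 \<le> card E"
  proof (cases "has_cycle E")
    case True
    then obtain vs where vs: "distinct vs" "3 \<le> length vs" "cyclic_edges vs \<subseteq> E"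
      unfolding has_cycle_def is_cycle_def by blast
    then show ?thesis using card_mono[OF finE vs(3)] card_cyclic_edges[OF vs(1,2)] by linarith
  next
    case False
    then show ?thesis using assms unfolding unicyclic_def has_cycle_def by blast
  qed
  \<comment> \<open>For a unicyclic graph acyclicity allows any \<open>L\<close> from 2 on; the
    chosen value makes \<open>1 / (L - 1)\<close> equal to \<open>1 / (2 * card E + 2)\<close>, the
    limit of Enforcer's range. For a tree both limits are \<open>1 / (card E - 1)\<close>.\<close>
  define L where "L = (if has_cycle E then 2 * card E + 3 else card E)"
  have L: "2 \<le> L" "L = card E \<or> has_cycle E" unfolding L_def using E by auto
  have "1 / real L < 1 / real (L - 1)" using L(1) by (intro divide_strict_left_mono) auto
  \<comment> \<open>\<open>\<delta>2\<close> serves Enforcer and the smaller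
    \<open>\<delta>1\<close> Avoider; the gap between them gives the little-o.\<close>
  then obtain \<delta>2 where \<delta>2: "1 / real L < \<delta>2" "\<delta>2 < 1 / real (L - 1)" using dense by blast
  obtain \<delta>1 where \<delta>1: "1 / real L < \<delta>1" "\<delta>1 < \<delta>2" using dense[OF \<delta>2(1)] by blast
  have "0 < 1 / real L" using L(1) by simp
  then have pos: "0 < \<delta>2" using \<delta>2(1) by linarith
  have L_pos: "0 < real L" "0 < real (L - 1)" using L(1) by simp_all
  have "1 < \<delta>1 * real L" using \<delta>1(1) L_pos by (simp add: pos_divide_less_eq)
  moreover have up: "\<delta>2 * real (L - 1) < 1" using \<delta>2(2) L_pos by (simp only: pos_less_divide_eq)
  moreover have "\<delta>1 * real (L - 1) \<le> \<delta>2 * real (L - 1)" using \<delta>1(2) by (intro mult_right_mono) auto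
  ultimately have "\<forall>\<^sub>F n in sequentially. real (lower_threshold V E n) \<le> real n powr (1 + \<delta>1)"
    by (intro eventually_lower_threshold_le[OF conn L]) auto
  then have "(\<lambda>n. real (lower_threshold V E n)) \<in> O(\<lambda>n. real n powr (1 + \<delta>1))"
    by (intro landau_o.big_mono) simp
  also have "(\<lambda>n. real n powr (1 + \<delta>1)) \<in> o(\<lambda>n. real n powr (1 + \<delta>2))"
    using powr_smallo_iff[of real sequentially "1 + \<delta>1" "1 + \<delta>2"] filterlim_real_sequentially \<delta>1(2) by simp
  also have "(\<lambda>n. real n powr (1 + \<delta>2)) \<in> O(\<lambda>n. real (upper_threshold V E n))"
  proof (rule bigoI[where c = 16])
    have "if has_cycle E then \<delta>2 * (2 * real (card E) + 2) < 1 else \<delta>2 * (real (card E) - 1) < 1"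
      using up E unfolding L_def by (auto simp: of_nat_diff add.commute)
    from eventually_upper_threshold_ge[OF conn one E pos this]
    show "\<forall>\<^sub>F n in sequentially. norm (real n powr (1 + \<delta>2)) \<le> 16 * norm (real (upper_threshold V E n))"
      by simp
  qed
  finally show ?thesis .
qed

end
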